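(* Let $l\geq 1$ be an odd integer and let $p\ge l^2+3l+5$ be a prime. Then there exists an infinite sequence of pairs of primes $\{(q_j,r_j)\}_{j=1}^{\infty}$ with $p<q_j$, $pq_j<r_j$ and $q_{j+1}>q_j$ for all $j$, such that $$\{a_{pq_jr_j}(k):k\geq 0\}=\Big\{-\frac{p-l-2}{2},-\frac{p-l-2}{2}+1,\dots,\frac{p+l+2}{2}\Big\}$$ (the set of all integers in the interval $[-(p-l-2)/2,(p+l+2)/2]$).
   Context: For a positive integer $n$, the $n$-th cyclotomic polynomial is $\Phi_n(x)=\prod_{1\le j\le n,\ \gcd(j,n)=1}(x-e^{2\pi i j/n})=\sum_{k=0}^{\varphi(n)}a_n(k)x^k$, and $a_n(k)=0$ for $k>\varphi(n)$. *)

theory Defs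
  imports Complex_Main "HOL-Computational_Algebra.Computational_Algebra"
begin

definition cyclotomic_poly :: "nat \<Rightarrow> complex poly" where
  "cyclotomic_poly n =
     (\<Prod>j\<in>{j\<in>{1..n}. coprime j n}. [:- exp (2 * of_real pi * \<i> * of_nat j / of_nat n), 1:])"

text \<open>
  The coefficients are complex numbers by construction; that they are integers is not
  built into the definition.
\<close>

definition cyclotomic_coeff :: "nat \<Rightarrow> nat \<Rightarrow> complex" where
  "cyclotomic_coeff n k = coeff (cyclotomic_poly n) k"

end

theory Submission
  imports "HOL-Number_Theory.Number_Theory" Defs
begin

text \<open>
  Since \<open>\<Phi>\<^sub>p\<^sub>q\<^sub>r(x) (1 - x^(p q)) = \<Phi>\<^sub>p\<^sub>q(x^r) (1 + x + \<dots> + x^(p - 1)) (1 - x^q)\<close> and \<open>r > p q\<close>, every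
  coefficient of \<open>\<Phi>\<^sub>p\<^sub>q\<^sub>r\<close> is a truncated sum of coefficients of \<open>\<Phi>\<^sub>p\<^sub>q\<close> that depends only on the truncation
  point \<open>N\<close>, on a residue \<open>t\<close> modulo \<open>p q\<close> and on \<open>r\<close> modulo \<open>p q\<close>. For fixed \<open>t\<close> it starts at 0 and
  changes by at most 1 with \<open>N\<close>, so the set of coefficients is an interval around 0.

  Let \<open>\<sigma> = (p + l + 2) / 2\<close> be the inverse of \<open>q\<close> modulo \<open>p\<close>, and let \<open>- d\<close> with \<open>0 < d \<le> p - \<sigma>\<close> be that
  of \<open>r\<close>. The sum splits into \<open>p\<close> differences, one for each residue \<open>\<beta>\<close> modulo \<open>p\<close>, which lie in \<open>{0, 1}\<close>
  if \<open>\<beta> < \<sigma>\<close> and in \<open>{-1, 0}\<close> otherwise; hence all coefficients lie in \<open>[\<sigma> - p, \<sigma>]\<close>. Both ends are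
  attained if \<open>d (l + 2) \<equiv> \<plusminus>2\<close> modulo \<open>p\<close>, so that \<open>d \<sigma> \<equiv> \<plusminus>1\<close> and \<open>\<beta>\<close> runs through consecutive values,
  and if the residue of \<open>r\<close> modulo \<open>q\<close> is chosen suitably; the bound on \<open>p\<close> is what gives
  \<open>l + 2 \<le> d \<le> p - \<sigma>\<close>.

  Primes \<open>q\<close> and \<open>r\<close> in the required classes come from Dirichlet's theorem, proved here by the
  elementary method of Mertens and Shapiro.
\<close>

section \<open>Sums over divisors\<close>

lemma divisors_prime_power_Suc_mult:
  fixes p m :: nat
  assumes "prime p" "\<not> p dvd m"
  shows "{d. d dvd p ^ Suc k * m} = {d. d dvd m} \<union> (*) p ` {d. d dvd p ^ k * m}"
proof (intro equalityI subsetI)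
  fix d assume d: "d \<in> {d. d dvd p ^ Suc k * m}"
  show "d \<in> {d. d dvd m} \<union> (*) p ` {d. d dvd p ^ k * m}"
  proof (cases "p dvd d")
    case True
    then obtain e where "d = p * e" by blast
    thus ?thesis using d assms(1) by (auto simp: mult.assoc)
  next
    case False
    hence "coprime d (p ^ Suc k)" using assms(1)
      by (meson coprime_commute coprime_power_right_iff prime_imp_coprime)
    thus ?thesis using d by (simp add: coprime_dvd_mult_right_iff)
  qed
qed (auto simp: mult.assoc)

lemma (in comm_monoid_set) divisors_prime_power_Suc_mult:
  fixes p m :: nat
  assumes p: "prime p" "\<not> p dvd m"
  shows "F g {d. d dvd p ^ Suc k * m} =
    F g {d. d dvd m} \<^bold>* F (\<lambda>d. g (p * d)) {d. d dvd p ^ k * m}"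
proof -
  have "m > 0" "p > 0" using p by (auto intro!: Nat.gr0I)
  hence "F g {d. d dvd p ^ Suc k * m} = F g {d. d dvd m} \<^bold>* F g ((*) p ` {d. d dvd p ^ k * m})"
    unfolding divisors_prime_power_Suc_mult[OF p]
    using p by (intro union_disjoint) (auto dest: dvd_mult_left)
  also have "F g ((*) p ` {d. d dvd p ^ k * m}) = F (\<lambda>d. g (p * d)) {d. d dvd p ^ k * m}"
    using \<open>p > 0\<close> by (subst reindex) (auto simp: inj_on_def comp_def)
  finally show ?thesis .
qed

lemma prime_power_mult_cases:
  fixes n :: nat
  assumes "n > 0"
  obtains (one) "n = 1"
  | (prime_power) p k m where "prime p" "\<not> p dvd m" "n = p ^ Suc k * m" "0 < m" "m < n"
proof (cases "n = 1")
  case False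
  then obtain p where p: "prime p" "p dvd n" using prime_factor_nat by blast
  then obtain m where m: "n = p ^ multiplicity p n * m" "\<not> p dvd m"
    using multiplicity_decompose'[of n p] assms by (auto simp: prime_nat_iff)
  obtain k where k: "multiplicity p n = Suc k"
    using p assms not_dvd_imp_multiplicity_0 prime_multiplicity_gt_zero_iff[of p n]
    by (auto simp: gr0_conv_Suc)
  have "m > 0" using m assms by (intro Nat.gr0I) auto
  moreover have "1 < p ^ Suc k" using p(1) by (intro one_less_power prime_gt_1_nat) auto
  ultimately have "m < n" using m(1) by (simp only: k n_less_n_mult_m mult.commute)
  thus ?thesis using prime_power[OF p(1) m(2)] m(1) \<open>m > 0\<close> by (simp only: k)
qed (use one in blast)

lemma sum_divisors_commute:
  fixes f :: "nat \<Rightarrow> nat \<Rightarrow> 'a::comm_monoid_add"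
  assumes "n > 0"
  shows "(\<Sum>d | d dvd n. \<Sum>e | e dvd n div d. f d e) = (\<Sum>e | e dvd n. \<Sum>d | d dvd n div e. f d e)"
proof -
  let ?S = "Sigma {d. d dvd n} (\<lambda>d. {e. e dvd n div d})"
  have fin: "finite {e. e dvd n div d}" if "d dvd n" for d
    using assms that by (auto elim!: dvdE)
  have "(\<Sum>d | d dvd n. \<Sum>e | e dvd n div d. f d e) = (\<Sum>(d, e)\<in>?S. f d e)"
    using assms fin by (intro sum.Sigma) auto
  also have "\<dots> = (\<Sum>(e, d)\<in>?S. f d e)"
    by (rule sum.reindex_bij_witness[where i = prod.swap and j = prod.swap])
       (use assms in \<open>auto elim!: dvdE simp: mult_ac\<close>)
  also have "\<dots> = (\<Sum>e | e dvd n. \<Sum>d | d dvd n div e. f d e)"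
    using assms fin by (intro sum.Sigma [symmetric]) auto
  finally show ?thesis .
qed

lemma sum_sum_divisors:
  fixes f :: "nat \<Rightarrow> nat \<Rightarrow> 'a::comm_monoid_add"
  shows "(\<Sum>n=1..x. \<Sum>d | d dvd n. f d (n div d)) = (\<Sum>d=1..x. \<Sum>m=1..x div d. f d m)"
proof -
  have le_of_mult_le: "b \<le> x" if "b * k \<le> x" "0 < k" for b k
    using that by (metis dvd_imp_le dvd_triv_left le_trans mult_eq_0_iff neq0_conv le0)
  have "(\<Sum>n=1..x. \<Sum>d | d dvd n. f d (n div d)) =
      (\<Sum>(n, d)\<in>Sigma {1..x} (\<lambda>n. {d. d dvd n}). f d (n div d))"
    by (rule sum.Sigma) auto
  also have "\<dots> = (\<Sum>(d, m)\<in>Sigma {1..x} (\<lambda>d. {1..x div d}). f d m)"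
    by (rule sum.reindex_bij_witness[where i = "\<lambda>(d, m). (d * m, d)" and j = "\<lambda>(n, d). (d, n div d)"])
       (auto simp: div_le_mono less_eq_div_iff_mult_less_eq mult.commute Suc_le_eq
         dest: dvd_imp_le intro: le_of_mult_le elim!: dvdE)
  also have "\<dots> = (\<Sum>d=1..x. \<Sum>m=1..x div d. f d m)"
    by (rule sum.Sigma [symmetric]) auto
  finally show ?thesis .
qed

section \<open>Sums of the von Mangoldt function\<close>

lemma ln_fact_eq_sum_ln: "ln (fact n :: real) = (\<Sum>k=1..n. ln (real k))"
  by (induction n) (simp_all add: ln_mult add.commute)

lemma ln_fact_eq_sum_mangoldt:
  assumes "n \<le> x"
  shows "ln (fact n) = (\<Sum>d=1..x. mangoldt d * real (n div d))"
proof -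
  have "ln (fact n :: real) = (\<Sum>k=1..n. \<Sum>d | d dvd k. mangoldt d)"
    unfolding ln_fact_eq_sum_ln by (intro sum.cong refl) (simp add: mangoldt_sum)
  also have "\<dots> = (\<Sum>d=1..n. \<Sum>m=1..n div d. mangoldt d)"
    by (rule sum_sum_divisors)
  also have "\<dots> = (\<Sum>d=1..n. mangoldt d * real (n div d))"
    by (simp add: mult.commute)
  also have "\<dots> = (\<Sum>d=1..x. mangoldt d * real (n div d))"
    using assms by (intro sum.mono_neutral_left) auto
  finally show ?thesis .
qed

lemma ln_fact_ge: "real n * ln (real n) - real n \<le> ln (fact n)"
proof (cases "n = 0")
  case False
  have "inverse (fact n) * real n ^ n \<le> exp (real n)"
    using sum_le_suminf[OF summable_exp, of "{n}" "real n"]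
    by (simp add: exp_def divide_inverse mult.commute)
  hence "ln (real n ^ n / fact n) \<le> ln (exp (real n))"
    using False by (subst ln_le_cancel_iff) (simp_all add: divide_inverse mult.commute)
  thus ?thesis using False by (simp add: ln_div ln_realpow)
qed auto

lemma ln_fact_le: "ln (fact n) \<le> real n * ln (real n)"
proof (cases "n = 0")
  case False
  have "ln (fact n :: real) \<le> ln (real n ^ n)"
    using fact_le_power[of n, where ?'a = real] False by (subst ln_le_cancel_iff) auto
  thus ?thesis using False by (simp add: ln_realpow)
qed auto

lemma ln_binomial_eq_sum_mangoldt:
  assumes "k \<le> n"
  shows "ln (real (n choose k)) =
    (\<Sum>d=1..n. mangoldt d * (real (n div d) - real (k div d) - real ((n - k) div d)))"
proof -
  have "ln (real (n choose k)) = ln (fact n) - ln (fact k) - ln (fact (n - k))"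
    using assms by (simp add: binomial_fact ln_div ln_mult)
  thus ?thesis
    using assms by (simp add: ln_fact_eq_sum_mangoldt[of _ n] sum_subtractf right_diff_distrib)
qed

definition chebyshev_psi :: "nat \<Rightarrow> real" where
  "chebyshev_psi x = (\<Sum>d=1..x. mangoldt d)"

lemma chebyshev_psi_mono: "x \<le> y \<Longrightarrow> chebyshev_psi x \<le> chebyshev_psi y"
  unfolding chebyshev_psi_def by (rule sum_mono2) (auto simp: mangoldt_nonneg)

lemma chebyshev_psi_double_le: "chebyshev_psi (2 * n) \<le> chebyshev_psi n + 2 * real n"
proof -
  define f where "f = (\<lambda>d. real (2 * n div d) - real (n div d) - real (n div d))"
  have f_nonneg: "0 \<le> f d" for d
    using div_add1_eq[of n n d] by (simp add: f_def flip: mult_2)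
  have f_eq_1: "f d = 1" if "d \<in> {Suc n..2 * n}" for d
  proof -
    have "2 * n div d = 1" using that by (intro div_nat_eqI) auto
    thus ?thesis using that by (simp add: f_def)
  qed
  have "chebyshev_psi (2 * n) - chebyshev_psi n = (\<Sum>d=Suc n..2*n. mangoldt d)"
    unfolding chebyshev_psi_def using sum.ub_add_nat[of 1 n "mangoldt :: nat \<Rightarrow> real" n]
    by (simp add: mult_2)
  also have "\<dots> = (\<Sum>d=Suc n..2*n. mangoldt d * f d)"
    by (intro sum.cong refl) (simp only: f_eq_1 mult_1_right)
  also have "\<dots> \<le> (\<Sum>d=1..2*n. mangoldt d * f d)"
    by (rule sum_mono2) (auto intro!: mult_nonneg_nonneg mangoldt_nonneg f_nonneg)
  also have "\<dots> = ln (real (2 * n choose n))"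
    by (simp add: f_def ln_binomial_eq_sum_mangoldt)
  also have "\<dots> \<le> ln (real (2 ^ (2 * n)))"
  proof -
    have "real (2 * n choose n) \<le> real (2 ^ (2 * n))"
      by (simp only: of_nat_le_iff binomial_le_pow2)
    thus ?thesis by (subst ln_le_cancel_iff) (auto simp: zero_less_binomial)
  qed
  also have "\<dots> = 2 * real n * ln 2" by (simp add: ln_realpow)
  also have "\<dots> \<le> 2 * real n * 1" using ln_2_less_1 by (intro mult_left_mono) auto
  finally show ?thesis by simp
qed

lemma chebyshev_psi_le: "chebyshev_psi x \<le> 6 * real x"
proof (induction x rule: less_induct)
  case (less x)
  consider (zero) "x = 0" | (one) "x = 1" | (greater) "x > 1" by linarith
  thus ?case
  proof cases
    case greater
    define n where "n = (x + 1) div 2"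
    have n: "n < x" "x \<le> 2 * n" "2 * n \<le> x + 1" using greater by (auto simp: n_def)
    have "chebyshev_psi x \<le> chebyshev_psi (2 * n)" using n by (intro chebyshev_psi_mono)
    also have "\<dots> \<le> chebyshev_psi n + 2 * real n" by (rule chebyshev_psi_double_le)
    also have "\<dots> \<le> 8 * real n" using less[OF n(1)] by simp
    also have "\<dots> \<le> 6 * real x" using n greater by linarith
    finally show ?thesis .
  qed (simp_all add: chebyshev_psi_def)
qed

lemma real_div_less_Suc_div:
  assumes "d > 0"
  shows "real x / real d < real (x div d) + 1"
proof -
  have "real x < real (d + x div d * d)"
    using dividend_less_div_times[OF assms, of x] by (simp only: of_nat_less_iff)
  thus ?thesis using assms by (simp add: field_simps)
qed

lemma sum_mangoldt_div_ge:
  assumes "x > 0"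
  shows "ln (real x) - 1 \<le> (\<Sum>d=1..x. mangoldt d / real d)"
proof -
  have "real x * (ln (real x) - 1) \<le> (\<Sum>d=1..x. mangoldt d * real (x div d))"
    using ln_fact_ge[of x] by (simp add: ln_fact_eq_sum_mangoldt[of x x] right_diff_distrib)
  also have "\<dots> \<le> (\<Sum>d=1..x. mangoldt d * (real x / real d))"
    by (intro sum_mono mult_left_mono mangoldt_nonneg of_nat_div_le_of_nat)
  also have "\<dots> = real x * (\<Sum>d=1..x. mangoldt d / real d)"
    by (simp add: sum_distrib_left field_simps)
  finally show ?thesis using assms by simp
qed

lemma sum_mangoldt_div_le:
  assumes "x > 0"
  shows "(\<Sum>d=1..x. mangoldt d / real d) \<le> ln (real x) + 6"
proof -
  have "real x * (\<Sum>d=1..x. mangoldt d / real d) = (\<Sum>d=1..x. mangoldt d * (real x / real d))"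
    by (simp add: sum_distrib_left field_simps)
  also have "\<dots> \<le> (\<Sum>d=1..x. mangoldt d * (real (x div d) + 1))"
    by (intro sum_mono mult_left_mono mangoldt_nonneg less_imp_le real_div_less_Suc_div) auto
  also have "\<dots> = ln (fact x) + chebyshev_psi x"
    by (simp add: ln_fact_eq_sum_mangoldt[of x x] chebyshev_psi_def distrib_left sum.distrib)
  also have "\<dots> \<le> real x * (ln (real x) + 6)"
    using ln_fact_le[of x] chebyshev_psi_le[of x] by (simp add: distrib_left)
  finally show ?thesis using assms by simp
qed

lemma sum_inverse_power_le:
  fixes y :: real
  assumes "y > 1"
  shows "(\<Sum>k=2..n. 1 / y ^ k) \<le> 1 / (y * (y - 1))"
proof (cases "n < 2")
  case False
  have "(\<Sum>k=2..n. 1 / y ^ k) = ((1 / y) ^ 2 - (1 / y) ^ Suc n) / (1 - 1 / y)"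
    using False assms sum_gp[of "1 / y" 2 n] by (simp add: power_one_over)
  also have "\<dots> \<le> (1 / y) ^ 2 / (1 - 1 / y)"
    using assms by (intro divide_right_mono) auto
  also have "\<dots> = 1 / (y * (y - 1))"
    using assms by (simp add: field_simps power2_eq_square)
  finally show ?thesis .
qed (use assms in auto)

lemma ln_div_mult_pred_le_telescope:
  fixes m :: nat
  assumes "m \<ge> 2"
  shows "ln (real m) / (real m * (real m - 1)) \<le>
    (ln (real (m - 1)) + 2) / real (m - 1) - (ln (real m) + 2) / real m"
proof -
  define n where "n = m - 1"
  have n: "m = Suc n" "real m = real n + 1" "n > 0" using assms by (auto simp: n_def)
  have "ln (real m) - ln (real n) = ln (1 + 1 / real n)"
    using n ln_div[of "real n + 1" "real n"] by (simp add: add_divide_distrib)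
  also have "\<dots> \<le> 1 / real n" by (rule ln_add_one_self_le_self) simp
  finally have "(real n + 1) * (ln (real m) - ln (real n)) \<le> (real n + 1) * (1 / real n)"
    by (intro mult_left_mono) auto
  also have "\<dots> \<le> 2" using n by (simp add: field_simps)
  finally have "ln (real m) \<le> (ln (real n) + 2) * real m - (ln (real m) + 2) * real n"
    by (simp add: n(2) algebra_simps)
  thus ?thesis using n(2,3) unfolding n_def [symmetric] by (simp add: divide_simps mult_ac)
qed

lemma sum_ln_div_mult_pred_le: "(\<Sum>m=2..x. ln (real m) / (real m * (real m - 1))) \<le> 2"
proof (cases "x \<ge> 2")
  case True
  let ?f = "\<lambda>m. (ln (real m) + 2) / real m"
  have "(\<Sum>m=2..x. ln (real m) / (real m * (real m - 1))) \<le> (\<Sum>m=Suc 1..x. ?f (m - 1) - ?f m)"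
    unfolding Suc_1 by (intro sum_mono ln_div_mult_pred_le_telescope) auto
  also have "\<dots> = ?f 1 - ?f x" using True sum_telescope''[of 1 x "\<lambda>m. - ?f m"] by simp
  also have "\<dots> \<le> 2" using True by simp
  finally show ?thesis .
qed auto

lemma sum_mangoldt_div_nonprime_le:
  "(\<Sum>d | d \<in> {1..x} \<and> \<not> prime d. mangoldt d / real d) \<le> 2"
proof -
  define I where "I = {m \<in> {2..x}. prime m} \<times> {2..x}"
  let ?g = "\<lambda>d. mangoldt d / real d" and ?pow = "\<lambda>(m, k). m ^ k :: nat"
  have "(\<Sum>d | d \<in> {1..x} \<and> \<not> prime d. ?g d) =
        (\<Sum>d | d \<in> {1..x} \<and> \<not> prime d \<and> primepow d. ?g d)"
    by (rule sum.mono_neutral_right) (auto simp: mangoldt_def)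
  also have "\<dots> \<le> sum ?g (?pow ` I)"
  proof (rule sum_mono2)
    show "{d. d \<in> {1..x} \<and> \<not> prime d \<and> primepow d} \<subseteq> ?pow ` I"
    proof safe
      fix d :: nat assume d: "d \<in> {1..x}" "\<not> prime d" "primepow d"
      then obtain m k where mk: "prime m" "k > 0" "d = m ^ k" by (auto simp: primepow_def)
      hence "2 \<le> m" "k \<noteq> 1" using d by (auto simp: prime_ge_2_nat)
      moreover have "m \<le> m ^ k" "k < m ^ k"
        using mk \<open>2 \<le> m\<close> by (auto intro: self_le_power power_gt_expt)
      ultimately have "(m, k) \<in> I" using mk d by (auto simp: I_def)
      thus "d \<in> ?pow ` I" using mk by force
    qed
  qed (auto simp: I_def intro!: divide_nonneg_nonneg mangoldt_nonneg)
  also have "\<dots> \<le> sum (?g \<circ> ?pow) I"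
    by (rule sum_image_le) (auto simp: I_def intro!: divide_nonneg_nonneg mangoldt_nonneg)
  also have "\<dots> = (\<Sum>(m, k)\<in>I. ln (real m) * (1 / real m ^ k))"
    by (rule sum.cong) (auto simp: I_def)
  also have "\<dots> = (\<Sum>m | m \<in> {2..x} \<and> prime m. ln (real m) * (\<Sum>k=2..x. 1 / real m ^ k))"
    unfolding I_def sum_distrib_left by (subst sum.cartesian_product) (auto simp: conj_commute)
  also have "\<dots> \<le> (\<Sum>m=2..x. ln (real m) * (\<Sum>k=2..x. 1 / real m ^ k))"
    by (intro sum_mono2) (auto intro!: mult_nonneg_nonneg sum_nonneg)
  also have "\<dots> \<le> (\<Sum>m=2..x. ln (real m) * (1 / (real m * (real m - 1))))"
    by (intro sum_mono mult_left_mono sum_inverse_power_le) auto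
  also have "\<dots> \<le> 2" using sum_ln_div_mult_pred_le by simp
  finally show ?thesis .
qed

lemma sum_mangoldt_div_le_primes:
  assumes "finite S" "A \<subseteq> {1..x}" "\<And>q. q \<in> A \<Longrightarrow> prime q \<Longrightarrow> q \<in> S"
  shows "(\<Sum>n\<in>A. mangoldt n / real n) \<le> (\<Sum>q\<in>S. mangoldt q / real q) + 2"
proof -
  let ?g = "\<lambda>n. mangoldt n / real n :: real" and ?T = "{d. d \<in> {1..x} \<and> \<not> prime d}"
  have nonneg: "0 \<le> ?g n" for n by (simp add: mangoldt_nonneg)
  have "sum ?g A \<le> sum ?g (S \<union> ?T)"
    using assms nonneg by (intro sum_mono2) auto
  also have "\<dots> \<le> sum ?g S + sum ?g ?T"
    using assms(1) nonneg by (simp add: sum_Un sum_nonneg)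
  also have "\<dots> \<le> sum ?g S + 2"
    using sum_mangoldt_div_nonprime_le by simp
  finally show ?thesis .
qed

section \<open>The Moebius function\<close>

definition moebius_mu :: "nat \<Rightarrow> real" where
  "moebius_mu n = (if squarefree n then (- 1) ^ card (prime_factors n) else 0)"

lemma abs_moebius_mu_le: "\<bar>moebius_mu n\<bar> \<le> 1"
  by (simp add: moebius_mu_def)

lemma moebius_mu_1 [simp]: "moebius_mu (Suc 0) = 1"
  by (simp add: moebius_mu_def)

lemma moebius_mu_prime_mult:
  assumes "prime p"
  shows "moebius_mu (p * n) = (if p dvd n then 0 else - moebius_mu n)"
proof (cases "p dvd n")
  case True
  hence "p ^ 2 dvd p * n" by (simp add: power2_eq_square)
  hence "\<not> squarefree (p * n)" using assms by (auto simp: squarefree_def)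
  thus ?thesis using True by (simp add: moebius_mu_def)
next
  case False
  hence "n \<noteq> 0" "coprime p n" using assms by (auto intro: prime_imp_coprime intro!: Nat.gr0I)
  hence "squarefree (p * n) \<longleftrightarrow> squarefree n"
    using assms by (auto simp: squarefree_prime intro: squarefree_mult_coprime dest: squarefree_multD)
  moreover have "prime_factors (p * n) = insert p (prime_factors n)"
    using assms \<open>n \<noteq> 0\<close> by (subst prime_factors_product) (auto simp: prime_factorization_prime)
  moreover have "p \<notin> prime_factors n" using False by auto
  ultimately show ?thesis using False by (simp add: moebius_mu_def)
qed

lemma sum_moebius_mu_divisors:
  assumes "n > 0"
  shows "(\<Sum>d | d dvd n. moebius_mu d) = of_bool (n = 1)"
  using assms
proof (cases rule: prime_power_mult_cases)
  case (prime_power p k m)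
  have "p > 0" using prime_power by (simp add: prime_gt_0_nat)
  have "(\<Sum>d | d dvd n. moebius_mu d) =
      (\<Sum>d | d dvd m. moebius_mu d) + (\<Sum>d | d dvd p ^ k * m. moebius_mu (p * d))"
    unfolding prime_power(3) using prime_power by (intro sum.divisors_prime_power_Suc_mult)
  also have "(\<Sum>d | d dvd p ^ k * m. moebius_mu (p * d)) = (\<Sum>d | d dvd m. - moebius_mu d)"
  proof (rule sum.mono_neutral_cong_right)
    have "coprime d (p ^ k)" if "\<not> p dvd d" for d
      using that prime_power(1) by (meson coprime_commute coprime_power_right_iff prime_imp_coprime)
    thus "\<forall>d\<in>{d. d dvd p ^ k * m} - {d. d dvd m}. moebius_mu (p * d) = 0"
      using prime_power(1) by (auto simp: moebius_mu_prime_mult coprime_dvd_mult_right_iff)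
  qed (use prime_power \<open>p > 0\<close> in \<open>auto simp: moebius_mu_prime_mult dest: dvd_trans\<close>)
  finally have "(\<Sum>d | d dvd n. moebius_mu d) = 0" by (simp add: sum_negf)
  moreover have "n \<noteq> 1" using prime_power(4,5) by simp
  ultimately show ?thesis by simp
qed auto

lemma sum_moebius_mu_ln_divisors:
  assumes "n > 0"
  shows "(\<Sum>d | d dvd n. moebius_mu d * ln (real d)) = - mangoldt n"
proof -
  have "(\<Sum>d | d dvd n. moebius_mu d * (ln (real n) - ln (real d))) =
        (\<Sum>d | d dvd n. \<Sum>e | e dvd n div d. moebius_mu d * mangoldt e)"
    using assms
    by (intro sum.cong refl) (auto elim!: dvdE simp: mangoldt_sum ln_mult simp flip: sum_distrib_left)
  also have "\<dots> = (\<Sum>e | e dvd n. \<Sum>d | d dvd n div e. moebius_mu d * mangoldt e)"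
    using assms by (rule sum_divisors_commute)
  also have "\<dots> = (\<Sum>e | e dvd n. if e = n then mangoldt n else 0)"
    using assms
    by (intro sum.cong refl)
       (auto elim!: dvdE simp: sum_moebius_mu_divisors simp flip: sum_distrib_right)
  also have "\<dots> = mangoldt n" using assms by simp
  also have "(\<Sum>d | d dvd n. moebius_mu d * (ln (real n) - ln (real d))) =
     ln (real n) * (\<Sum>d | d dvd n. moebius_mu d) - (\<Sum>d | d dvd n. moebius_mu d * ln (real d))"
    by (simp add: algebra_simps sum_subtractf sum_distrib_left)
  also have "ln (real n) * (\<Sum>d | d dvd n. moebius_mu d) = 0"
    using assms by (simp add: sum_moebius_mu_divisors)
  finally show ?thesis by simp
qed

section \<open>Dirichlet characters\<close>

definition dcharacter :: "nat \<Rightarrow> (nat \<Rightarrow> complex) \<Rightarrow> bool" where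
  "dcharacter N \<chi> \<longleftrightarrow> \<chi> 1 = 1 \<and> (\<forall>a b. \<chi> (a * b) = \<chi> a * \<chi> b) \<and> (\<forall>a. \<chi> (a mod N) = \<chi> a) \<and>
     (\<forall>a. \<chi> a = 0 \<longleftrightarrow> \<not> coprime a N)"

definition principal_dcharacter :: "nat \<Rightarrow> nat \<Rightarrow> complex" where
  "principal_dcharacter N a = of_bool (coprime a N)"

lemma dcharacter_principal: "dcharacter N (principal_dcharacter N)"
  by (cases "N = 0") (auto simp: dcharacter_def principal_dcharacter_def)

lemma dcharacter_times: "dcharacter N \<chi> \<Longrightarrow> dcharacter N \<psi> \<Longrightarrow> dcharacter N (\<lambda>a. \<chi> a * \<psi> a)"
  by (auto simp: dcharacter_def)

lemma dcharacter_cnj: "dcharacter N \<chi> \<Longrightarrow> dcharacter N (\<lambda>a. cnj (\<chi> a))"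
  by (auto simp: dcharacter_def)

context
  fixes N :: nat and \<chi> :: "nat \<Rightarrow> complex"
  assumes \<chi>: "dcharacter N \<chi>"
begin

lemma dcharacter_1: "\<chi> (Suc 0) = 1"
  using \<chi> by (simp add: dcharacter_def)

lemma dcharacter_mult: "\<chi> (a * b) = \<chi> a * \<chi> b"
  using \<chi> by (simp add: dcharacter_def)

lemma dcharacter_mod: "\<chi> (a mod N) = \<chi> a"
  using \<chi> by (simp add: dcharacter_def)

lemma dcharacter_eq_0_iff: "\<chi> a = 0 \<longleftrightarrow> \<not> coprime a N"
  using \<chi> by (simp add: dcharacter_def)

lemma dcharacter_cong: "[a = b] (mod N) \<Longrightarrow> \<chi> a = \<chi> b"
  by (metis cong_def dcharacter_mod)

lemma dcharacter_power: "\<chi> (a ^ k) = \<chi> a ^ k"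
  by (induction k) (simp_all add: dcharacter_1 dcharacter_mult)

lemma dcharacter_power_totient:
  assumes "coprime a N"
  shows "\<chi> a ^ totient N = 1"
  using dcharacter_cong[OF euler_theorem[OF assms]] by (simp add: dcharacter_power dcharacter_1)

context
  assumes N_pos: "N > 0"
begin

lemma norm_dcharacter: "norm (\<chi> a) = of_bool (coprime a N)"
proof (cases "coprime a N")
  case True
  have "norm (\<chi> a) ^ totient N = 1"
    using dcharacter_power_totient[OF True] by (metis norm_one norm_power)
  thus ?thesis using True N_pos power_eq_imp_eq_base[of "norm (\<chi> a)" "totient N" 1] by simp
qed (use dcharacter_eq_0_iff in auto)

lemma norm_dcharacter_le_1: "norm (\<chi> a) \<le> 1"
  by (simp add: norm_dcharacter)

lemma dcharacter_mult_cnj: "\<chi> a * cnj (\<chi> a) = of_bool (coprime a N)"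
  using norm_dcharacter[of a] by (simp flip: complex_norm_square)

lemma sum_dcharacter_eq_0:
  assumes "\<chi> \<noteq> principal_dcharacter N"
  shows "(\<Sum>k<N. \<chi> k) = 0"
proof -
  obtain b where "\<chi> b \<noteq> principal_dcharacter N b" using assms by blast
  hence b: "coprime b N" "\<chi> b \<noteq> 1"
    using dcharacter_eq_0_iff[of b] by (auto simp: principal_dcharacter_def split: if_splits)
  have "inj_on (\<lambda>k. b * k mod N) {..<N}"
  proof (rule inj_onI)
    fix x y assume xy: "x \<in> {..<N}" "y \<in> {..<N}" "b * x mod N = b * y mod N"
    hence "[x = y] (mod N)"
      using b(1) by (metis cong_def cong_mult_lcancel_nat)
    thus "x = y" using xy by (simp add: cong_def)
  qed
  hence bij: "bij_betw (\<lambda>k. b * k mod N) {..<N} {..<N}"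
    unfolding bij_betw_def using N_pos by (intro conjI endo_inj_surj) auto
  have "(\<Sum>k<N. \<chi> k) = (\<Sum>k<N. \<chi> (b * k mod N))"
    by (rule sum.reindex_bij_betw[OF bij, symmetric])
  also have "\<dots> = \<chi> b * (\<Sum>k<N. \<chi> k)"
    by (simp add: dcharacter_mod dcharacter_mult sum_distrib_left)
  finally show ?thesis using b(2) by (metis mult_cancel_right1)
qed

lemma sum_dcharacter_lessThan_mod:
  assumes "\<chi> \<noteq> principal_dcharacter N"
  shows "(\<Sum>k<m. \<chi> k) = (\<Sum>k<m mod N. \<chi> k)"
proof -
  have block: "(\<Sum>k = N * q..<N * q + r. \<chi> k) = (\<Sum>k<r. \<chi> k)" for q r
    unfolding sum.atLeastLessThan_shift_0[of \<chi> "N * q"] atLeast0LessThan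
    by (intro sum.cong refl) (auto intro!: dcharacter_cong simp: cong_def)
  have "(\<Sum>k<N * q. \<chi> k) = 0" for q
    using block[of _ N] sum_dcharacter_eq_0[OF assms] sum.nat_group[of \<chi> N q]
    by (simp add: mult.commute)
  hence "(\<Sum>k<N * q + r. \<chi> k) = (\<Sum>k<r. \<chi> k)" for q r
    using sum.atLeastLessThan_concat[of 0 "N * q" "N * q + r" \<chi>] block[of q r]
    by (simp add: atLeast0LessThan)
  from this[of "m div N" "m mod N"] show ?thesis by simp
qed

lemma norm_sum_dcharacter_le:
  assumes "\<chi> \<noteq> principal_dcharacter N"
  shows "norm (\<Sum>k=a..n. \<chi> k) \<le> 2 * real N"
proof -
  have bound: "norm (\<Sum>k<m. \<chi> k) \<le> real N" for m
  proof -
    have "norm (\<Sum>k<m. \<chi> k) \<le> (\<Sum>k<m mod N. 1)"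
      unfolding sum_dcharacter_lessThan_mod[OF assms, of m]
      by (intro sum_norm_le norm_dcharacter_le_1)
    also have "\<dots> \<le> real N" using N_pos by (simp add: less_imp_le)
    finally show ?thesis .
  qed
  show ?thesis
  proof (cases "a \<le> Suc n")
    case True
    have "(\<Sum>k=a..n. \<chi> k) = (\<Sum>k<Suc n. \<chi> k) - (\<Sum>k<a. \<chi> k)"
      using sum.atLeastLessThan_concat[of 0 a "Suc n" \<chi>] True
      by (simp add: atLeast0LessThan atLeastLessThanSuc_atLeastAtMost eq_diff_eq lessThan_Suc_atMost
          atMost_atLeast0 add.commute del: sum.lessThan_Suc)
    also have "norm \<dots> \<le> real N + real N"
      by (intro norm_triangle_le_diff add_mono bound)
    finally show ?thesis by simp
  qed auto
qed

end

end

lemma finite_dcharacters: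
  assumes "N > 0"
  shows "finite {\<chi>. dcharacter N \<chi>}"
proof (rule finite_imageD)
  define R where "R = insert 0 {z::complex. z ^ totient N = 1}"
  have "\<chi> a \<in> R" if "dcharacter N \<chi>" for \<chi> a
    using dcharacter_eq_0_iff[OF that] dcharacter_power_totient[OF that] by (auto simp: R_def)
  hence "(\<lambda>\<chi>. restrict \<chi> {..<N}) ` {\<chi>. dcharacter N \<chi>} \<subseteq> {..<N} \<rightarrow>\<^sub>E R"
    by (intro image_subsetI) (simp add: restrict_PiE_iff)
  moreover have "finite ({..<N} \<rightarrow>\<^sub>E R)"
    using assms by (intro finite_PiE) (auto simp: R_def finite_roots_unity Suc_le_eq)
  ultimately show "finite ((\<lambda>\<chi>. restrict \<chi> {..<N}) ` {\<chi>. dcharacter N \<chi>})"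
    by (rule finite_subset)
  show "inj_on (\<lambda>\<chi>. restrict \<chi> {..<N}) {\<chi>. dcharacter N \<chi>}"
  proof (rule inj_onI, rule ext)
    fix \<chi> \<psi> a
    assume char: "\<chi> \<in> {\<chi>. dcharacter N \<chi>}" "\<psi> \<in> {\<chi>. dcharacter N \<chi>}"
      and eq: "restrict \<chi> {..<N} = restrict \<psi> {..<N}"
    have "\<chi> (a mod N) = \<psi> (a mod N)"
      using fun_cong[OF eq, of "a mod N"] assms by simp
    thus "\<chi> a = \<psi> a" using char by (simp add: dcharacter_mod)
  qed
qed

text \<open>
  A partial character is a character of a subgroup of the units modulo \<open>N\<close>, the subgroup being given
  as a union \<open>H\<close> of residue classes. Residues are separated by extending partial characters one
  generator at a time.
\<close>

locale partial_dcharacter =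
  fixes N :: nat and H :: "nat set" and \<chi> :: "nat \<Rightarrow> complex"
  assumes N_pos: "N > 0"
    and coprime: "a \<in> H \<Longrightarrow> coprime a N"
    and one_closed: "1 \<in> H" and one: "\<chi> 1 = 1"
    and mult_closed: "a \<in> H \<Longrightarrow> b \<in> H \<Longrightarrow> a * b \<in> H"
    and mult: "a \<in> H \<Longrightarrow> b \<in> H \<Longrightarrow> \<chi> (a * b) = \<chi> a * \<chi> b"
    and cong_closed: "a \<in> H \<Longrightarrow> [a = b] (mod N) \<Longrightarrow> b \<in> H"
    and cong: "a \<in> H \<Longrightarrow> [a = b] (mod N) \<Longrightarrow> \<chi> a = \<chi> b"
begin

lemma power_closed: "a \<in> H \<Longrightarrow> a ^ k \<in> H"
  by (induction k) (auto simp: one_closed[simplified] mult_closed)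

lemma power: "a \<in> H \<Longrightarrow> \<chi> (a ^ k) = \<chi> a ^ k"
  by (induction k) (auto simp: one[simplified] mult power_closed)

lemma nonzero:
  assumes "a \<in> H"
  shows "\<chi> a \<noteq> 0"
proof -
  have "[1 = a ^ totient N] (mod N)"
    using coprime[OF assms] by (intro cong_sym[OF euler_theorem])
  hence "\<chi> a ^ totient N = 1"
    using cong[OF one_closed] one power[OF assms] by metis
  thus ?thesis using N_pos by (auto simp: power_0_left)
qed

lemma cancel_closed:
  assumes "a \<in> H" "b * a \<in> H"
  shows "b \<in> H"
proof (rule cong_closed)
  show "(b * a) * a ^ (totient N - 1) \<in> H"
    by (rule mult_closed[OF assms(2) power_closed[OF assms(1)]])
  have "totient N > 0" using N_pos by simp
  hence "(b * a) * a ^ (totient N - 1) = b * a ^ totient N"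
    by (simp add: mult.assoc flip: power_Suc)
  also have "[b * a ^ totient N = b * 1] (mod N)"
    using coprime[OF assms(1)] by (intro cong_mult euler_theorem) auto
  finally show "[(b * a) * a ^ (totient N - 1) = b] (mod N)" by simp
qed

lemma exists_index:
  assumes "coprime g N"
  obtains m where "m > 0" "\<And>j. g ^ j \<in> H \<longleftrightarrow> m dvd j"
proof -
  define m where "m = (LEAST m. m > 0 \<and> g ^ m \<in> H)"
  have "totient N > 0 \<and> g ^ totient N \<in> H"
    using N_pos cong_closed[OF one_closed, of "g ^ totient N"] euler_theorem[OF assms]
    by (auto simp: cong_sym_eq)
  hence m: "m > 0" "g ^ m \<in> H"
    using LeastI[of "\<lambda>m. m > 0 \<and> g ^ m \<in> H" "totient N"] by (auto simp: m_def)
  have "m dvd j" if "g ^ j \<in> H" for j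
  proof -
    have "g ^ j = g ^ (j mod m + m * (j div m))" by simp
    hence "g ^ j = g ^ (j mod m) * (g ^ m) ^ (j div m)" by (simp only: power_add power_mult)
    hence "g ^ (j mod m) \<in> H"
      using that cancel_closed[OF power_closed[OF m(2)]] by metis
    moreover have "j mod m < m" using m(1) by simp
    ultimately have "j mod m = 0"
      using not_less_Least[of "j mod m" "\<lambda>m. m > 0 \<and> g ^ m \<in> H"] by (auto simp: m_def)
    thus ?thesis by auto
  qed
  moreover have "g ^ j \<in> H" if "m dvd j" for j
    using that power_closed[OF m(2)] by (auto simp: power_mult elim!: dvdE)
  ultimately show ?thesis using that[OF m(1)] by blast
qed

context
  fixes g m :: nat and w :: complex
  assumes g: "coprime g N" and index: "\<And>j. g ^ j \<in> H \<longleftrightarrow> m dvd j" and w: "w ^ m = \<chi> (g ^ m)"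
begin

lemma extended_value_unique:
  assumes "h \<in> H" "h' \<in> H" "[g ^ i * h = g ^ j * h'] (mod N)"
  shows "w ^ i * \<chi> h = w ^ j * \<chi> h'"
  using assms
proof (induction i j arbitrary: h h' rule: linorder_wlog)
  case (le i j)
  define k where "k = j - i"
  have j: "j = i + k" using le by (simp add: k_def)
  have "[g ^ i * h = g ^ i * (g ^ k * h')] (mod N)"
    using le.prems(3) by (simp add: j power_add mult.assoc)
  hence h_cong: "[h = g ^ k * h'] (mod N)"
    using g by (simp add: cong_mult_lcancel_nat)
  hence "g ^ k * h' \<in> H" using le.prems(1) cong_closed by blast
  hence gk: "g ^ k \<in> H" using le.prems(2) cancel_closed by blast
  then obtain l where l: "k = m * l" using index by (auto elim: dvdE)
  have "\<chi> h = \<chi> (g ^ k) * \<chi> h'"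
    using cong[OF le.prems(1) h_cong] mult[OF gk le.prems(2)] by simp
  also have "\<chi> (g ^ k) = \<chi> ((g ^ m) ^ l)" by (simp add: l power_mult)
  also have "\<dots> = \<chi> (g ^ m) ^ l" by (rule power) (simp add: index)
  also have "\<dots> = w ^ k" by (simp only: w [symmetric] l power_mult)
  finally show ?case by (simp add: j power_add)
next
  case (sym i j)
  show ?case using sym.IH[OF sym.prems(2,1) cong_sym[OF sym.prems(3)]] by simp
qed

definition extended_domain :: "nat set" where
  "extended_domain = {x. \<exists>i h. h \<in> H \<and> [x = g ^ i * h] (mod N)}"

definition extended_value :: "nat \<Rightarrow> complex" where
  "extended_value x = (THE z. \<exists>i h. h \<in> H \<and> [x = g ^ i * h] (mod N) \<and> z = w ^ i * \<chi> h)"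

lemma extended_domainI: "h \<in> H \<Longrightarrow> [x = g ^ i * h] (mod N) \<Longrightarrow> x \<in> extended_domain"
  by (auto simp: extended_domain_def)

lemma extended_value_eq:
  assumes "h \<in> H" "[x = g ^ i * h] (mod N)"
  shows "extended_value x = w ^ i * \<chi> h"
  unfolding extended_value_def
proof (rule the_equality)
  fix z assume "\<exists>i h. h \<in> H \<and> [x = g ^ i * h] (mod N) \<and> z = w ^ i * \<chi> h"
  then obtain j h' where h': "h' \<in> H" "[x = g ^ j * h'] (mod N)" "z = w ^ j * \<chi> h'" by blast
  have "[g ^ j * h' = g ^ i * h] (mod N)" using assms(2) h'(2) by (metis cong_sym cong_trans)
  thus "z = w ^ i * \<chi> h" using extended_value_unique[OF h'(1) assms(1)] h'(3) by simp
qed (use assms in blast)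

lemma partial_dcharacter_extended: "partial_dcharacter N extended_domain extended_value"
proof
  show "N > 0" by (rule N_pos)
  show "coprime x N" if "x \<in> extended_domain" for x
  proof -
    obtain i h where "h \<in> H" "[x = g ^ i * h] (mod N)"
      using \<open>x \<in> extended_domain\<close> by (auto simp: extended_domain_def)
    thus ?thesis using g coprime[of h]
      by (metis cong_imp_coprime cong_sym coprime_mult_left_iff coprime_power_left_iff)
  qed
  have one_repr: "[1 = g ^ 0 * 1] (mod N)" by simp
  show "1 \<in> extended_domain" by (rule extended_domainI[OF one_closed one_repr])
  show "extended_value 1 = 1" using extended_value_eq[OF one_closed one_repr] one by simp
next
  fix x y assume "x \<in> extended_domain" "y \<in> extended_domain"
  then obtain i h j h'
    where h: "h \<in> H" "[x = g ^ i * h] (mod N)" and h': "h' \<in> H" "[y = g ^ j * h'] (mod N)"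
    by (auto simp: extended_domain_def)
  have "[x * y = (g ^ i * h) * (g ^ j * h')] (mod N)" by (intro cong_mult h h')
  hence prod_repr: "[x * y = g ^ (i + j) * (h * h')] (mod N)" by (simp add: power_add mult_ac)
  show "x * y \<in> extended_domain"
    by (rule extended_domainI[OF mult_closed[OF h(1) h'(1)] prod_repr])
  have "extended_value (x * y) = w ^ (i + j) * \<chi> (h * h')"
    by (rule extended_value_eq[OF mult_closed[OF h(1) h'(1)] prod_repr])
  thus "extended_value (x * y) = extended_value x * extended_value y"
    by (simp add: extended_value_eq[OF h] extended_value_eq[OF h'] mult[OF h(1) h'(1)] power_add)
next
  fix x y assume "x \<in> extended_domain" and xy: "[x = y] (mod N)"
  then obtain i h where h: "h \<in> H" "[x = g ^ i * h] (mod N)"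
    by (auto simp: extended_domain_def)
  have y: "[y = g ^ i * h] (mod N)" using h(2) xy by (metis cong_sym cong_trans)
  show "y \<in> extended_domain" by (rule extended_domainI[OF h(1) y])
  show "extended_value x = extended_value y"
    using extended_value_eq[OF h] extended_value_eq[OF h(1) y] by simp
qed

lemma exists_extension:
  "\<exists>H' \<chi>'. partial_dcharacter N H' \<chi>' \<and> insert g H \<subseteq> H' \<and> \<chi>' g = w \<and> (\<forall>h\<in>H. \<chi>' h = \<chi> h)"
proof (intro exI[of _ extended_domain] exI[of _ extended_value] conjI ballI)
  have g_repr: "[g = g ^ 1 * 1] (mod N)" and repr: "[h = g ^ 0 * h] (mod N)" for h by simp_all
  show "insert g H \<subseteq> extended_domain"
    using extended_domainI[OF one_closed g_repr] extended_domainI[OF _ repr] by blast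
  show "extended_value g = w" using extended_value_eq[OF one_closed g_repr] one by simp
  show "extended_value h = \<chi> h" if "h \<in> H" for h using extended_value_eq[OF that repr] by simp
qed (rule partial_dcharacter_extended)

end

end

lemma partial_dcharacter_extends_finite:
  assumes "partial_dcharacter N H \<chi>" "finite S" "\<And>g. g \<in> S \<Longrightarrow> coprime g N"
  shows "\<exists>H' \<chi>'. partial_dcharacter N H' \<chi>' \<and> H \<union> S \<subseteq> H' \<and> (\<forall>h\<in>H. \<chi>' h = \<chi> h)"
  using assms(2,3)
proof (induction S)
  case empty
  thus ?case using assms(1) by blast
next
  case (insert g S)
  then obtain H' \<chi>' where IH: "partial_dcharacter N H' \<chi>'" "H \<union> S \<subseteq> H'" "\<forall>h\<in>H. \<chi>' h = \<chi> h"
    by blast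
  interpret partial_dcharacter N H' \<chi>' by fact
  have g: "coprime g N" using insert.prems by simp
  obtain m where m: "m > 0" "\<And>j. g ^ j \<in> H' \<longleftrightarrow> m dvd j" using exists_index[OF g] by blast
  obtain w where "w ^ m = \<chi>' (g ^ m)" using nth_root_exists[OF m(1)] by blast
  from exists_extension[OF g m(2) this]
  obtain H'' \<chi>'' where H'': "partial_dcharacter N H'' \<chi>''" "insert g H' \<subseteq> H''"
    and agree: "\<forall>h\<in>H'. \<chi>'' h = \<chi>' h"
    by blast
  have "H \<union> insert g S \<subseteq> H''" using IH(2) H''(2) by blast
  moreover have "\<forall>h\<in>H. \<chi>'' h = \<chi> h" using IH(2,3) agree by auto
  ultimately show ?case using H''(1) by blast
qed

lemma partial_dcharacter_extends:
  assumes "partial_dcharacter N H \<chi>"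
  obtains \<psi> where "dcharacter N \<psi>" "\<And>h. h \<in> H \<Longrightarrow> \<psi> h = \<chi> h"
proof -
  have N_pos: "N > 0" using assms by (rule partial_dcharacter.N_pos)
  have "\<exists>H' \<chi>'. partial_dcharacter N H' \<chi>' \<and> H \<union> {a. a < N \<and> coprime a N} \<subseteq> H' \<and> (\<forall>h\<in>H. \<chi>' h = \<chi> h)"
    using assms by (rule partial_dcharacter_extends_finite) auto
  then obtain H' \<chi>' where H': "partial_dcharacter N H' \<chi>'" "{a. a < N \<and> coprime a N} \<subseteq> H'"
    and agree: "\<forall>h\<in>H. \<chi>' h = \<chi> h"
    by blast
  interpret extended: partial_dcharacter N H' \<chi>' by (rule H'(1))
  have mem: "a \<in> H'" if "coprime a N" for a
  proof (rule extended.cong_closed)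
    have "a mod N < N" "coprime (a mod N) N" using that N_pos by simp_all
    thus "a mod N \<in> H'" using H'(2) by blast
  qed simp
  define \<psi> where "\<psi> a = (if coprime a N then \<chi>' a else 0)" for a
  have "dcharacter N \<psi>"
    unfolding dcharacter_def
  proof (intro conjI allI)
    show "\<psi> 1 = 1" by (simp add: \<psi>_def extended.one[simplified])
    show "\<psi> (a * b) = \<psi> a * \<psi> b" for a b
      by (simp add: \<psi>_def extended.mult mem)
    show "\<psi> (a mod N) = \<psi> a" for a
      using extended.cong[OF mem, of a "a mod N"] N_pos by (simp add: \<psi>_def)
    show "\<psi> a = 0 \<longleftrightarrow> \<not> coprime a N" for a
      by (simp add: \<psi>_def extended.nonzero mem)
  qed
  moreover have "\<psi> h = \<chi> h" if "h \<in> H" for h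
    using that agree partial_dcharacter.coprime[OF assms] by (simp add: \<psi>_def)
  ultimately show ?thesis using that by blast
qed

lemma exists_dcharacter_neq_1:
  assumes "N > 0" "coprime a N" "\<not> [a = 1] (mod N)"
  obtains \<chi> where "dcharacter N \<chi>" "\<chi> a \<noteq> 1"
proof -
  interpret trivial: partial_dcharacter N "{x. [x = 1] (mod N)}" "\<lambda>_. 1"
  proof
    show "coprime x N" if "x \<in> {x. [x = 1] (mod N)}" for x
      using that cong_imp_coprime[of 1 x N] by (simp add: cong_sym_eq)
    show "x * y \<in> {x. [x = 1] (mod N)}"
      if "x \<in> {x. [x = 1] (mod N)}" "y \<in> {x. [x = 1] (mod N)}" for x y
      using cong_mult[of x 1 N y 1] that by simp
    show "y \<in> {x. [x = 1] (mod N)}" if "x \<in> {x. [x = 1] (mod N)}" "[x = y] (mod N)" for x y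
      using that by (metis cong_sym cong_trans mem_Collect_eq)
  qed (use assms in auto)
  define m where "m = ord N a"
  have "m > 0" "m \<noteq> 1"
    using assms by (auto simp: m_def coprime_commute ord_eq_Suc_0_iff)
  define w where "w = cis (2 * pi * real 1 / real m)"
  have "w ^ m = 1" using \<open>m > 0\<close> by (simp add: w_def DeMoivre)
  have "w \<noteq> cis (2 * pi * real 0 / real m)"
    unfolding w_def using bij_betw_roots_unity[OF \<open>m > 0\<close>] \<open>m > 0\<close> \<open>m \<noteq> 1\<close>
    by (subst inj_on_eq_iff[of _ "{..<m}"]) (auto simp: bij_betw_def)
  hence "w \<noteq> 1" by simp
  have "a ^ j \<in> {x. [x = 1] (mod N)} \<longleftrightarrow> m dvd j" for j
    using ord_divides[of a j N] by (simp add: m_def)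
  then obtain H \<chi> where "partial_dcharacter N H \<chi>" "a \<in> H" "\<chi> a = w"
    using trivial.exists_extension[OF assms(2), of m w] \<open>w ^ m = 1\<close> by auto
  then obtain \<psi> where "dcharacter N \<psi>" "\<psi> a = w"
    using partial_dcharacter_extends by metis
  thus ?thesis using that \<open>w \<noteq> 1\<close> by blast
qed

lemma sum_dcharacters:
  assumes N: "N > 0"
  shows "(\<Sum>\<chi> | dcharacter N \<chi>. \<chi> a) = of_nat (card {\<chi>. dcharacter N \<chi>}) * of_bool ([a = 1] (mod N))"
proof -
  consider (one) "[a = 1] (mod N)" | (other_unit) "coprime a N" "\<not> [a = 1] (mod N)"
    | (nonunit) "\<not> coprime a N"
    by blast
  thus ?thesis
  proof cases
    case one
    hence "\<chi> a = 1" if "dcharacter N \<chi>" for \<chi>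
      using dcharacter_cong[OF that one] dcharacter_1[OF that] by simp
    hence "(\<Sum>\<chi> | dcharacter N \<chi>. \<chi> a) = (\<Sum>\<chi> | dcharacter N \<chi>. 1)" by (intro sum.cong) auto
    thus ?thesis using one by simp
  next
    case other_unit
    obtain \<psi> where \<psi>: "dcharacter N \<psi>" "\<psi> a \<noteq> 1"
      using exists_dcharacter_neq_1[OF N other_unit] by blast
    have cancel: "\<psi> x * (cnj (\<psi> x) * \<chi> x) = \<chi> x" "cnj (\<psi> x) * (\<psi> x * \<chi> x) = \<chi> x"
      if "dcharacter N \<chi>" for \<chi> x
      using dcharacter_mult_cnj[OF \<psi>(1) N, of x] dcharacter_eq_0_iff[OF that, of x]
      by (auto simp flip: mult.assoc simp: mult.commute[of "cnj (\<psi> x)"])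
    have "(\<Sum>\<chi> | dcharacter N \<chi>. \<chi> a) = (\<Sum>\<chi> | dcharacter N \<chi>. \<psi> a * \<chi> a)"
      by (rule sum.reindex_bij_witness[where i = "\<lambda>\<chi> x. \<psi> x * \<chi> x" and j = "\<lambda>\<chi> x. cnj (\<psi> x) * \<chi> x"])
         (auto simp: cancel intro!: dcharacter_times \<psi> dcharacter_cnj)
    also have "\<dots> = \<psi> a * (\<Sum>\<chi> | dcharacter N \<chi>. \<chi> a)" by (simp add: sum_distrib_left)
    finally have "(\<Sum>\<chi> | dcharacter N \<chi>. \<chi> a) = 0" using \<psi>(2) by (metis mult_cancel_right1)
    thus ?thesis using other_unit(2) by simp
  next
    case nonunit
    hence "\<not> [a = 1] (mod N)" by (metis cong_imp_coprime cong_sym coprime_1_left)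
    moreover have "(\<Sum>\<chi> | dcharacter N \<chi>. \<chi> a) = 0"
      using nonunit by (intro sum.neutral) (simp add: dcharacter_eq_0_iff)
    ultimately show ?thesis by simp
  qed
qed

section \<open>Values of L-functions at 1\<close>

definition L_sum :: "(nat \<Rightarrow> complex) \<Rightarrow> nat \<Rightarrow> complex" where
  "L_sum \<chi> x = (\<Sum>n=1..x. \<chi> n / of_nat n)"

definition L_one :: "(nat \<Rightarrow> complex) \<Rightarrow> complex" where
  "L_one \<chi> = lim (L_sum \<chi>)"

definition mangoldt_sum :: "(nat \<Rightarrow> complex) \<Rightarrow> nat \<Rightarrow> complex" where
  "mangoldt_sum \<chi> x = (\<Sum>n=1..x. \<chi> n * mangoldt n / of_nat n)"

lemma norm_sum_scaleR_antimono_le: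
  fixes c :: "nat \<Rightarrow> 'a::real_normed_vector" and b :: "nat \<Rightarrow> real"
  assumes C: "\<And>n. norm (\<Sum>k=a..n. c k) \<le> C"
    and b: "\<And>k. a \<le> k \<Longrightarrow> b (Suc k) \<le> b k" "\<And>k. a \<le> k \<Longrightarrow> 0 \<le> b k"
    and "a \<le> n"
  shows "norm (\<Sum>k=a..n. b k *\<^sub>R c k) \<le> C * b a"
proof -
  define S where "S = (\<lambda>n. \<Sum>k=a..n. c k)"
  have "(\<Sum>k=a..n. b k *\<^sub>R c k) = b n *\<^sub>R S n + (\<Sum>k=a..<n. (b k - b (Suc k)) *\<^sub>R S k)"
    using \<open>a \<le> n\<close> by (induction n rule: dec_induct) (auto simp: S_def algebra_simps)
  also have "norm \<dots> \<le> norm (b n *\<^sub>R S n) + (\<Sum>k=a..<n. norm ((b k - b (Suc k)) *\<^sub>R S k))"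
    by (intro norm_triangle_mono order.refl norm_sum)
  also have "\<dots> \<le> b n * C + (\<Sum>k=a..<n. (b k - b (Suc k)) * C)"
    using b C \<open>a \<le> n\<close> by (intro add_mono sum_mono) (auto simp: S_def intro!: mult_left_mono)
  also have "(\<Sum>k=a..<n. (b k - b (Suc k)) * C) = (b a - b n) * C"
    using \<open>a \<le> n\<close> sum_Suc_diff'[of a n b]
    by (simp flip: sum_distrib_right add: sum_subtractf)
  also have "b n * C + \<dots> = C * b a" by (simp add: algebra_simps)
  finally show ?thesis .
qed

lemma ln_plus_1_over_antimono:
  fixes x y :: real
  assumes "1 \<le> x" "x \<le> y"
  shows "(ln y + 1) / y \<le> (ln x + 1) / x"
proof -
  have "ln (exp 1 * y) / (exp 1 * y) \<le> ln (exp 1 * x) / (exp 1 * x)"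
    using assms by (intro ln_x_over_x_mono) auto
  hence "exp 1 * (ln (exp 1 * y) / (exp 1 * y)) \<le> exp 1 * (ln (exp 1 * x) / (exp 1 * x))"
    by (intro mult_left_mono) auto
  thus ?thesis using assms by (simp add: ln_mult add.commute)
qed

locale nonprincipal_dcharacter =
  fixes N :: nat and \<chi> :: "nat \<Rightarrow> complex"
  assumes dcharacter: "dcharacter N \<chi>" and nonprincipal: "\<chi> \<noteq> principal_dcharacter N"
    and N_pos: "N > 0"
begin

lemma norm_sum_weighted_le:
  assumes "\<And>k. a \<le> k \<Longrightarrow> b (Suc k) \<le> b k" "\<And>k. a \<le> k \<Longrightarrow> 0 \<le> b k" "a \<le> n"
  shows "norm (\<Sum>k=a..n. \<chi> k * of_real (b k)) \<le> 2 * real N * b a"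
  using norm_sum_scaleR_antimono_le[where c = \<chi> and C = "2 * real N" and a = a and b = b and n = n] assms
    norm_sum_dcharacter_le[OF dcharacter N_pos nonprincipal]
  by (simp add: scaleR_conv_of_real mult.commute)

lemma norm_L_sum_diff_le:
  assumes "x \<le> y"
  shows "norm (L_sum \<chi> y - L_sum \<chi> x) \<le> 2 * real N / real (x + 1)"
proof (cases "x = y")
  case False
  have "L_sum \<chi> y = L_sum \<chi> x + (\<Sum>n=Suc x..y. \<chi> n / of_nat n)"
    unfolding L_sum_def using assms sum.ub_add_nat[of 1 x "\<lambda>n. \<chi> n / of_nat n" "y - x"] by simp
  hence "L_sum \<chi> y - L_sum \<chi> x = (\<Sum>n=Suc x..y. \<chi> n * of_real (1 / real n))"
    by simp
  also have "norm \<dots> \<le> 2 * real N * (1 / real (Suc x))"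
    using assms False by (intro norm_sum_weighted_le) (auto simp: field_simps)
  finally show ?thesis by simp
qed auto

lemma L_sum_tendsto: "L_sum \<chi> \<longlonglongrightarrow> L_one \<chi>"
proof -
  have "Cauchy (L_sum \<chi>)"
  proof (rule CauchyI')
    fix e :: real assume e: "e > 0"
    have "(\<lambda>x. 2 * real N / real (x + 1)) \<longlonglongrightarrow> 0"
      using LIMSEQ_Suc[OF lim_const_over_n[of "2 * real N"]] by simp
    hence "eventually (\<lambda>x. 2 * real N / real (x + 1) < e) sequentially"
      using e by (rule order_tendstoD)
    then obtain M where M: "\<And>x. x \<ge> M \<Longrightarrow> 2 * real N / real (x + 1) < e"
      by (auto simp: eventually_sequentially)
    show "\<exists>M. \<forall>m\<ge>M. \<forall>n>m. dist (L_sum \<chi> m) (L_sum \<chi> n) < e"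
    proof (intro exI[of _ M] allI impI)
      fix m n assume "M \<le> m" "m < n"
      thus "dist (L_sum \<chi> m) (L_sum \<chi> n) < e"
        using norm_L_sum_diff_le[of m n] M[of m] by (simp add: dist_norm norm_minus_commute)
    qed
  qed
  thus ?thesis unfolding L_one_def by (simp add: Cauchy_convergent_iff convergent_LIMSEQ_iff)
qed

lemma norm_L_one_diff_le: "norm (L_one \<chi> - L_sum \<chi> x) \<le> 2 * real N / real (x + 1)"
proof (rule Lim_bounded)
  show "(\<lambda>y. norm (L_sum \<chi> y - L_sum \<chi> x)) \<longlonglongrightarrow> norm (L_one \<chi> - L_sum \<chi> x)"
    by (intro tendsto_intros L_sum_tendsto)
  show "\<forall>y\<ge>x. norm (L_sum \<chi> y - L_sum \<chi> x) \<le> 2 * real N / real (x + 1)"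
    using norm_L_sum_diff_le by blast
qed

lemma norm_L_one_diff_div_le:
  assumes "x > 0" "d > 0"
  shows "norm (L_one \<chi> - L_sum \<chi> (x div d)) \<le> 2 * real N * (real d / real x)"
proof -
  have "real x \<le> real d * real (x div d + 1)"
    using real_div_less_Suc_div[OF assms(2), of x] assms by (simp add: field_simps)
  hence "1 / real (x div d + 1) \<le> real d / real x"
    using assms by (simp add: divide_simps mult.commute del: of_nat_add of_nat_Suc)
  hence "2 * real N * (1 / real (x div d + 1)) \<le> 2 * real N * (real d / real x)"
    by (rule mult_left_mono) simp
  thus ?thesis using norm_L_one_diff_le[of "x div d"] by simp
qed

lemma sum_divisor_sum_eq:
  fixes f :: "nat \<Rightarrow> real"
  shows "(\<Sum>n=1..x. \<chi> n / of_nat n * of_real (\<Sum>d | d dvd n. f d)) =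
    (\<Sum>d=1..x. \<chi> d * of_real (f d) / of_nat d * L_sum \<chi> (x div d))"
proof -
  have "(\<Sum>n=1..x. \<chi> n / of_nat n * of_real (\<Sum>d | d dvd n. f d)) =
      (\<Sum>n=1..x. \<Sum>d | d dvd n. (\<chi> d * of_real (f d) / of_nat d) * (\<chi> (n div d) / of_nat (n div d)))"
    unfolding of_real_sum sum_distrib_left
    by (intro sum.cong refl) (auto elim!: dvdE simp: dcharacter_mult[OF dcharacter])
  also have "\<dots> = (\<Sum>d=1..x. \<Sum>m=1..x div d. (\<chi> d * of_real (f d) / of_nat d) * (\<chi> m / of_nat m))"
    by (rule sum_sum_divisors)
  finally show ?thesis by (simp add: L_sum_def sum_distrib_left)
qed

lemma norm_sum_divisor_sum_diff_le:
  fixes f :: "nat \<Rightarrow> real"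
  assumes "x > 0"
  shows "norm ((\<Sum>n=1..x. \<chi> n / of_nat n * of_real (\<Sum>d | d dvd n. f d)) -
      L_one \<chi> * (\<Sum>d=1..x. \<chi> d * of_real (f d) / of_nat d)) \<le>
    2 * real N / real x * (\<Sum>d=1..x. \<bar>f d\<bar>)"
proof -
  have "(\<Sum>n=1..x. \<chi> n / of_nat n * of_real (\<Sum>d | d dvd n. f d)) -
      L_one \<chi> * (\<Sum>d=1..x. \<chi> d * of_real (f d) / of_nat d) =
      (\<Sum>d=1..x. \<chi> d * of_real (f d) / of_nat d * (L_sum \<chi> (x div d) - L_one \<chi>))"
    unfolding sum_divisor_sum_eq
    by (simp add: right_diff_distrib sum_subtractf sum_distrib_left mult.commute[of "L_one \<chi>"])
  also have "norm \<dots> \<le> (\<Sum>d=1..x. 2 * real N / real x * \<bar>f d\<bar>)"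
  proof (intro sum_norm_le)
    fix d assume d: "d \<in> {1..x}"
    have "norm (\<chi> d * of_real (f d) / of_nat d * (L_sum \<chi> (x div d) - L_one \<chi>)) =
        norm (\<chi> d) * (\<bar>f d\<bar> / real d) * norm (L_one \<chi> - L_sum \<chi> (x div d))"
      by (simp add: norm_mult norm_divide norm_minus_commute)
    also have "\<dots> \<le> 1 * (\<bar>f d\<bar> / real d) * (2 * real N * (real d / real x))"
      using d assms norm_dcharacter_le_1[OF dcharacter N_pos]
      by (intro mult_mono norm_L_one_diff_div_le) auto
    also have "\<dots> = 2 * real N / real x * \<bar>f d\<bar>" using d by simp
    finally show "norm (\<chi> d * of_real (f d) / of_nat d * (L_sum \<chi> (x div d) - L_one \<chi>)) \<le> \<dots>" .
  qed
  finally show ?thesis by (simp only: sum_distrib_left [symmetric])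
qed

lemma norm_sum_ln_le: "norm (\<Sum>n=1..x. \<chi> n / of_nat n * of_real (ln (real n))) \<le> 4 * real N"
proof (cases "x = 0")
  case False
  have "(\<Sum>n=1..x. \<chi> n / of_nat n * of_real (ln (real n))) =
      (\<Sum>n=1..x. \<chi> n * of_real ((ln (real n) + 1) / real n)) - (\<Sum>n=1..x. \<chi> n * of_real (1 / real n))"
    unfolding sum_subtractf [symmetric]
    by (intro sum.cong refl) (simp add: add_divide_distrib algebra_simps)
  also have "norm \<dots> \<le> 2 * real N * ((ln (real 1) + 1) / real 1) + 2 * real N * (1 / real 1)"
    using False
    by (intro norm_triangle_le_diff add_mono norm_sum_weighted_le ln_plus_1_over_antimono)
       (auto simp: field_simps)
  finally show ?thesis by simp
qed auto

lemma norm_L_one_mult_mangoldt_sum_le: "norm (L_one \<chi> * mangoldt_sum \<chi> x) \<le> 16 * real N"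
proof (cases "x = 0")
  case False
  let ?T = "\<Sum>n=1..x. \<chi> n / of_nat n * of_real (ln (real n))"
  have "(\<Sum>n=1..x. \<chi> n / of_nat n * of_real (\<Sum>d | d dvd n. mangoldt d)) = ?T"
    by (intro sum.cong refl) (simp add: mangoldt_sum)
  hence "norm (?T - L_one \<chi> * mangoldt_sum \<chi> x) \<le> 2 * real N / real x * chebyshev_psi x"
    using norm_sum_divisor_sum_diff_le[of x mangoldt] False
    by (simp add: mangoldt_sum_def chebyshev_psi_def)
  also have "\<dots> \<le> 2 * real N / real x * (6 * real x)"
    by (intro mult_left_mono chebyshev_psi_le) auto
  also have "\<dots> = 12 * real N" using False by simp
  finally have "norm (L_one \<chi> * mangoldt_sum \<chi> x - ?T) \<le> 12 * real N"
    by (simp only: norm_minus_commute)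
  thus ?thesis
    using norm_sum_ln_le[of x] norm_triangle_sub[of "L_one \<chi> * mangoldt_sum \<chi> x" ?T] by linarith
qed (simp add: mangoldt_sum_def)

lemma norm_mangoldt_sum_add_ln_le:
  assumes "L_one \<chi> = 0" "x > 0"
  shows "norm (mangoldt_sum \<chi> x + of_real (ln (real x))) \<le> 2 * real N"
proof -
  define f where "f d = moebius_mu d * (ln (real x) - ln (real d))" for d
  have divisor_sum: "(\<Sum>d | d dvd n. f d) = mangoldt n + of_bool (n = 1) * ln (real x)"
    if "n > 0" for n
    using sum_moebius_mu_divisors[OF that] sum_moebius_mu_ln_divisors[OF that]
    by (simp add: f_def right_diff_distrib sum_subtractf flip: sum_distrib_right)
  have "(\<Sum>n=1..x. \<chi> n / of_nat n * of_real (\<Sum>d | d dvd n. f d)) =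
      mangoldt_sum \<chi> x + (\<Sum>n=1..x. if n = 1 then of_real (ln (real x)) else 0)"
    unfolding mangoldt_sum_def sum.distrib [symmetric]
    by (intro sum.cong refl) (auto simp: divisor_sum distrib_left dcharacter_1[OF dcharacter])
  also have "(\<Sum>n=1..x. if n = 1 then of_real (ln (real x)) else 0) = (of_real (ln (real x)) :: complex)"
    using assms(2) by (subst sum.delta) auto
  finally have "norm (mangoldt_sum \<chi> x + of_real (ln (real x))) \<le>
      2 * real N / real x * (\<Sum>d=1..x. \<bar>f d\<bar>)"
    using norm_sum_divisor_sum_diff_le[OF assms(2), of f] assms(1) by simp
  also have "\<dots> \<le> 2 * real N / real x * real x"
  proof (rule mult_left_mono)
    have "(\<Sum>d=1..x. \<bar>f d\<bar>) \<le> (\<Sum>d=1..x. 1 * (ln (real x) - ln (real d)))"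
      unfolding f_def abs_mult by (intro sum_mono mult_mono abs_moebius_mu_le) auto
    also have "\<dots> = real x * ln (real x) - ln (fact x)"
      by (simp add: sum_subtractf ln_fact_eq_sum_ln)
    also have "\<dots> \<le> real x" using ln_fact_ge[of x] by simp
    finally show "(\<Sum>d=1..x. \<bar>f d\<bar>) \<le> real x" .
  qed simp
  finally show ?thesis using assms(2) by simp
qed

end

section \<open>Nonvanishing for real characters\<close>

lemma geometric_sum_ge:
  fixes u :: real
  assumes "0 \<le> u"
  shows "real n * u ^ (n - 1) \<le> (\<Sum>i<n. (u ^ 2) ^ i)"
proof -
  have "2 * (real n * u ^ (n - 1)) = (\<Sum>i<n. 2 * u ^ (n - 1))" by simp
  also have "\<dots> \<le> (\<Sum>i<n. (u ^ 2) ^ i + (u ^ 2) ^ (n - Suc i))"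
  proof (intro sum_mono)
    fix i assume "i \<in> {..<n}"
    hence "u ^ (n - 1) = u ^ i * u ^ (n - Suc i)" by (simp flip: power_add)
    thus "2 * u ^ (n - 1) \<le> (u ^ 2) ^ i + (u ^ 2) ^ (n - Suc i)"
      using sum_squares_bound[of "u ^ i" "u ^ (n - Suc i)"]
      by (simp add: power_mult [symmetric] mult_ac)
  qed
  also have "\<dots> = 2 * (\<Sum>i<n. (u ^ 2) ^ i)"
    by (simp add: sum.distrib sum.nat_diff_reindex)
  finally show ?thesis by simp
qed

lemma geometric_sum_mult_Suc_ge:
  fixes t :: real
  assumes "0 \<le> t" "t \<le> 1"
  shows "real n * real (Suc n) * t ^ n \<le> (\<Sum>i<n. t ^ i) * (\<Sum>i<Suc n. t ^ i)"
proof (cases "n = 0")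
  case False
  define u where "u = sqrt t"
  have u: "0 \<le> u" "u \<le> 1" "u ^ 2 = t" using assms by (auto simp: u_def)
  have "real n * real (Suc n) * t ^ n = real n * real (Suc n) * u ^ (2 * n)"
    by (simp add: power_mult u)
  also have "\<dots> \<le> real n * real (Suc n) * u ^ (2 * n - 1)"
    using u by (intro mult_left_mono power_decreasing) auto
  also have "\<dots> = (real n * u ^ (n - 1)) * (real (Suc n) * u ^ (Suc n - 1))"
    using False by (simp add: mult_ac mult_2_right flip: power_add)
  also have "\<dots> \<le> (\<Sum>i<n. t ^ i) * (\<Sum>i<Suc n. t ^ i)"
    unfolding u(3) [symmetric] using u(1)
    by (intro mult_mono geometric_sum_ge) (auto intro: sum_nonneg)
  finally show ?thesis .
qed simp

text \<open>
  If \<open>L(1, \<chi>) = 0\<close> for a real \<open>\<chi>\<close>, the Lambert series \<open>(1 - t) (\<Sum>n. \<chi> n t^n / (1 - t^n))\<close> equals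
  \<open>- (\<Sum>n. \<chi> n lambert_weight t n)\<close>, which is \<open>O(1 - t)\<close> by Abel summation. But the power series
  of the Lambert series has nonnegative coefficients that are at least 1 at squares.
\<close>

definition lambert_weight :: "real \<Rightarrow> nat \<Rightarrow> real" where
  "lambert_weight t n = 1 / real n - t ^ n / (\<Sum>i<n. t ^ i)"

context
  fixes t :: real
  assumes t: "0 < t" "t < 1"
begin

lemma geometric_sum_pos: "n > 0 \<Longrightarrow> 0 < (\<Sum>i<n. t ^ i)"
  using t by (intro sum_pos) auto

lemma lambert_weight_nonneg:
  assumes "n > 0"
  shows "0 \<le> lambert_weight t n"
proof -
  have "real n * t ^ n = (\<Sum>i<n. t ^ n)" by simp
  also have "\<dots> \<le> (\<Sum>i<n. t ^ i)" using t by (intro sum_mono power_decreasing) auto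
  finally show ?thesis
    using assms geometric_sum_pos[OF assms]
    by (simp add: lambert_weight_def divide_simps mult.commute)
qed

lemma lambert_weight_Suc_le:
  assumes "n > 0"
  shows "lambert_weight t (Suc n) \<le> lambert_weight t n"
proof -
  define G where "G = (\<lambda>n. \<Sum>i<n. t ^ i)"
  have pos: "0 < G n" "0 < G (Suc n)"
    using geometric_sum_pos[of n] geometric_sum_pos[of "Suc n"] assms
    by (simp_all add: G_def del: sum.lessThan_Suc)
  have G_Suc: "G (Suc n) = 1 + t * G n"
    unfolding G_def by (subst sum.lessThan_Suc_shift) (simp add: sum_distrib_left)
  have "lambert_weight t n - lambert_weight t (Suc n) =
      (1 / real n - 1 / real (Suc n)) - (t ^ n / G n - t ^ Suc n / G (Suc n))"
    by (simp add: lambert_weight_def G_def)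
  also have "1 / real n - 1 / real (Suc n) = 1 / (real n * real (Suc n))"
    using assms by (simp add: divide_simps)
  also have "t ^ n / G n - t ^ Suc n / G (Suc n) = t ^ n * (G (Suc n) - t * G n) / (G n * G (Suc n))"
    using pos by (simp add: diff_divide_distrib right_diff_distrib mult_ac)
  also have "\<dots> = t ^ n / (G n * G (Suc n))" by (simp add: G_Suc)
  finally have "lambert_weight t n - lambert_weight t (Suc n) =
      1 / (real n * real (Suc n)) - t ^ n / (G n * G (Suc n))" .
  moreover have "t ^ n / (G n * G (Suc n)) \<le> 1 / (real n * real (Suc n))"
    using geometric_sum_mult_Suc_ge[of t n] t assms pos
    by (subst frac_le_eq) (auto simp: G_def divide_simps mult_ac simp del: of_nat_Suc sum.lessThan_Suc)
  ultimately show ?thesis by linarith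
qed

lemma geometric_sum_eq_lambert_weight:
  assumes "d > 0"
  shows "(1 - t) * (\<Sum>m=1..y. t ^ (d * m)) =
    1 / real d - lambert_weight t d - t ^ (d * (y + 1)) / (\<Sum>i<d. t ^ i)"
proof -
  define G where "G = (\<Sum>i<d. t ^ i)"
  have G: "G > 0" "1 - t ^ d = (1 - t) * G"
    unfolding G_def using geometric_sum_pos[OF assms] one_diff_power_eq[of t d] by auto
  have "G * ((1 - t) * (\<Sum>m=1..y. (t ^ d) ^ m)) = (1 - t ^ d) * (\<Sum>m=1..y. (t ^ d) ^ m)"
    by (simp add: G(2))
  also have "\<dots> = t ^ d - (t ^ d) ^ Suc y"
    using sum_gp_multiplied[of 1 y "t ^ d"] by (cases "y = 0") auto
  finally have "(1 - t) * (\<Sum>m=1..y. (t ^ d) ^ m) = (t ^ d - (t ^ d) ^ Suc y) / G"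
    using G(1) by (simp add: eq_divide_eq mult.commute)
  thus ?thesis
    by (simp add: lambert_weight_def G_def diff_divide_distrib power_mult [symmetric] del: power_Suc)
qed

lemma lambert_remainder_bounds:
  assumes "d > 0"
  shows "0 \<le> t ^ (d * (x div d + 1)) / (\<Sum>i<d. t ^ i)" "t ^ (d * (x div d + 1)) / (\<Sum>i<d. t ^ i) \<le> t ^ x"
proof -
  show "0 \<le> t ^ (d * (x div d + 1)) / (\<Sum>i<d. t ^ i)"
    using t by (intro divide_nonneg_nonneg sum_nonneg) auto
  have "x \<le> d * (x div d + 1)"
    using dividend_less_div_times[OF assms, of x] by (simp add: algebra_simps)
  hence "t ^ (d * (x div d + 1)) \<le> t ^ x" using t by (intro power_decreasing) auto
  moreover have "1 \<le> (\<Sum>i<d. t ^ i)"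
    using member_le_sum[of 0 "{..<d}" "\<lambda>i. t ^ i"] assms t by simp
  ultimately have "t ^ (d * (x div d + 1)) / (\<Sum>i<d. t ^ i) \<le> t ^ x / 1"
    using t by (intro frac_le) auto
  thus "t ^ (d * (x div d + 1)) / (\<Sum>i<d. t ^ i) \<le> t ^ x" by simp
qed

end

locale sign_multiplicative =
  fixes h :: "nat \<Rightarrow> real"
  assumes mult: "h (a * b) = h a * h b" and one: "h 1 = 1" and range: "h a \<in> {-1, 0, 1}"
begin

definition divisor_sum :: "nat \<Rightarrow> real" where
  "divisor_sum n = (\<Sum>d | d dvd n. h d)"

lemma divisor_sum_1: "divisor_sum 1 = 1"
  by (simp add: divisor_sum_def one[simplified])

lemma divisor_sum_prime_power_Suc_mult:
  assumes "prime p" "\<not> p dvd m"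
  shows "divisor_sum (p ^ Suc k * m) = divisor_sum m + h p * divisor_sum (p ^ k * m)"
  unfolding divisor_sum_def sum.divisors_prime_power_Suc_mult[OF assms]
  by (simp add: mult sum_distrib_left)

lemma divisor_sum_prime_power_mult_bounds:
  assumes "prime p" "\<not> p dvd m" "0 \<le> divisor_sum m"
  shows "0 \<le> divisor_sum (p ^ k * m)" "even k \<Longrightarrow> divisor_sum m \<le> divisor_sum (p ^ k * m)"
proof -
  note Suc_eq = divisor_sum_prime_power_Suc_mult[OF assms(1,2)]
  have "0 \<le> divisor_sum (p ^ k * m) \<and> (even k \<longrightarrow> divisor_sum m \<le> divisor_sum (p ^ k * m))"
  proof -
    consider (zero) "h p = 0" | (plus) "h p = 1" | (minus) "h p = - 1" using range[of p] by auto
    thus ?thesis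
    proof cases
      case zero
      thus ?thesis using assms(3) Suc_eq by (cases k) auto
    next
      case plus
      have "divisor_sum m \<le> divisor_sum (p ^ k * m)"
        by (induction k) (use plus assms(3) Suc_eq in auto)
      thus ?thesis using assms(3) by auto
    next
      case minus
      have "divisor_sum (p ^ k * m) = (if even k then divisor_sum m else 0)"
        by (induction k) (use minus Suc_eq in auto)
      thus ?thesis using assms(3) by auto
    qed
  qed
  thus "0 \<le> divisor_sum (p ^ k * m)" "even k \<Longrightarrow> divisor_sum m \<le> divisor_sum (p ^ k * m)" by auto
qed

lemma divisor_sum_nonneg: "n > 0 \<Longrightarrow> 0 \<le> divisor_sum n"
proof (induction n rule: less_induct)
  case (less n)
  from less.prems show ?case
  proof (cases rule: prime_power_mult_cases)
    case (prime_power p k m)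
    thus ?thesis using less.IH[of m] divisor_sum_prime_power_mult_bounds(1)[of p m "Suc k"] by blast
  qed (use divisor_sum_1 in simp)
qed

lemma divisor_sum_square_ge: "s > 0 \<Longrightarrow> 1 \<le> divisor_sum (s ^ 2)"
proof (induction s rule: less_induct)
  case (less s)
  from less.prems show ?case
  proof (cases rule: prime_power_mult_cases)
    case (prime_power p k m)
    have "1 \<le> divisor_sum (m ^ 2)" using less.IH prime_power by blast
    also have "\<dots> \<le> divisor_sum (p ^ (2 * Suc k) * m ^ 2)"
      using prime_power
      by (intro divisor_sum_prime_power_mult_bounds(2) divisor_sum_nonneg) (auto dest: prime_dvd_power)
    also have "p ^ (2 * Suc k) * m ^ 2 = s ^ 2"
      unfolding prime_power(3) by (simp only: power_mult_distrib power_mult [symmetric] mult.commute)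
    finally show ?thesis .
  qed (use divisor_sum_1 in simp)
qed

lemma abs_sum_mult_lambert_weight_le:
  assumes t: "0 < t" "t < 1" and partial: "\<And>n. \<bar>\<Sum>k=1..n. h k\<bar> \<le> C" and x: "x > 0"
  shows "\<bar>\<Sum>d=1..x. lambert_weight t d * h d\<bar> \<le> C * (1 - t)"
proof -
  have "\<bar>\<Sum>d=1..x. lambert_weight t d * h d\<bar> \<le> C * lambert_weight t 1"
    using norm_sum_scaleR_antimono_le
        [where c = h and C = C and a = 1 and b = "lambert_weight t" and n = x]
      partial x lambert_weight_nonneg[OF t] lambert_weight_Suc_le[OF t] by auto
  thus ?thesis by (simp add: lambert_weight_def)
qed

lemma sum_divisor_sum_power_le:
  assumes t: "0 < t" "t < 1" and partial: "\<And>n. \<bar>\<Sum>k=1..n. h k\<bar> \<le> C"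
    and decay: "\<bar>\<Sum>n=1..x. h n / real n\<bar> \<le> C / real (x + 1)" and x: "x > 0"
  shows "(1 - t) * (\<Sum>n=1..x. divisor_sum n * t ^ n) \<le> C / real (x + 1) + C * (1 - t) + real x * t ^ x"
proof -
  let ?rem = "\<lambda>d. h d * (t ^ (d * (x div d + 1)) / (\<Sum>i<d. t ^ i))"
  have "(1 - t) * (\<Sum>n=1..x. divisor_sum n * t ^ n) =
      (1 - t) * (\<Sum>n=1..x. \<Sum>d | d dvd n. h d * t ^ (d * (n div d)))"
    unfolding divisor_sum_def sum_distrib_right
    by (intro arg_cong2[of _ _ _ _ "(*)"] sum.cong refl) auto
  also have "\<dots> = (1 - t) * (\<Sum>d=1..x. \<Sum>m=1..x div d. h d * t ^ (d * m))"
    by (subst sum_sum_divisors) (rule refl)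
  also have "\<dots> = (\<Sum>d=1..x. h d * ((1 - t) * (\<Sum>m=1..x div d. t ^ (d * m))))"
    by (simp add: sum_distrib_left mult_ac)
  also have "\<dots> = (\<Sum>d=1..x. h d / real d - lambert_weight t d * h d - ?rem d)"
    by (intro sum.cong[OF refl], subst geometric_sum_eq_lambert_weight[OF t])
       (auto simp: right_diff_distrib mult.commute)
  also have "\<dots> = (\<Sum>d=1..x. h d / real d) - (\<Sum>d=1..x. lambert_weight t d * h d) - (\<Sum>d=1..x. ?rem d)"
    by (simp add: sum_subtractf)
  also have "\<dots> \<le> C / real (x + 1) - (- (C * (1 - t))) - (- (real x * t ^ x))"
  proof (intro diff_mono)
    have "\<bar>\<Sum>d=1..x. ?rem d\<bar> \<le> (\<Sum>d=1..x. 1 * t ^ x)"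
    proof (intro order.trans[OF sum_abs] sum_mono)
      fix d assume "d \<in> {1..x}"
      thus "\<bar>?rem d\<bar> \<le> 1 * t ^ x"
        unfolding abs_mult using range[of d] t lambert_remainder_bounds[OF t, of d x]
        by (intro mult_mono) auto
    qed
    thus "- (real x * t ^ x) \<le> (\<Sum>d=1..x. ?rem d)" by simp
  qed (use decay abs_sum_mult_lambert_weight_le[OF t partial x] in \<open>simp_all add: abs_le_iff\<close>)
  finally show ?thesis by simp
qed

lemma sum_power_squares_le_sum_divisor_sum:
  assumes "0 \<le> t" "M ^ 2 \<le> x"
  shows "(\<Sum>s=1..M. t ^ (s ^ 2)) \<le> (\<Sum>n=1..x. divisor_sum n * t ^ n)"
proof -
  have "(\<Sum>s=1..M. t ^ (s ^ 2)) \<le> (\<Sum>s=1..M. divisor_sum (s ^ 2) * t ^ (s ^ 2))"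
    using divisor_sum_square_ge assms(1) by (intro sum_mono) (auto simp: mult_le_cancel_right1)
  also have "\<dots> = (\<Sum>n\<in>(\<lambda>s. s ^ 2) ` {1..M}. divisor_sum n * t ^ n)"
    by (subst sum.reindex) (auto simp: inj_on_def)
  also have "\<dots> \<le> (\<Sum>n=1..x. divisor_sum n * t ^ n)"
  proof (rule sum_mono2)
    have "1 \<le> s ^ 2 \<and> s ^ 2 \<le> x" if "s \<in> {1..M}" for s
      using that assms(2) order.trans[OF power_mono[of s M 2]] by auto
    thus "(\<lambda>s. s ^ 2) ` {1..M} \<subseteq> {1..x}" by auto
  qed (use divisor_sum_nonneg assms(1) in auto)
  finally show ?thesis .
qed

lemma sum_power_squares_le:
  assumes t: "0 < t" "t < 1" and partial: "\<And>n. \<bar>\<Sum>k=1..n. h k\<bar> \<le> C"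
    and decay: "\<And>x. \<bar>\<Sum>n=1..x. h n / real n\<bar> \<le> C / real (x + 1)"
  shows "(\<Sum>s=1..M. t ^ (s ^ 2)) \<le> C"
proof -
  have "(1 - t) * (\<Sum>s=1..M. t ^ (s ^ 2)) \<le> C * (1 - t)"
  proof (rule LIMSEQ_le_const)
    have "(\<lambda>x. C / real (x + 1)) \<longlonglongrightarrow> 0"
      using LIMSEQ_Suc[OF lim_const_over_n[of C]] by simp
    moreover have "(\<lambda>x. real x * t ^ x) \<longlonglongrightarrow> 0"
      using powser_times_n_limit_0[of t] t by simp
    ultimately have "(\<lambda>x. C / real (x + 1) + C * (1 - t) + real x * t ^ x) \<longlonglongrightarrow> 0 + C * (1 - t) + 0"
      by (intro tendsto_intros)
    thus "(\<lambda>x. C / real (x + 1) + C * (1 - t) + real x * t ^ x) \<longlonglongrightarrow> C * (1 - t)" by simp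
    show "\<exists>K. \<forall>x\<ge>K. (1 - t) * (\<Sum>s=1..M. t ^ (s ^ 2)) \<le> C / real (x + 1) + C * (1 - t) + real x * t ^ x"
    proof (intro exI[of _ "M ^ 2 + 1"] allI impI)
      fix x assume x: "M ^ 2 + 1 \<le> x"
      have "(1 - t) * (\<Sum>s=1..M. t ^ (s ^ 2)) \<le> (1 - t) * (\<Sum>n=1..x. divisor_sum n * t ^ n)"
        using t x by (intro mult_left_mono sum_power_squares_le_sum_divisor_sum) auto
      also have "\<dots> \<le> C / real (x + 1) + C * (1 - t) + real x * t ^ x"
        using x by (intro sum_divisor_sum_power_le t partial decay) auto
      finally show "(1 - t) * (\<Sum>s=1..M. t ^ (s ^ 2)) \<le> \<dots>" .
    qed
  qed
  thus ?thesis using t by (simp add: mult.commute)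
qed

lemma reciprocal_sum_exceeds:
  assumes "\<And>n. \<bar>\<Sum>k=1..n. h k\<bar> \<le> C"
  shows "\<exists>x. C / real (x + 1) < \<bar>\<Sum>n=1..x. h n / real n\<bar>"
proof (rule ccontr)
  assume "\<not> ?thesis"
  hence decay: "\<bar>\<Sum>n=1..x. h n / real n\<bar> \<le> C / real (x + 1)" for x by (simp add: not_less)
  obtain M :: nat where M: "C < real M" using reals_Archimedean2 by blast
  have "((\<lambda>t::real. \<Sum>s=1..M. t ^ (s ^ 2)) \<longlongrightarrow> (\<Sum>s=1..M. 1 ^ (s ^ 2))) (at_left 1)"
    by (intro tendsto_intros)
  moreover have "eventually (\<lambda>t::real. (\<Sum>s=1..M. t ^ (s ^ 2)) \<le> C) (at_left 1)"
    unfolding eventually_at_left_field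
    by (intro exI[of _ 0]) (use sum_power_squares_le assms decay in auto)
  ultimately have "(\<Sum>s=1..M. 1 ^ (s ^ 2)) \<le> C"
    by (intro tendsto_upperbound) auto
  thus False using M by simp
qed

end

context nonprincipal_dcharacter
begin

lemma L_one_nonzero_if_real:
  assumes real: "\<And>n. cnj (\<chi> n) = \<chi> n"
  shows "L_one \<chi> \<noteq> 0"
proof
  assume vanishing: "L_one \<chi> = 0"
  have Im: "Im (\<chi> n) = 0" for n using real[of n] by (simp add: complex_eq_iff)
  interpret sign_multiplicative "\<lambda>n. Re (\<chi> n)"
  proof
    show "Re (\<chi> (a * b)) = Re (\<chi> a) * Re (\<chi> b)" for a b
      by (simp add: dcharacter_mult[OF dcharacter] Im)
    show "Re (\<chi> 1) = 1" by (simp add: dcharacter_1[OF dcharacter])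
    show "Re (\<chi> a) \<in> {-1, 0, 1}" for a
      using norm_dcharacter[OF dcharacter N_pos, of a]
      by (cases "coprime a N") (auto simp: cmod_def Im)
  qed
  have "\<bar>\<Sum>k=1..n. Re (\<chi> k)\<bar> \<le> 2 * real N" for n
    using abs_Re_le_cmod[of "\<Sum>k=1..n. \<chi> k"]
      norm_sum_dcharacter_le[OF dcharacter N_pos nonprincipal, of 1 n]
    by simp
  then obtain x where "2 * real N / real (x + 1) < \<bar>\<Sum>n=1..x. Re (\<chi> n) / real n\<bar>"
    using reciprocal_sum_exceeds by blast
  also have "\<dots> \<le> norm (L_one \<chi> - L_sum \<chi> x)"
    using abs_Re_le_cmod[of "L_sum \<chi> x"] vanishing by (simp add: L_sum_def Re_divide_of_nat)
  also have "\<dots> \<le> 2 * real N / real (x + 1)" by (rule norm_L_one_diff_le)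
  finally show False by simp
qed

end

section \<open>Dirichlet's theorem\<close>

definition pole_order :: "nat \<Rightarrow> (nat \<Rightarrow> complex) \<Rightarrow> real" where
  "pole_order N \<chi> = (if \<chi> = principal_dcharacter N then 1 else if L_one \<chi> = 0 then - 1 else 0)"

lemma mangoldt_sum_principal_bounded:
  assumes "N > 0"
  shows "\<exists>B. \<forall>x>0. norm (mangoldt_sum (principal_dcharacter N) x - of_real (ln (real x))) \<le> B"
proof (intro exI allI impI)
  define K where "K = (\<Sum>p\<in>prime_factors N. mangoldt p / real p :: real)"
  have "K \<ge> 0" unfolding K_def by (intro sum_nonneg divide_nonneg_nonneg mangoldt_nonneg) auto
  fix x :: nat assume x: "x > 0"
  let ?g = "\<lambda>n. mangoldt n / real n :: real"
  define A where "A = {n \<in> {1..x}. \<not> coprime n N}"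
  have "0 \<le> sum ?g A" by (intro sum_nonneg divide_nonneg_nonneg mangoldt_nonneg) auto
  have "sum ?g A \<le> K + 2"
    unfolding K_def using assms
    by (intro sum_mangoldt_div_le_primes) (auto simp: A_def in_prime_factors_iff dest: prime_imp_coprime)
  have "mangoldt_sum (principal_dcharacter N) x = (\<Sum>n\<in>{1..x} - A. mangoldt n / of_nat n)"
    unfolding mangoldt_sum_def
    by (rule sum.mono_neutral_cong_right) (auto simp: A_def principal_dcharacter_def)
  also have "\<dots> = of_real (sum ?g ({1..x} - A))" by simp
  also have "sum ?g ({1..x} - A) = sum ?g {1..x} - sum ?g A"
    by (rule sum_diff) (auto simp: A_def)
  finally have "norm (mangoldt_sum (principal_dcharacter N) x - of_real (ln (real x))) =
      \<bar>sum ?g {1..x} - sum ?g A - ln (real x)\<bar>"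
    by (simp only: of_real_diff [symmetric] norm_of_real)
  also have "\<dots> \<le> K + 6"
    using sum_mangoldt_div_ge[OF x] sum_mangoldt_div_le[OF x] \<open>0 \<le> sum ?g A\<close> \<open>sum ?g A \<le> K + 2\<close> \<open>K \<ge> 0\<close>
    by (simp add: abs_le_iff)
  finally show "norm (mangoldt_sum (principal_dcharacter N) x - of_real (ln (real x))) \<le> K + 6" .
qed

lemma mangoldt_sum_bounded:
  assumes "N > 0" "dcharacter N \<chi>"
  shows "\<exists>B. \<forall>x>0. norm (mangoldt_sum \<chi> x - of_real (pole_order N \<chi> * ln (real x))) \<le> B"
proof (cases "\<chi> = principal_dcharacter N")
  case True
  thus ?thesis using mangoldt_sum_principal_bounded[OF assms(1)] by (simp add: pole_order_def)
next
  case False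
  then interpret nonprincipal_dcharacter N \<chi> using assms by unfold_locales
  show ?thesis
  proof (cases "L_one \<chi> = 0")
    case True
    thus ?thesis using norm_mangoldt_sum_add_ln_le False
      by (intro exI[of _ "2 * real N"]) (simp add: pole_order_def)
  next
    case nonzero: False
    have "norm (mangoldt_sum \<chi> x) \<le> 16 * real N / norm (L_one \<chi>)" for x
      using norm_L_one_mult_mangoldt_sum_le[of x] nonzero by (simp add: norm_mult field_simps)
    thus ?thesis using False nonzero by (auto simp: pole_order_def)
  qed
qed

lemma sum_dcharacters_mangoldt_sum:
  assumes "N > 0"
  shows "(\<Sum>\<chi> | dcharacter N \<chi>. \<chi> b * mangoldt_sum \<chi> x) =
    of_real (real (card {\<chi>. dcharacter N \<chi>}) *
      (\<Sum>n | n \<in> {1..x} \<and> [b * n = 1] (mod N). mangoldt n / real n))"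
proof -
  let ?X = "{\<chi>. dcharacter N \<chi>}"
  have "(\<Sum>\<chi>\<in>?X. \<chi> b * mangoldt_sum \<chi> x) = (\<Sum>\<chi>\<in>?X. \<Sum>n=1..x. \<chi> (b * n) * (mangoldt n / of_nat n))"
    by (intro sum.cong refl) (simp add: mangoldt_sum_def sum_distrib_left dcharacter_mult mult.assoc)
  also have "\<dots> = (\<Sum>n=1..x. (\<Sum>\<chi>\<in>?X. \<chi> (b * n)) * (mangoldt n / of_nat n))"
    by (subst sum.swap) (simp only: sum_distrib_right)
  also have "\<dots> = (\<Sum>n | n \<in> {1..x} \<and> [b * n = 1] (mod N). of_nat (card ?X) * (mangoldt n / of_nat n))"
    unfolding sum_dcharacters[OF assms] by (intro sum.mono_neutral_cong_right) auto
  finally show ?thesis by (simp add: sum_distrib_left)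
qed

lemma sum_mangoldt_residue_bounded:
  assumes "N > 0"
  shows "\<exists>B. \<forall>x>0. norm (of_real (real (card {\<chi>. dcharacter N \<chi>}) *
       (\<Sum>n | n \<in> {1..x} \<and> [b * n = 1] (mod N). mangoldt n / real n)) -
     (\<Sum>\<chi> | dcharacter N \<chi>. \<chi> b * of_real (pole_order N \<chi>)) * of_real (ln (real x))) \<le> B"
proof -
  let ?X = "{\<chi>. dcharacter N \<chi>}"
  have "\<forall>\<chi>\<in>?X. \<exists>B. \<forall>x>0. norm (mangoldt_sum \<chi> x - of_real (pole_order N \<chi> * ln (real x))) \<le> B"
    using mangoldt_sum_bounded[OF assms] by blast
  then obtain B where B: "\<And>\<chi> x. dcharacter N \<chi> \<Longrightarrow> x > 0 \<Longrightarrow>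
      norm (mangoldt_sum \<chi> x - of_real (pole_order N \<chi> * ln (real x))) \<le> B \<chi>"
    by (metis mem_Collect_eq)
  show ?thesis
  proof (intro exI allI impI)
    fix x :: nat assume x: "x > 0"
    have "norm (\<Sum>\<chi>\<in>?X. \<chi> b * (mangoldt_sum \<chi> x - of_real (pole_order N \<chi> * ln (real x)))) \<le>
        (\<Sum>\<chi>\<in>?X. 1 * B \<chi>)"
      using B[OF _ x] norm_dcharacter_le_1[OF _ assms]
      by (intro sum_norm_le) (auto simp: norm_mult intro!: mult_mono simp del: mult_1)
    thus "norm (of_real (real (card ?X) * (\<Sum>n | n \<in> {1..x} \<and> [b * n = 1] (mod N). mangoldt n / real n)) -
        (\<Sum>\<chi>\<in>?X. \<chi> b * of_real (pole_order N \<chi>)) * of_real (ln (real x))) \<le> (\<Sum>\<chi>\<in>?X. 1 * B \<chi>)"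
      unfolding sum_dcharacters_mangoldt_sum[OF assms, symmetric]
      by (simp add: right_diff_distrib sum_subtractf sum_distrib_right mult.assoc)
  qed
qed

lemma exists_ln_real_greater: "\<exists>x>0. B < ln (real x)"
proof -
  obtain x :: nat where x: "exp B < real x" using reals_Archimedean2 by blast
  hence "0 < real x" using exp_gt_zero less_trans by blast
  moreover have "B < ln (real x)"
    using x \<open>0 < real x\<close> by (metis exp_gt_zero ln_exp ln_less_cancel_iff)
  ultimately show ?thesis by auto
qed

text \<open>
  The case \<open>b = 1\<close> of the preceding asymptotics concerns a nonnegative quantity.
\<close>

lemma sum_pole_order_nonneg:
  assumes "N > 0"
  shows "0 \<le> (\<Sum>\<chi> | dcharacter N \<chi>. pole_order N \<chi>)"
proof (rule ccontr)
  define c where "c = (\<Sum>\<chi> | dcharacter N \<chi>. pole_order N \<chi>)"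
  assume "\<not> 0 \<le> (\<Sum>\<chi> | dcharacter N \<chi>. pole_order N \<chi>)"
  hence c: "c < 0" by (simp add: c_def)
  let ?S = "\<lambda>x. real (card {\<chi>. dcharacter N \<chi>}) *
      (\<Sum>n | n \<in> {1..x} \<and> [1 * n = 1] (mod N). mangoldt n / real n)"
  have c_eq: "(\<Sum>\<chi> | dcharacter N \<chi>. \<chi> 1 * of_real (pole_order N \<chi>)) = of_real c"
    unfolding c_def of_real_sum by (intro sum.cong refl) (simp add: dcharacter_1)
  obtain B where B: "\<And>x. x > 0 \<Longrightarrow>
      norm (of_real (?S x) - of_real c * of_real (ln (real x)) :: complex) \<le> B"
    using sum_mangoldt_residue_bounded[OF assms, of 1] unfolding c_eq by blast
  obtain x where x: "x > 0" "B / (- c) < ln (real x)" using exists_ln_real_greater by blast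
  have "0 \<le> ?S x"
    by (intro mult_nonneg_nonneg sum_nonneg divide_nonneg_nonneg mangoldt_nonneg) auto
  moreover have "\<bar>?S x - c * ln (real x)\<bar> \<le> B"
    using B[OF x(1)] by (simp only: of_real_mult [symmetric] of_real_diff [symmetric] norm_of_real)
  moreover have "B < - c * ln (real x)" using x(2) c by (simp add: field_simps)
  ultimately show False by linarith
qed

text \<open>
  Hence at most one nonprincipal character can satisfy \<open>L(1, \<chi>) = 0\<close>; since \<open>L(1, cnj \<chi>)\<close> then
  vanishes as well, such a character would be real.
\<close>

lemma (in nonprincipal_dcharacter) L_one_nonzero: "L_one \<chi> \<noteq> 0"
proof
  assume vanishing: "L_one \<chi> = 0"
  define \<psi> where "\<psi> = (\<lambda>n. cnj (\<chi> n))"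
  have \<chi>_eq: "\<chi> = (\<lambda>n. cnj (\<psi> n))" by (simp add: \<psi>_def)
  have "\<psi> \<noteq> principal_dcharacter N"
  proof
    assume "\<psi> = principal_dcharacter N"
    hence "\<chi> = principal_dcharacter N" unfolding \<chi>_eq by (simp add: principal_dcharacter_def fun_eq_iff)
    thus False using nonprincipal by blast
  qed
  then interpret conj: nonprincipal_dcharacter N \<psi>
    using dcharacter_cnj[OF dcharacter] N_pos by unfold_locales (simp_all add: \<psi>_def)
  have "L_sum \<psi> = (\<lambda>x. cnj (L_sum \<chi> x))" by (simp add: L_sum_def \<psi>_def fun_eq_iff)
  hence "L_sum \<psi> \<longlonglongrightarrow> cnj (L_one \<chi>)" using tendsto_cnj[OF L_sum_tendsto] by simp
  hence conj_vanishing: "L_one \<psi> = 0" using conj.L_sum_tendsto LIMSEQ_unique vanishing by fastforce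
  have "\<chi> \<noteq> \<psi>" using L_one_nonzero_if_real vanishing by (metis \<psi>_def)
  let ?X = "{\<chi>. dcharacter N \<chi>}" and ?T = "{principal_dcharacter N, \<chi>, \<psi>}"
  have T: "?T \<subseteq> ?X" using dcharacter conj.dcharacter dcharacter_principal by auto
  have "sum (pole_order N) ?X = sum (pole_order N) (?X - ?T) + sum (pole_order N) ?T"
    using T finite_dcharacters[OF N_pos] by (rule sum.subset_diff)
  also have "sum (pole_order N) ?T = - 1"
    using nonprincipal conj.nonprincipal \<open>\<chi> \<noteq> \<psi>\<close> vanishing conj_vanishing
    by (simp add: pole_order_def)
  also have "sum (pole_order N) (?X - ?T) \<le> 0"
    by (intro sum_nonpos) (auto simp: pole_order_def)
  finally show False using sum_pole_order_nonneg[OF N_pos] by simp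
qed

lemma pole_order_eq:
  assumes "N > 0" "dcharacter N \<chi>"
  shows "pole_order N \<chi> = of_bool (\<chi> = principal_dcharacter N)"
proof (cases "\<chi> = principal_dcharacter N")
  case False
  then interpret nonprincipal_dcharacter N \<chi> using assms by unfold_locales
  show ?thesis using False L_one_nonzero by (simp add: pole_order_def)
qed (simp add: pole_order_def)

theorem dirichlet_primes_in_progression:
  fixes N a :: nat
  assumes N: "N > 0" and a: "coprime a N"
  shows "infinite {p. prime p \<and> [p = a] (mod N)}"
proof
  let ?P = "{p. prime p \<and> [p = a] (mod N)}" and ?X = "{\<chi>. dcharacter N \<chi>}"
  assume fin: "finite ?P"
  obtain b where b: "[a * b = 1] (mod N)" using cong_solve_coprime_nat[OF a] by auto
  let ?A = "\<lambda>x. {n. n \<in> {1..x} \<and> [b * n = 1] (mod N)}"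
  have cong_a: "[n = a] (mod N)" if "[b * n = 1] (mod N)" for n
  proof -
    have "[a * (b * n) = a * 1] (mod N)" using that by (rule cong_scalar_left)
    moreover have "[(a * b) * n = 1 * n] (mod N)" using b by (rule cong_scalar_right)
    ultimately show ?thesis by (metis cong_sym cong_trans mult.assoc mult_1 mult.right_neutral)
  qed
  have "coprime b N" using b by (metis coprime_iff_invertible_nat mult.commute One_nat_def)
  hence "(\<Sum>\<chi>\<in>?X. \<chi> b * of_real (pole_order N \<chi>)) =
      (\<Sum>\<chi>\<in>?X. if \<chi> = principal_dcharacter N then 1 else 0)"
    by (intro sum.cong refl) (auto simp: pole_order_eq[OF N] principal_dcharacter_def)
  also have "\<dots> = 1" using finite_dcharacters[OF N] dcharacter_principal by simp
  finally have sum_eq: "(\<Sum>\<chi>\<in>?X. \<chi> b * of_real (pole_order N \<chi>)) = 1" .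
  obtain B where B: "\<And>x. x > 0 \<Longrightarrow>
      norm (of_real (real (card ?X) * (\<Sum>n\<in>?A x. mangoldt n / real n)) -
        1 * of_real (ln (real x)) :: complex) \<le> B"
    using sum_mangoldt_residue_bounded[OF N, of b] unfolding sum_eq by blast
  define K where "K = (\<Sum>q\<in>?P. mangoldt q / real q) + (2::real)"
  obtain x where x: "x > 0" "B + real (card ?X) * K < ln (real x)"
    using exists_ln_real_greater by blast
  have "ln (real x) - B \<le> real (card ?X) * (\<Sum>n\<in>?A x. mangoldt n / real n)"
    using abs_le_D2[OF B[OF x(1), unfolded mult_1 of_real_diff [symmetric] norm_of_real]] by linarith
  also have "\<dots> \<le> real (card ?X) * K"
    unfolding K_def using fin cong_a
    by (intro mult_left_mono sum_mangoldt_div_le_primes[of ?P "?A x" x]) auto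
  finally show False using x(2) by simp
qed

lemma exists_prime_inverse_mod:
  fixes s m :: int
  assumes "m > 0" "coprime s m"
  obtains r :: nat where "prime r" "r > M" "[int r * s = 1] (mod m)"
proof -
  obtain n where m: "m = int n" "n > 0" using assms(1) zero_less_imp_eq_int by blast
  obtain a where a: "[s * a = 1] (mod m)" using cong_solve_coprime_int[OF assms(2)] by blast
  define b where "b = nat (a mod m)"
  have "[int b = a] (mod m)" using assms(1) by (simp add: b_def cong_def)
  hence b: "[int b * s = 1] (mod m)"
    using a by (metis cong_scalar_right cong_trans mult.commute)
  hence "coprime (int b) (int n)" unfolding m(1) by (metis coprime_iff_invertible_int)
  hence "infinite {r. prime r \<and> [r = b] (mod n)}"
    using m(2) by (intro dirichlet_primes_in_progression) auto
  then obtain r where r: "prime r" "[r = b] (mod n)" "r > M"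
    unfolding infinite_nat_iff_unbounded by blast
  have "[int r = int b] (mod m)" unfolding m(1) using r(2) by (simp only: cong_int_iff)
  hence "[int r * s = 1] (mod m)" using b by (metis cong_scalar_right cong_trans)
  thus ?thesis using that r by blast
qed

section \<open>Cyclotomic polynomials\<close>

lemma cyclotomic_poly_altdef:
  "cyclotomic_poly n = (\<Prod>j\<in>{j\<in>{1..n}. coprime j n}. [:- cis (2 * pi * real j / real n), 1:])"
  by (simp add: cyclotomic_poly_def cis_conv_exp mult_ac)

lemma cyclotomic_poly_nonzero: "cyclotomic_poly n \<noteq> 0"
  by (simp add: cyclotomic_poly_def)

lemma monom_minus_1_nonzero:
  assumes "n > 0"
  shows "monom 1 n - 1 \<noteq> (0 :: 'a::comm_ring_1 poly)"
proof
  assume "monom 1 n - 1 = (0 :: 'a poly)"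
  hence "coeff (monom 1 n - 1 :: 'a poly) n = 0" by simp
  thus False using assms by simp
qed

lemma pcompose_monom_monom:
  fixes c :: "'a::comm_semiring_1"
  shows "pcompose (monom c n) (monom 1 r) = monom c (r * n)"
proof (induction n)
  case (Suc n)
  thus ?case by (simp add: monom_Suc pcompose_pCons mult_monom)
qed (simp add: monom_0)

lemma pcompose_monom_minus_1:
  "pcompose (monom 1 n - 1 :: 'a::comm_ring_1 poly) (monom 1 r) = monom 1 (r * n) - 1"
  by (simp add: pcompose_diff pcompose_monom_monom pcompose_1)

lemma monom_minus_1_eq_prod:
  assumes "n > 0"
  shows "monom 1 n - 1 = (\<Prod>k\<in>{1..n}. [:- cis (2 * pi * real k / real n), 1:])"
proof -
  let ?p = "monom 1 n - 1 :: complex poly" and ?w = "\<lambda>k. cis (2 * pi * real k / real n)"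
  have "rsquarefree ?p"
    unfolding rsquarefree_roots
    using assms by (auto simp: pderiv_diff pderiv_monom poly_monom power_0_left)
  moreover have "degree ?p = n"
    using assms by (intro antisym degree_diff_le le_degree) (auto simp: degree_monom_eq)
  ultimately have "?p = (\<Prod>z | poly ?p z = 0. [:- z, 1:])"
    using complex_poly_decompose_rsquarefree[of ?p] assms by simp
  also have "\<dots> = (\<Prod>z | z ^ n = 1. [:- z, 1:])" by (simp add: poly_monom)
  also have "\<dots> = (\<Prod>k<n. [:- ?w k, 1:])"
    by (rule prod.reindex_bij_betw[OF bij_betw_roots_unity[OF assms], symmetric])
  also have "\<dots> = (\<Prod>k\<in>{1..n}. [:- ?w k, 1:])"
    by (rule prod.reindex_bij_witness[where i = "\<lambda>k. if k = n then 0 else k"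
          and j = "\<lambda>k. if k = 0 then n else k"])
       (use assms in auto)
  finally show ?thesis .
qed

lemma prod_cyclotomic_poly_divisors:
  assumes "n > 0"
  shows "(\<Prod>d | d dvd n. cyclotomic_poly d) = monom 1 n - 1"
proof -
  let ?T = "\<lambda>d. {j\<in>{1..d}. coprime j d}" and ?i = "\<lambda>k. (n div gcd k n, k div gcd k n)"
    and ?j = "\<lambda>(d, j). n div d * j"
  have "(\<Prod>d | d dvd n. cyclotomic_poly d) =
     (\<Prod>(d, j)\<in>Sigma {d. d dvd n} ?T. [:- cis (2 * pi * real j / real d), 1:])"
    unfolding cyclotomic_poly_altdef using assms by (intro prod.Sigma) auto
  also have "\<dots> = (\<Prod>k\<in>{1..n}. [:- cis (2 * pi * real k / real n), 1:])"
  proof (rule prod.reindex_bij_witness[where i = ?i and j = ?j])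
    fix x assume "x \<in> Sigma {d. d dvd n} ?T"
    then obtain d j e where x: "x = (d, j)" "1 \<le> j" "j \<le> d" "coprime j d" and e: "n = d * e"
      by (auto elim!: dvdE)
    have pos: "d > 0" "e > 0" using e assms by auto
    have "gcd (e * j) (d * e) = e"
      using x(4) by (metis coprime_imp_gcd_eq_1 gcd_mult_distrib_nat mult.commute mult.right_neutral)
    thus "?i (?j x) = x" using x e pos by simp
    show "?j x \<in> {1..n}" using x e pos by (simp add: mult.commute)
    show "[:- cis (2 * pi * real (?j x) / real n), 1:] =
        (case x of (d, j) \<Rightarrow> [:- cis (2 * pi * real j / real d), 1:])"
      using x e pos by (simp add: field_simps)
  next
    fix k assume k: "k \<in> {1..n}"
    define g where "g = gcd k n"
    have g: "g dvd k" "g dvd n" "g > 0" using k by (auto simp: g_def)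
    have "coprime (k div g) (n div g)" unfolding g_def using k by (intro div_gcd_coprime) auto
    moreover have "k div g \<le> n div g" using k by (intro div_le_mono) auto
    moreover have "k div g > 0" using g k by (auto simp: div_greater_zero_iff dvd_imp_le)
    ultimately show "?i k \<in> Sigma {d. d dvd n} ?T"
      using g by (auto simp: g_def [symmetric])
    show "?j (?i k) = k"
      using g assms unfolding g_def [symmetric] by (auto elim!: dvdE)
  qed
  also have "\<dots> = monom 1 n - 1" by (rule monom_minus_1_eq_prod [OF assms, symmetric])
  finally show ?thesis .
qed

lemma cyclotomic_poly_1: "cyclotomic_poly (Suc 0) = monom 1 1 - 1"
  using prod_cyclotomic_poly_divisors[of 1] by simp

lemma cyclotomic_poly_prime_mult_monom_minus_1:
  assumes "prime p"
  shows "cyclotomic_poly p * (monom 1 1 - 1) = monom 1 p - 1"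
proof -
  have "{d. d dvd p} = {1, p}" using assms by (auto simp: prime_nat_iff)
  moreover have "p \<noteq> 1" using assms by auto
  ultimately show ?thesis
    using prod_cyclotomic_poly_divisors[of p] prime_gt_0_nat[OF assms]
    by (simp add: cyclotomic_poly_1 mult.commute)
qed

lemma prod_divisors_eq_imp_eq:
  fixes f g :: "nat \<Rightarrow> 'a::idom"
  assumes "n > 0" "\<And>d. d dvd n \<Longrightarrow> (\<Prod>e | e dvd d. f e) = (\<Prod>e | e dvd d. g e)"
    and "\<And>d. d dvd n \<Longrightarrow> f d \<noteq> 0"
  shows "f n = g n"
  using assms
proof (induction n rule: less_induct)
  case (less n)
  let ?D = "{d. d dvd n} - {n}"
  have split: "(\<Prod>d | d dvd n. h d) = h n * prod h ?D" for h :: "nat \<Rightarrow> 'a"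
    using less.prems(1) by (intro prod.remove) auto
  have "f d = g d" if "d \<in> ?D" for d
  proof (rule less.IH)
    have d: "d dvd n" "d \<noteq> n" using that by auto
    show "d < n" using d dvd_imp_le[OF d(1)] less.prems(1) by simp
    show "d > 0" using d less.prems(1) by (auto intro!: Nat.gr0I)
    show "(\<Prod>e | e dvd d'. f e) = (\<Prod>e | e dvd d'. g e)" "f d' \<noteq> 0" if "d' dvd d" for d'
      using dvd_trans[OF that d(1)] less.prems(2,3) by auto
  qed
  hence "prod f ?D = prod g ?D" by (intro prod.cong) auto
  moreover have "prod f ?D \<noteq> 0" using less.prems(1,3) by simp
  ultimately show ?case using less.prems(2)[of n] by (simp add: split)
qed

lemma cyclotomic_poly_prime_mult:
  assumes r: "prime r" "\<not> r dvd m" and m: "m > 0"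
  shows "cyclotomic_poly (r * m) * cyclotomic_poly m = pcompose (cyclotomic_poly m) (monom 1 r)"
proof (rule prod_divisors_eq_imp_eq[OF m])
  fix d assume d: "d dvd m"
  have d_pos: "d > 0" using d m by (auto intro!: Nat.gr0I)
  have "\<not> r dvd d" using r(2) d dvd_trans by blast
  from prod.divisors_prime_power_Suc_mult[OF r(1) this, of cyclotomic_poly 0]
  have "(\<Prod>e | e dvd d. cyclotomic_poly (r * e) * cyclotomic_poly e) =
      (\<Prod>e | e dvd r * d. cyclotomic_poly e)"
    by (simp add: prod.distrib mult.commute)
  also have "\<dots> = monom 1 (r * d) - 1"
    using r d_pos by (intro prod_cyclotomic_poly_divisors) (simp add: prime_gt_0_nat)
  also have "\<dots> = pcompose (\<Prod>e | e dvd d. cyclotomic_poly e) (monom 1 r)"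
    using d_pos by (simp add: prod_cyclotomic_poly_divisors pcompose_monom_minus_1)
  finally show "(\<Prod>e | e dvd d. cyclotomic_poly (r * e) * cyclotomic_poly e) =
      (\<Prod>e | e dvd d. pcompose (cyclotomic_poly e) (monom 1 r))"
    by (simp add: pcompose_prod)
qed (simp add: cyclotomic_poly_nonzero)

lemma cyclotomic_poly_two_primes:
  assumes "prime p" "prime q" "p \<noteq> q"
  shows "cyclotomic_poly (p * q) * (monom 1 p - 1) * (monom 1 q - 1) =
    (monom 1 (p * q) - 1) * (monom 1 1 - 1)"
proof -
  let ?x = "monom 1 1 :: complex poly"
  have "\<not> p dvd q" using assms by (auto simp: primes_dvd_imp_eq)
  hence "cyclotomic_poly (p * q) * cyclotomic_poly q = pcompose (cyclotomic_poly q) (monom 1 p)"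
    using assms prime_gt_0_nat by (intro cyclotomic_poly_prime_mult) auto
  moreover have "pcompose (cyclotomic_poly q * (?x - 1)) (monom 1 p) = monom 1 (p * q) - 1"
    unfolding cyclotomic_poly_prime_mult_monom_minus_1[OF assms(2)] by (rule pcompose_monom_minus_1)
  ultimately have monom_eq: "monom 1 (p * q) - 1 =
      cyclotomic_poly (p * q) * cyclotomic_poly q * (monom 1 p - 1)"
    by (simp add: pcompose_mult pcompose_monom_minus_1)
  have "(monom 1 (p * q) - 1) * (?x - 1) =
      cyclotomic_poly (p * q) * (monom 1 p - 1) * (cyclotomic_poly q * (?x - 1))"
    unfolding monom_eq by (simp only: mult_ac)
  thus ?thesis by (simp only: cyclotomic_poly_prime_mult_monom_minus_1[OF assms(2)])
qed

lemma monom_minus_1_eq_geometric_sum: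
  "monom 1 n - 1 = (monom 1 1 - 1) * (\<Sum>i<n. monom 1 i :: 'a::comm_ring_1 poly)"
  using power_diff_1_eq[of "monom 1 1 :: 'a poly" n] by (simp add: monom_power)

lemma cyclotomic_poly_three_primes:
  assumes "prime p" "prime q" "prime r" "p \<noteq> q" "p \<noteq> r" "q \<noteq> r"
  shows "cyclotomic_poly (p * q * r) * (1 - monom 1 (p * q)) =
    pcompose (cyclotomic_poly (p * q)) (monom 1 r) * ((\<Sum>i<p. monom 1 i) * (1 - monom 1 q))"
proof -
  let ?x = "monom 1 1 :: complex poly" and ?\<Phi> = cyclotomic_poly
  have "\<not> r dvd p * q" using assms primes_dvd_imp_eq by (auto simp: prime_dvd_mult_iff)
  hence r: "?\<Phi> (p * q * r) * ?\<Phi> (p * q) = pcompose (?\<Phi> (p * q)) (monom 1 r)"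
    using cyclotomic_poly_prime_mult[of r "p * q"] assms prime_gt_0_nat by (simp add: mult.commute)
  have "?\<Phi> (p * q * r) * (1 - monom 1 (p * q)) * (?x - 1) =
      - (?\<Phi> (p * q * r) * ((monom 1 (p * q) - 1) * (?x - 1)))"
    by (simp add: algebra_simps)
  also have "\<dots> = - (?\<Phi> (p * q * r) * ?\<Phi> (p * q) * (monom 1 p - 1) * (monom 1 q - 1))"
    unfolding cyclotomic_poly_two_primes[OF assms(1,2,4), symmetric] by (simp only: mult.assoc)
  also have "\<dots> = pcompose (?\<Phi> (p * q)) (monom 1 r) * ((\<Sum>i<p. monom 1 i) * (1 - monom 1 q)) * (?x - 1)"
    unfolding r monom_minus_1_eq_geometric_sum[of p] by (simp add: algebra_simps)
  finally show ?thesis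
    using monom_minus_1_nonzero[of 1, where ?'a = complex] by (simp only: mult_cancel_right) simp
qed

lemma coeff_quotient_one_minus_monom:
  fixes A W :: "'a::comm_ring_1 poly"
  assumes M: "M > 0" and W: "\<And>j. M \<le> j \<Longrightarrow> coeff W j = 0"
    and quotient: "A * (1 - monom 1 M) = (\<Sum>i\<in>I. monom (c i) (e i)) * W"
  shows "coeff A n = (\<Sum>i\<in>I. if e i \<le> n then c i * coeff W ((n - e i) mod M) else 0)"
proof (induction n rule: less_induct)
  case (less n)
  let ?f = "\<lambda>n i. if e i \<le> n then c i * coeff W ((n - e i) mod M) else 0"
  have split: "?f n i = (if e i \<le> n then c i * coeff W (n - e i) else 0) +
      (if M \<le> n then ?f (n - M) i else 0)" for i
  proof (cases "M + e i \<le> n")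
    case True
    hence "coeff W (n - e i) = 0" by (intro W) simp
    moreover have "(n - e i) mod M = (n - M - e i) mod M"
      using True le_mod_geq[of M "n - e i"] by (simp add: add.commute)
    ultimately show ?thesis using True by simp
  next
    case False
    hence "(n - e i) mod M = n - e i" if "e i \<le> n" using that by (intro mod_less) linarith
    thus ?thesis using False by auto
  qed
  have "coeff A n - (if M \<le> n then coeff A (n - M) else 0) = coeff (A * (1 - monom 1 M)) n"
    by (simp add: right_diff_distrib mult.commute[of A "monom 1 M"] coeff_monom_mult)
  also have "\<dots> = (\<Sum>i\<in>I. if e i \<le> n then c i * coeff W (n - e i) else 0)"
    unfolding quotient sum_distrib_right coeff_sum
    by (intro sum.cong refl) (auto simp: coeff_monom_mult)
  finally have "coeff A n = (\<Sum>i\<in>I. if e i \<le> n then c i * coeff W (n - e i) else 0) +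
      (if M \<le> n then coeff A (n - M) else 0)"
    by (simp add: diff_eq_eq)
  also have "(if M \<le> n then coeff A (n - M) else 0) = (\<Sum>i\<in>I. if M \<le> n then ?f (n - M) i else 0)"
    using less.IH[of "n - M"] M by simp
  finally show ?case by (simp only: split sum.distrib)
qed

section \<open>Binary cyclotomic polynomials\<close>

lemma sum_power_int_interval:
  fixes y :: "'a::comm_ring_1"
  assumes "0 \<le> a + e" "a \<le> c"
  shows "(\<Sum>k\<in>{a..<c}. y ^ nat (k + e)) * (y - 1) = y ^ nat (c + e) - y ^ nat (a + e)"
  using assms(2)
proof (induction c rule: int_ge_induct)
  case (step c)
  have "{a..<c + 1} = insert c {a..<c}" using step by auto
  hence "(\<Sum>k\<in>{a..<c + 1}. y ^ nat (k + e)) * (y - 1) =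
      y ^ nat (c + e) * (y - 1) + (\<Sum>k\<in>{a..<c}. y ^ nat (k + e)) * (y - 1)"
    by (simp add: distrib_right)
  also have "\<dots> = y * y ^ nat (c + e) - y ^ nat (a + e)"
    using step by (simp add: algebra_simps)
  also have "y * y ^ nat (c + e) = y ^ nat (c + 1 + e)"
    using step assms(1) by (subst power_Suc [symmetric], intro arg_cong[of _ _ "(^) y"]) linarith
  finally show ?case .
qed auto

text \<open>
  Here \<open>\<mu>\<close> is the inverse of \<open>p\<close> modulo \<open>q\<close> and \<open>\<sigma>\<close> that of \<open>q\<close> modulo \<open>p\<close>. Every residue modulo
  \<open>p q\<close> is \<open>\<alpha> p + \<beta> q\<close> with unique \<open>\<mu> - q \<le> \<alpha> < \<mu>\<close> and \<open>0 \<le> \<beta> < p\<close>. With this range of \<open>\<alpha>\<close>, the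
  indices with nonzero coefficient in \<open>\<Phi>\<^sub>p\<^sub>q\<close> are equal to \<open>\<alpha> p + \<beta> q\<close> without any reduction.
\<close>

locale bezout_pair =
  fixes p q \<mu> \<sigma> :: int
  assumes bezout: "p * \<mu> + q * \<sigma> = p * q + 1"
    and \<mu>_bounds: "0 < \<mu>" "\<mu> < q" and \<sigma>_bounds: "0 < \<sigma>" "\<sigma> < p"
begin

definition coord_p :: "int \<Rightarrow> int" where
  "coord_p x = ((x - 1) * \<mu>) mod q - (q - \<mu>)"

definition coord_q :: "int \<Rightarrow> int" where
  "coord_q x = (x * \<sigma>) mod p"

definition coord_sign :: "int \<Rightarrow> int \<Rightarrow> int" where
  "coord_sign \<alpha> \<beta> = (if 0 \<le> \<alpha> \<and> \<beta> < \<sigma> then 1 else if \<alpha> < 0 \<and> \<sigma> \<le> \<beta> then - 1 else 0)"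

definition binary_coeff :: "int \<Rightarrow> int" where
  "binary_coeff x = coord_sign (coord_p x) (coord_q x)"

lemma pq_pos: "0 < p" "0 < q" using \<mu>_bounds \<sigma>_bounds by auto

lemma pq_mult_pos: "0 < p * q" using pq_pos by simp

lemma cong_p_\<mu>: "[p * \<mu> = 1] (mod q)"
proof -
  have "p * \<mu> = 1 + q * (p - \<sigma>)" using bezout by (simp add: algebra_simps)
  thus ?thesis by (simp add: cong_def)
qed

lemma cong_q_\<sigma>: "[q * \<sigma> = 1] (mod p)"
proof -
  have "q * \<sigma> = 1 + p * (q - \<mu>)" using bezout by (simp add: algebra_simps)
  thus ?thesis by (simp add: cong_def)
qed

lemma coprime_p_q: "coprime p q"
  using cong_p_\<mu> by (metis coprime_iff_invertible_int)

lemma coord_p_range: "\<mu> - q \<le> coord_p x" "coord_p x < \<mu>"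
  and coord_q_range: "0 \<le> coord_q x" "coord_q x < p"
  using pq_pos pos_mod_bound[of q "(x - 1) * \<mu>"] by (auto simp: coord_p_def coord_q_def)

lemma cong_coord_p: "[coord_p x = x * \<mu>] (mod q)"
proof -
  have "[coord_p x = (x - 1) * \<mu> - (q - \<mu>)] (mod q)"
    unfolding coord_p_def by (intro cong_diff) (auto simp: cong_def)
  also have "(x - 1) * \<mu> - (q - \<mu>) = x * \<mu> - q" by (simp add: algebra_simps)
  also have "[x * \<mu> - q = x * \<mu>] (mod q)" by (simp add: cong_def)
  finally show ?thesis .
qed

lemma cong_coord_q: "[coord_q x = x * \<sigma>] (mod p)"
  by (simp add: coord_q_def cong_def)

lemma coord_p_eqI:
  assumes "\<mu> - q \<le> \<alpha>" "\<alpha> < \<mu>" "[\<alpha> = x * \<mu>] (mod q)"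
  shows "coord_p x = \<alpha>"
proof -
  have "[coord_p x - (\<mu> - q) = \<alpha> - (\<mu> - q)] (mod q)"
    using assms(3) cong_coord_p by (metis cong_diff cong_refl cong_sym cong_trans)
  thus ?thesis using assms(1,2) coord_p_range[of x] by (simp add: cong_def)
qed

lemma coord_q_eqI:
  assumes "0 \<le> \<beta>" "\<beta> < p" "[\<beta> = x * \<sigma>] (mod p)"
  shows "coord_q x = \<beta>"
  using assms by (simp add: coord_q_def cong_def)

lemma coord_p_cong: "[x * \<mu> = y * \<mu>] (mod q) \<Longrightarrow> coord_p x = coord_p y"
  by (intro coord_p_eqI coord_p_range) (metis cong_coord_p cong_sym cong_trans)

lemma coord_q_cong: "[x * \<sigma> = y * \<sigma>] (mod p) \<Longrightarrow> coord_q x = coord_q y"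
  by (simp add: coord_q_def cong_def)

lemma coord_p_combine:
  assumes "\<mu> - q \<le> \<alpha>" "\<alpha> < \<mu>"
  shows "coord_p (\<alpha> * p + \<beta> * q) = \<alpha>"
proof (rule coord_p_eqI[OF assms])
  have "[\<alpha> * (p * \<mu>) + q * (\<beta> * \<mu>) = \<alpha> * 1 + 0] (mod q)"
    by (intro cong_add cong_mult cong_p_\<mu>) (auto simp: cong_def)
  moreover have "(\<alpha> * p + \<beta> * q) * \<mu> = \<alpha> * (p * \<mu>) + q * (\<beta> * \<mu>)" by (simp add: algebra_simps)
  ultimately show "[\<alpha> = (\<alpha> * p + \<beta> * q) * \<mu>] (mod q)" by (simp add: cong_sym_eq)
qed

lemma coord_q_combine:
  assumes "0 \<le> \<beta>" "\<beta> < p"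
  shows "coord_q (\<alpha> * p + \<beta> * q) = \<beta>"
proof (rule coord_q_eqI[OF assms])
  have "[\<beta> * (q * \<sigma>) + p * (\<alpha> * \<sigma>) = \<beta> * 1 + 0] (mod p)"
    by (intro cong_add cong_mult cong_q_\<sigma>) (auto simp: cong_def)
  moreover have "(\<alpha> * p + \<beta> * q) * \<sigma> = \<beta> * (q * \<sigma>) + p * (\<alpha> * \<sigma>)" by (simp add: algebra_simps)
  ultimately show "[\<beta> = (\<alpha> * p + \<beta> * q) * \<sigma>] (mod p)" by (simp add: cong_sym_eq)
qed

lemma combine_coords: "[coord_p x * p + coord_q x * q = x] (mod p * q)"
proof (rule coprime_cong_mult)
  have "[coord_p x * p + coord_q x * q = 0 + x * \<sigma> * q] (mod p)"
    by (intro cong_add cong_mult cong_coord_q cong_refl) (simp add: cong_def)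
  also have "[0 + x * \<sigma> * q = x * 1] (mod p)"
    using cong_mult[OF cong_refl cong_q_\<sigma>, of x] by (simp add: mult_ac)
  finally show "[coord_p x * p + coord_q x * q = x] (mod p)" by simp
  have "[coord_p x * p + coord_q x * q = x * \<mu> * p + 0] (mod q)"
    by (intro cong_add cong_mult cong_coord_p cong_refl) (simp add: cong_def)
  also have "[x * \<mu> * p + 0 = x * 1] (mod q)"
    using cong_mult[OF cong_refl cong_p_\<mu>, of x] by (simp add: mult_ac)
  finally show "[coord_p x * p + coord_q x * q = x] (mod q)" by simp
qed (rule coprime_p_q)

lemma combine_bounds:
  assumes "\<mu> - q \<le> \<alpha>" "\<alpha> < \<mu>" "0 \<le> \<beta>" "\<beta> < p" "coord_sign \<alpha> \<beta> \<noteq> 0"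
  shows "0 \<le> \<alpha> * p + \<beta> * q" "\<alpha> * p + \<beta> * q < p * q"
proof -
  consider (low) "0 \<le> \<alpha>" "\<beta> < \<sigma>" | (high) "\<alpha> < 0" "\<sigma> \<le> \<beta>"
    using assms(5) by (auto simp: coord_sign_def split: if_splits)
  hence "0 \<le> \<alpha> * p + \<beta> * q \<and> \<alpha> * p + \<beta> * q < p * q"
  proof cases
    case low
    hence "\<alpha> * p \<le> (\<mu> - 1) * p" "\<beta> * q \<le> (\<sigma> - 1) * q"
      using assms pq_pos by (auto intro!: mult_right_mono)
    thus ?thesis using low assms(3) bezout pq_pos \<mu>_bounds \<sigma>_bounds by (simp add: algebra_simps)
  next
    case high
    hence "(\<mu> - q) * p \<le> \<alpha> * p" "\<sigma> * q \<le> \<beta> * q" "\<alpha> * p < 0" "\<beta> * q \<le> p * q"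
      using assms pq_pos by (auto intro!: mult_right_mono simp: mult_neg_pos)
    thus ?thesis using bezout by (simp add: algebra_simps)
  qed
  thus "0 \<le> \<alpha> * p + \<beta> * q" "\<alpha> * p + \<beta> * q < p * q" by auto
qed

lemma mod_eq_combine_coords:
  assumes "binary_coeff x \<noteq> 0"
  shows "x mod (p * q) = coord_p x * p + coord_q x * q"
  using combine_bounds[OF coord_p_range coord_q_range, of x x] combine_coords[of x] assms
  by (simp add: binary_coeff_def cong_def)

lemma coords_cong:
  assumes "[x = y] (mod p * q)"
  shows "coord_p x = coord_p y" "coord_q x = coord_q y"
proof -
  have "[x = y] (mod p)" "[x = y] (mod q)"
    using assms cong_modulus_mult[of x y p q] cong_modulus_mult[of x y q p]
    by (simp_all add: mult.commute)
  thus "coord_p x = coord_p y" "coord_q x = coord_q y"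
    by (auto intro: coord_p_cong coord_q_cong cong_scalar_right)
qed

lemma binary_coeff_mod: "binary_coeff (x mod (p * q)) = binary_coeff x"
proof -
  have "[x mod (p * q) = x] (mod p * q)" by (simp add: cong_def)
  thus ?thesis by (simp only: binary_coeff_def coords_cong)
qed

context
  fixes x :: "'a::idom"
begin

lemma power_combine:
  assumes "0 \<le> \<alpha> + q" "0 \<le> \<beta>" "0 \<le> \<alpha> * p + \<beta> * q"
  shows "x ^ nat (p * q) * x ^ nat (\<alpha> * p + \<beta> * q) = (x ^ nat p) ^ nat (\<alpha> + q) * (x ^ nat q) ^ nat \<beta>"
proof -
  have "nat (p * q) + nat (\<alpha> * p + \<beta> * q) = nat ((\<alpha> + q) * p + \<beta> * q)"
    using assms pq_pos by (simp add: algebra_simps flip: nat_add_distrib)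
  also have "\<dots> = nat p * nat (\<alpha> + q) + nat q * nat \<beta>"
    using assms pq_pos by (simp add: nat_add_distrib nat_mult_distrib mult.commute)
  finally show ?thesis by (simp only: power_add [symmetric] power_mult [symmetric])
qed

lemma sum_binary_coeff_eq_sum_coords:
  "x ^ nat (p * q) * (\<Sum>i\<in>{0..<p * q}. of_int (binary_coeff i) * x ^ nat i) =
    (\<Sum>(\<alpha>, \<beta>)\<in>{\<mu> - q..<\<mu>} \<times> {0..<p}.
      of_int (coord_sign \<alpha> \<beta>) * ((x ^ nat p) ^ nat (\<alpha> + q) * (x ^ nat q) ^ nat \<beta>))"
    (is "?lhs = ?rhs")
proof -
  have "?lhs = (\<Sum>i\<in>{i\<in>{0..<p * q}. binary_coeff i \<noteq> 0}.
      x ^ nat (p * q) * (of_int (binary_coeff i) * x ^ nat i))"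
    unfolding sum_distrib_left by (rule sum.mono_neutral_right) auto
  also have "\<dots> = (\<Sum>(\<alpha>, \<beta>)\<in>{z\<in>{\<mu> - q..<\<mu>} \<times> {0..<p}. coord_sign (fst z) (snd z) \<noteq> 0}.
      of_int (coord_sign \<alpha> \<beta>) * ((x ^ nat p) ^ nat (\<alpha> + q) * (x ^ nat q) ^ nat \<beta>))"
  proof (rule sum.reindex_bij_witness[where i = "\<lambda>(\<alpha>, \<beta>). \<alpha> * p + \<beta> * q"
        and j = "\<lambda>i. (coord_p i, coord_q i)"])
    fix i assume i: "i \<in> {i\<in>{0..<p * q}. binary_coeff i \<noteq> 0}"
    hence i_eq: "coord_p i * p + coord_q i * q = i" using mod_eq_combine_coords[of i] by simp
    thus "(case (coord_p i, coord_q i) of (\<alpha>, \<beta>) \<Rightarrow> \<alpha> * p + \<beta> * q) = i" by simp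
    show "(coord_p i, coord_q i) \<in> {z\<in>{\<mu> - q..<\<mu>} \<times> {0..<p}. coord_sign (fst z) (snd z) \<noteq> 0}"
      using i coord_p_range coord_q_range by (simp add: binary_coeff_def)
    show "(case (coord_p i, coord_q i) of (\<alpha>, \<beta>) \<Rightarrow>
        of_int (coord_sign \<alpha> \<beta>) * ((x ^ nat p) ^ nat (\<alpha> + q) * (x ^ nat q) ^ nat \<beta>)) =
      x ^ nat (p * q) * (of_int (binary_coeff i) * x ^ nat i)"
      using power_combine[of "coord_p i" "coord_q i"] i i_eq
        coord_p_range(1)[of i] coord_q_range(1)[of i] \<mu>_bounds
      by (simp add: binary_coeff_def mult_ac)
  next
    fix z assume "z \<in> {z\<in>{\<mu> - q..<\<mu>} \<times> {0..<p}. coord_sign (fst z) (snd z) \<noteq> 0}"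
    thus "(coord_p (case z of (\<alpha>, \<beta>) \<Rightarrow> \<alpha> * p + \<beta> * q), coord_q (case z of (\<alpha>, \<beta>) \<Rightarrow> \<alpha> * p + \<beta> * q)) = z"
      "(case z of (\<alpha>, \<beta>) \<Rightarrow> \<alpha> * p + \<beta> * q) \<in> {i\<in>{0..<p * q}. binary_coeff i \<noteq> 0}"
      using combine_bounds by (auto simp: coord_p_combine coord_q_combine binary_coeff_def)
  qed
  also have "\<dots> = ?rhs" by (rule sum.mono_neutral_left) auto
  finally show ?thesis .
qed

lemma sum_coord_sign_eq_blocks:
  fixes f g :: "int \<Rightarrow> 'a"
  shows "(\<Sum>(\<alpha>, \<beta>)\<in>{\<mu> - q..<\<mu>} \<times> {0..<p}. of_int (coord_sign \<alpha> \<beta>) * (f \<alpha> * g \<beta>)) =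
    sum f {0..<\<mu>} * sum g {0..<\<sigma>} - sum f {\<mu> - q..<0} * sum g {\<sigma>..<p}"
proof -
  let ?h = "\<lambda>\<alpha>. \<Sum>\<beta>\<in>{0..<p}. of_int (coord_sign \<alpha> \<beta>) * (f \<alpha> * g \<beta>)"
  have nonneg: "?h \<alpha> = f \<alpha> * sum g {0..<\<sigma>}" if "0 \<le> \<alpha>" for \<alpha>
    unfolding sum_distrib_left using that \<sigma>_bounds
    by (intro sum.mono_neutral_cong_right) (auto simp: coord_sign_def)
  have neg: "?h \<alpha> = - (f \<alpha> * sum g {\<sigma>..<p})" if "\<alpha> < 0" for \<alpha>
    unfolding sum_distrib_left sum_negf [symmetric] using that \<sigma>_bounds
    by (intro sum.mono_neutral_cong_right) (auto simp: coord_sign_def)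
  have "{\<mu> - q..<\<mu>} = {\<mu> - q..<0} \<union> {0..<\<mu>}" using \<mu>_bounds by auto
  hence "sum ?h {\<mu> - q..<\<mu>} = sum ?h {\<mu> - q..<0} + sum ?h {0..<\<mu>}"
    by (simp only: sum.union_disjoint finite_atLeastLessThan_int ivl_disj_int)
  thus ?thesis
    by (simp add: nonneg neg sum_negf sum_distrib_right flip: sum.cartesian_product)
qed

lemma binary_coeff_polynomial_identity:
  assumes "x \<noteq> 0"
  shows "(\<Sum>i\<in>{0..<p * q}. of_int (binary_coeff i) * x ^ nat i) * (x ^ nat p - 1) * (x ^ nat q - 1) =
    (x ^ nat (p * q) - 1) * (x - 1)"
proof -
  define y z M where "y = x ^ nat p" and "z = x ^ nat q" and "M = x ^ nat (p * q)"
  let ?B = "\<Sum>i\<in>{0..<p * q}. of_int (binary_coeff i) * x ^ nat i"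
  have M: "y ^ nat q = M" "z ^ nat p = M"
    using pq_pos by (simp_all add: y_def z_def M_def nat_mult_distrib mult.commute flip: power_mult)
  have corner: "y ^ nat (\<mu> + q) * z ^ nat \<sigma> = M * (M * x)"
  proof -
    have "\<mu> * p + \<sigma> * q = p * q + 1" using bezout by (simp add: mult.commute)
    hence "M * x ^ nat (p * q + 1) = y ^ nat (\<mu> + q) * z ^ nat \<sigma>"
      using power_combine[of \<mu> \<sigma>] \<mu>_bounds \<sigma>_bounds pq_pos by (simp add: y_def z_def M_def)
    thus ?thesis using pq_pos by (simp add: M_def nat_add_distrib mult_ac)
  qed
  have y_add: "y ^ nat (\<mu> + q) = y ^ nat \<mu> * M"
    using \<mu>_bounds pq_pos by (simp add: nat_add_distrib power_add M)
  have "M \<noteq> 0" using assms by (simp add: M_def)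
  hence corner': "y ^ nat \<mu> * z ^ nat \<sigma> = M * x" using corner y_add by simp
  have "M * (?B * (y - 1) * (z - 1)) =
      ((\<Sum>\<alpha>\<in>{0..<\<mu>}. y ^ nat (\<alpha> + q)) * (y - 1)) * ((\<Sum>\<beta>\<in>{0..<\<sigma>}. z ^ nat \<beta>) * (z - 1)) -
      ((\<Sum>\<alpha>\<in>{\<mu> - q..<0}. y ^ nat (\<alpha> + q)) * (y - 1)) * ((\<Sum>\<beta>\<in>{\<sigma>..<p}. z ^ nat \<beta>) * (z - 1))"
    using sum_binary_coeff_eq_sum_coords
    unfolding sum_coord_sign_eq_blocks y_def [symmetric] z_def [symmetric] M_def [symmetric]
    by (simp only: mult.assoc [symmetric]) (simp add: algebra_simps)
  also have "\<dots> = (y ^ nat (\<mu> + q) - M) * (z ^ nat \<sigma> - 1) - (M - y ^ nat \<mu>) * (M - z ^ nat \<sigma>)"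
    using \<mu>_bounds \<sigma>_bounds pq_pos
    by (simp add: sum_power_int_interval sum_power_int_interval[where e = 0, simplified] M)
  also have "\<dots> = y ^ nat (\<mu> + q) * z ^ nat \<sigma> + M - M * M - y ^ nat \<mu> * z ^ nat \<sigma>"
    by (simp add: y_add algebra_simps)
  also have "\<dots> = M * ((M - 1) * (x - 1))"
    unfolding corner corner' by (simp add: algebra_simps)
  finally have "?B * (y - 1) * (z - 1) = (M - 1) * (x - 1)" using \<open>M \<noteq> 0\<close> by simp
  thus ?thesis by (simp only: y_def z_def M_def)
qed

end

end

section \<open>Truncated coefficient sums\<close>

lemma cong_diff_mult_iff:
  fixes r s t i j m :: int
  assumes "[r * s = 1] (mod m)"
  shows "[t - r * i = j] (mod m) \<longleftrightarrow> [i = s * (t - j)] (mod m)"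
proof -
  have inverse: "[r * (s * z) = z] (mod m)" "[s * (r * z) = z] (mod m)" for z
    using cong_scalar_right[OF assms, of z] by (simp_all add: mult_ac)
  have "t - r * i - j = - (r * i - (t - j))" by simp
  hence "[t - r * i = j] (mod m) \<longleftrightarrow> [r * i = t - j] (mod m)"
    unfolding cong_iff_dvd_diff by (simp only: dvd_minus_iff)
  also have "\<dots> \<longleftrightarrow> [i = s * (t - j)] (mod m)"
  proof
    assume "[r * i = t - j] (mod m)"
    from cong_scalar_left[OF this, of s] show "[i = s * (t - j)] (mod m)"
      using cong_trans[OF cong_sym[OF inverse(2)]] by blast
  next
    assume "[i = s * (t - j)] (mod m)"
    from cong_scalar_left[OF this, of r] show "[r * i = t - j] (mod m)"
      using cong_trans[OF _ inverse(1)] by blast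
  qed
  finally show ?thesis .
qed

context bezout_pair
begin

definition window :: "int \<Rightarrow> int" where
  "window x = (if 0 \<le> x \<and> x < p then 1 else if q \<le> x \<and> x < q + p then - 1 else 0)"

text \<open>
  For \<open>r > p q\<close> the \<open>n\<close>-th coefficient of \<open>\<Phi>\<^sub>p\<^sub>q\<^sub>r\<close> is \<open>truncated_sum r (n div r) n\<close>; the second argument
  and the residue of the third modulo \<open>p q\<close> vary independently.
\<close>

definition truncated_sum :: "int \<Rightarrow> int \<Rightarrow> int \<Rightarrow> int" where
  "truncated_sum r N t =
    (\<Sum>i\<in>{0..<p * q}. if i \<le> N then binary_coeff i * window ((t - r * i) mod (p * q)) else 0)"

lemma truncated_sum_cong:
  assumes "[t = t'] (mod p * q)"
  shows "truncated_sum r N t = truncated_sum r N t'"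
proof -
  have "(t - r * i) mod (p * q) = (t' - r * i) mod (p * q)" for i
    using cong_diff[OF assms cong_refl] by (simp only: cong_def)
  thus ?thesis by (simp only: truncated_sum_def)
qed

lemma truncated_sum_neg: "N < 0 \<Longrightarrow> truncated_sum r N t = 0"
  unfolding truncated_sum_def by (intro sum.neutral) auto

lemma truncated_sum_step: "\<bar>truncated_sum r (N + 1) t - truncated_sum r N t\<bar> \<le> 1"
proof -
  have "truncated_sum r (N + 1) t - truncated_sum r N t =
      (\<Sum>i\<in>{0..<p * q}. if i = N + 1 then binary_coeff i * window ((t - r * i) mod (p * q)) else 0)"
    unfolding truncated_sum_def sum_subtractf [symmetric] by (intro sum.cong refl) auto
  also have "\<bar>\<dots>\<bar> \<le> 1" by (auto simp: binary_coeff_def coord_sign_def window_def)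
  finally show ?thesis .
qed

lemma truncated_sum_intermediate:
  assumes "min 0 (truncated_sum r N t) \<le> v" "v \<le> max 0 (truncated_sum r N t)"
  obtains N' where "truncated_sum r N' t = v"
proof -
  define f where "f k = truncated_sum r (int k - 1) t" for k
  have f_0: "f 0 = 0" by (simp add: f_def truncated_sum_neg)
  have f_end: "f (nat (N + 1)) = truncated_sum r N t"
    by (cases "N < 0") (simp_all add: f_def truncated_sum_neg)
  have step: "\<bar>f (k + 1) - f k\<bar> \<le> 1" for k
    using truncated_sum_step[of r "int k - 1" t] by (simp add: f_def)
  have "\<exists>k. f k = v"
  proof (cases v "0 :: int" rule: linorder_cases)
    case less
    hence "\<exists>k\<le>nat (N + 1). - f k = - v"
      using step f_0 f_end assms by (intro nat0_intermed_int_val) (auto simp: abs_minus_commute)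
    thus ?thesis by auto
  next
    case greater
    hence "\<exists>k\<le>nat (N + 1). f k = v"
      using step f_0 f_end assms by (intro nat0_intermed_int_val) auto
    thus ?thesis by blast
  qed (use f_0 in blast)
  thus ?thesis using that by (auto simp: f_def)
qed

definition truncated_sign :: "int \<Rightarrow> int \<Rightarrow> int \<Rightarrow> int" where
  "truncated_sign N \<alpha> \<beta> = (if \<alpha> * p + \<beta> * q \<le> N then coord_sign \<alpha> \<beta> else 0)"

definition shift_diff :: "int \<Rightarrow> int \<Rightarrow> int \<Rightarrow> int \<Rightarrow> int" where
  "shift_diff d N \<alpha> \<beta> = truncated_sign N \<alpha> \<beta> - truncated_sign N \<alpha> ((\<beta> + d) mod p)"

lemma truncated_sign_coords:
  "truncated_sign N (coord_p x) (coord_q x) = (if x mod (p * q) \<le> N then binary_coeff x else 0)"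
  using mod_eq_combine_coords[of x]
  by (cases "binary_coeff x = 0") (simp_all add: truncated_sign_def binary_coeff_def)

lemma sum_binary_coeff_residue:
  assumes "[r * s = 1] (mod p * q)" "0 \<le> j" "j < p * q"
  shows "(\<Sum>i\<in>{0..<p * q}. if i \<le> N \<and> (t - r * i) mod (p * q) = j then binary_coeff i else 0) =
    truncated_sign N (coord_p (s * (t - j))) (coord_q (s * (t - j)))"
proof -
  define i0 where "i0 = (s * (t - j)) mod (p * q)"
  have i0: "0 \<le> i0" "i0 < p * q" using pq_mult_pos by (auto simp: i0_def)
  have "(t - r * i) mod (p * q) = j \<longleftrightarrow> i = i0" if "0 \<le> i" "i < p * q" for i
    using cong_diff_mult_iff[OF assms(1), of t i j] assms(2,3) that by (simp add: cong_def i0_def)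
  hence "(\<Sum>i\<in>{0..<p * q}. if i \<le> N \<and> (t - r * i) mod (p * q) = j then binary_coeff i else 0) =
      (\<Sum>i\<in>{0..<p * q}. if i = i0 then (if i0 \<le> N then binary_coeff i0 else 0) else 0)"
    by (intro sum.cong) auto
  also have "\<dots> = (if i0 \<le> N then binary_coeff i0 else 0)" using i0 by simp
  finally show ?thesis by (simp add: truncated_sign_coords i0_def binary_coeff_mod)
qed

lemma coords_diff_mult_q:
  assumes "[s = - d] (mod p)"
  shows "coord_p (x - s * q) = coord_p x" "coord_q (x - s * q) = (coord_q x + d) mod p"
proof -
  show "coord_p (x - s * q) = coord_p x"
    by (intro coord_p_cong) (simp add: cong_iff_dvd_diff left_diff_distrib)
  have "[x * \<sigma> - s * (q * \<sigma>) = coord_q x - (- d) * 1] (mod p)"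
    by (intro cong_diff cong_mult assms cong_q_\<sigma> cong_sym[OF cong_coord_q])
  moreover have "(x - s * q) * \<sigma> = x * \<sigma> - s * (q * \<sigma>)" by (simp add: algebra_simps)
  ultimately show "coord_q (x - s * q) = (coord_q x + d) mod p"
    by (simp add: coord_q_def cong_def)
qed

lemma shift_diff_bounds:
  assumes "0 \<le> \<beta>" "\<beta> < p" "0 \<le> d" "d \<le> \<sigma>" "d \<le> p - \<sigma>"
  shows "shift_diff d N \<alpha> \<beta> \<in> (if \<beta> < \<sigma> then {0..1} else {- 1..0})"
proof -
  have "0 \<le> d * q" using assms(3) pq_pos by simp
  hence mono: "\<alpha> * p + \<beta> * q \<le> N" if "\<alpha> * p + (\<beta> + d) * q \<le> N"
    using that unfolding distrib_right by linarith
  show ?thesis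
  proof (cases "\<beta> + d < p")
    case True
    hence "(\<beta> + d) mod p = \<beta> + d" using assms by simp
    thus ?thesis using mono assms by (auto simp: shift_diff_def truncated_sign_def coord_sign_def)
  next
    case False
    hence "(\<beta> + d) mod p = \<beta> + d - p" "\<beta> + d - p < \<sigma>" "\<sigma> \<le> \<beta>"
      using assms mod_pos_pos_trivial[of "\<beta> + d - p" p] by auto
    thus ?thesis by (simp add: shift_diff_def truncated_sign_def coord_sign_def)
  qed
qed

lemma sum_of_bool_less_\<sigma>: "(\<Sum>\<beta>\<in>{0..<p}. of_bool (\<beta> < \<sigma>)) = \<sigma>"
proof -
  have "(\<Sum>\<beta>\<in>{0..<p}. of_bool (\<beta> < \<sigma>)) = (\<Sum>\<beta>\<in>{0..<\<sigma>}. 1 :: int)"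
    using \<sigma>_bounds by (intro sum.mono_neutral_cong_right) auto
  thus ?thesis using \<sigma>_bounds by simp
qed

lemma sum_of_bool_ge_\<sigma>: "(\<Sum>\<beta>\<in>{0..<p}. - of_bool (\<sigma> \<le> \<beta>)) = \<sigma> - p"
proof -
  have "(\<Sum>\<beta>\<in>{0..<p}. - of_bool (\<sigma> \<le> \<beta>)) = (\<Sum>\<beta>\<in>{\<sigma>..<p}. - 1 :: int)"
    using \<sigma>_bounds by (intro sum.mono_neutral_cong_right) auto
  thus ?thesis using \<sigma>_bounds by simp
qed

lemma bij_betw_coord_q:
  assumes "coprime s p"
  shows "bij_betw (\<lambda>j. coord_q (s * (t - j))) {0..<p} {0..<p}"
proof -
  have "inj_on (\<lambda>j. coord_q (s * (t - j))) {0..<p}"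
  proof (rule inj_onI)
    fix x y assume xy: "x \<in> {0..<p}" "y \<in> {0..<p}" "coord_q (s * (t - x)) = coord_q (s * (t - y))"
    have "coprime (s * \<sigma>) p"
      using assms cong_q_\<sigma> by (metis coprime_iff_invertible_int coprime_mult_left_iff mult.commute)
    moreover have "[(t - x) * (s * \<sigma>) = (t - y) * (s * \<sigma>)] (mod p)"
      using xy(3) by (simp add: coord_q_def cong_def mult_ac)
    ultimately have "[t - x = t - y] (mod p)" by (simp add: cong_mult_rcancel)
    hence "[t - (t - x) = t - (t - y)] (mod p)" by (rule cong_diff[OF cong_refl])
    thus "x = y" using xy(1,2) by (simp add: cong_def)
  qed
  thus ?thesis unfolding bij_betw_def using coord_q_range by (intro conjI endo_inj_surj) auto
qed

context
  fixes r s d :: int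
  assumes p_less_q: "p < q" and rs: "[r * s = 1] (mod p * q)" and s_mod_p: "[s = - d] (mod p)"
begin

lemma truncated_sum_eq_sum_shift_diff:
  "truncated_sum r N t = (\<Sum>j\<in>{0..<p}. shift_diff d N (coord_p (s * (t - j))) (coord_q (s * (t - j))))"
proof -
  have "2 * q \<le> p * q" using \<sigma>_bounds pq_pos by (intro mult_right_mono) auto
  hence q_add_p: "q + p \<le> p * q" using p_less_q by linarith
  let ?sel = "\<lambda>j i. if i \<le> N \<and> (t - r * i) mod (p * q) = j then binary_coeff i else 0"
  have window_eq: "window x = (\<Sum>j\<in>{0..<p}. of_bool (x = j) - of_bool (x = q + j))" if "0 \<le> x" for x
  proof -
    have "(\<Sum>j\<in>{0..<p}. of_bool (x = q + j)) = (\<Sum>j\<in>{0..<p}. of_bool (x - q = j) :: int)"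
      by (intro sum.cong refl) auto
    thus ?thesis using that p_less_q by (auto simp: sum_subtractf window_def of_bool_def)
  qed
  have "truncated_sum r N t = (\<Sum>i\<in>{0..<p * q}. \<Sum>j\<in>{0..<p}. ?sel j i - ?sel (q + j) i)"
    unfolding truncated_sum_def using pq_mult_pos
    by (intro sum.cong refl) (auto simp: window_eq sum_distrib_left intro!: sum.cong)
  also have "\<dots> = (\<Sum>j\<in>{0..<p}. (\<Sum>i\<in>{0..<p * q}. ?sel j i) - (\<Sum>i\<in>{0..<p * q}. ?sel (q + j) i))"
    by (subst sum.swap) (simp only: sum_subtractf)
  also have "\<dots> = (\<Sum>j\<in>{0..<p}. shift_diff d N (coord_p (s * (t - j))) (coord_q (s * (t - j))))"
  proof (intro sum.cong refl)
    fix j assume "j \<in> {0..<p}"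
    hence j: "0 \<le> j" "j < p * q" "0 \<le> q + j" "q + j < p * q" using q_add_p pq_pos by auto
    have "s * (t - (q + j)) = s * (t - j) - s * q" by (simp add: algebra_simps)
    thus "(\<Sum>i\<in>{0..<p * q}. ?sel j i) - (\<Sum>i\<in>{0..<p * q}. ?sel (q + j) i) =
        shift_diff d N (coord_p (s * (t - j))) (coord_q (s * (t - j)))"
      unfolding sum_binary_coeff_residue[OF rs j(1,2)] sum_binary_coeff_residue[OF rs j(3,4)]
      by (simp only: coords_diff_mult_q[OF s_mod_p] shift_diff_def)
  qed
  finally show ?thesis .
qed

lemma truncated_sum_bounds:
  assumes "0 \<le> d" "d \<le> \<sigma>" "d \<le> p - \<sigma>"
  shows "truncated_sum r N t \<in> {\<sigma> - p..\<sigma>}"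
proof -
  have "[r * s = 1] (mod p)" using rs by (rule cong_modulus_mult)
  hence "coprime s p" by (metis coprime_iff_invertible_int mult.commute)
  note reindex = sum.reindex_bij_betw[OF bij_betw_coord_q[OF this, of t]]
  have bounds: "- of_bool (\<sigma> \<le> coord_q x) \<le> shift_diff d N (coord_p x) (coord_q x)"
    "shift_diff d N (coord_p x) (coord_q x) \<le> of_bool (coord_q x < \<sigma>)" for x
    using shift_diff_bounds[OF coord_q_range[of x] assms, of N "coord_p x"] by (auto split: if_splits)
  have "truncated_sum r N t \<le> (\<Sum>j\<in>{0..<p}. of_bool (coord_q (s * (t - j)) < \<sigma>))"
    unfolding truncated_sum_eq_sum_shift_diff by (intro sum_mono bounds)
  also have "\<dots> = \<sigma>" using reindex[of "\<lambda>\<beta>. of_bool (\<beta> < \<sigma>) :: int"] by (simp only: sum_of_bool_less_\<sigma>)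
  finally have "truncated_sum r N t \<le> \<sigma>" .
  moreover have "\<sigma> - p = (\<Sum>j\<in>{0..<p}. - of_bool (\<sigma> \<le> coord_q (s * (t - j))))"
    using reindex[of "\<lambda>\<beta>. - of_bool (\<sigma> \<le> \<beta>) :: int"] by (simp only: sum_of_bool_ge_\<sigma>)
  hence "\<sigma> - p \<le> truncated_sum r N t"
    unfolding truncated_sum_eq_sum_shift_diff by (simp only:) (intro sum_mono bounds)
  ultimately show ?thesis by simp
qed

text \<open>
  With \<open>d \<sigma> \<equiv> \<epsilon> = \<plusminus>1\<close>, a step in the summation index moves the second coordinate by \<open>\<epsilon>\<close>, so the
  points of the sum lie on a line of slope \<open>- \<kappa>\<close>.
\<close>

context
  fixes \<epsilon> \<kappa> :: int
  assumes d\<sigma>: "[d * \<sigma> = \<epsilon>] (mod p)" and s_mod_q: "[s = \<epsilon> * (\<kappa> * p)] (mod q)"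
begin

lemma cong_line_combine:
  "[s * (r * ((\<alpha> - \<kappa> * c) * p + c * q) - j) = (\<alpha> - \<kappa> * (c + \<epsilon> * j)) * p + (c + \<epsilon> * j) * q] (mod p * q)"
proof (rule coprime_cong_mult)
  define x where "x = (\<alpha> - \<kappa> * c) * p + c * q"
  have "[r * s * x = 1 * x] (mod p * q)" using rs by (rule cong_scalar_right)
  hence "[s * (r * x) = x] (mod p * q)" by (simp add: mult_ac)
  hence x: "[s * (r * x) = x] (mod p)" "[s * (r * x) = x] (mod q)"
    using cong_modulus_mult cong_modulus_mult[of _ _ q p] by (blast, simp add: mult.commute)
  have "[d = d * (q * \<sigma>)] (mod p)"
    using cong_scalar_left[OF cong_q_\<sigma>, of d] by (simp add: cong_sym_eq)
  also have "[d * (q * \<sigma>) = \<epsilon> * q] (mod p)"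
    using cong_scalar_right[OF d\<sigma>, of q] by (simp add: mult_ac)
  finally have "[- d = - (\<epsilon> * q)] (mod p)" by (simp only: cong_minus_minus_iff)
  hence "[s * (r * x) - s * j = x - (- (\<epsilon> * q)) * j] (mod p)"
    by (intro cong_diff cong_mult x cong_refl cong_trans[OF s_mod_p])
  also have "x - (- (\<epsilon> * q)) * j =
      (\<alpha> - \<kappa> * (c + \<epsilon> * j)) * p + (c + \<epsilon> * j) * q + p * (\<kappa> * \<epsilon> * j)"
    by (simp add: x_def algebra_simps)
  finally show "[s * (r * x - j) = (\<alpha> - \<kappa> * (c + \<epsilon> * j)) * p + (c + \<epsilon> * j) * q] (mod p)"
    by (simp only: cong_def right_diff_distrib mod_mult_self2)
  have "[s * (r * x) - s * j = x - \<epsilon> * (\<kappa> * p) * j] (mod q)"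
    by (intro cong_diff cong_mult x s_mod_q cong_refl)
  also have "x - \<epsilon> * (\<kappa> * p) * j =
      (\<alpha> - \<kappa> * (c + \<epsilon> * j)) * p + (c + \<epsilon> * j) * q + q * (- \<epsilon> * j)"
    by (simp add: x_def algebra_simps)
  finally show "[s * (r * x - j) = (\<alpha> - \<kappa> * (c + \<epsilon> * j)) * p + (c + \<epsilon> * j) * q] (mod q)"
    by (simp only: cong_def right_diff_distrib mod_mult_self2)
qed (rule coprime_p_q)

lemma truncated_sum_on_line:
  assumes \<epsilon>: "\<epsilon> = 1 \<or> \<epsilon> = - 1"
    and range: "\<And>\<beta>. 0 \<le> \<beta> \<Longrightarrow> \<beta> < p \<Longrightarrow> \<mu> - q \<le> \<alpha> - \<kappa> * \<beta> \<and> \<alpha> - \<kappa> * \<beta> < \<mu>"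
  obtains t where "\<And>N. truncated_sum r N t = (\<Sum>\<beta>\<in>{0..<p}. shift_diff d N (\<alpha> - \<kappa> * \<beta>) \<beta>)"
proof -
  define c where "c = (if \<epsilon> = 1 then 0 else p - 1)"
  define t where "t = r * ((\<alpha> - \<kappa> * c) * p + c * q)"
  have coords: "coord_p (s * (t - j)) = \<alpha> - \<kappa> * (c + \<epsilon> * j)" "coord_q (s * (t - j)) = c + \<epsilon> * j"
    if "j \<in> {0..<p}" for j
  proof -
    define \<beta> where "\<beta> = c + \<epsilon> * j"
    have \<beta>: "0 \<le> \<beta>" "\<beta> < p" using that \<epsilon> by (auto simp: \<beta>_def c_def)
    have line: "[s * (t - j) = (\<alpha> - \<kappa> * \<beta>) * p + \<beta> * q] (mod p * q)"
      unfolding t_def \<beta>_def by (rule cong_line_combine)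
    show "coord_p (s * (t - j)) = \<alpha> - \<kappa> * (c + \<epsilon> * j)" "coord_q (s * (t - j)) = c + \<epsilon> * j"
      unfolding coords_cong[OF line] \<beta>_def [symmetric]
      using range[OF \<beta>] \<beta> by (auto intro: coord_p_combine coord_q_combine)
  qed
  have "truncated_sum r N t = (\<Sum>\<beta>\<in>{0..<p}. shift_diff d N (\<alpha> - \<kappa> * \<beta>) \<beta>)" for N
    unfolding truncated_sum_eq_sum_shift_diff
    by (rule sum.reindex_bij_witness[where i = "\<lambda>\<beta>. \<epsilon> * (\<beta> - c)" and j = "\<lambda>j. c + \<epsilon> * j"])
       (use \<epsilon> in \<open>auto simp: coords c_def\<close>)
  thus ?thesis by (rule that)
qed

end

end

end

section \<open>Extremal coefficients\<close>

text \<open>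
  With \<open>T = p - \<sigma> + d\<close>, the assumptions on \<open>\<kappa>\<close> say that \<open>d / T \<le> 1 - \<kappa> p / q < d / (T - 1)\<close>.
\<close>

locale extremal_line = bezout_pair +
  fixes d \<kappa> :: int
  assumes \<sigma>_large: "p - \<sigma> < \<sigma>" "\<sigma> \<le> p - \<sigma> + d" and d_le: "d \<le> p - \<sigma>"
    and \<kappa>_pos: "0 < \<kappa>" and \<kappa>_upper: "\<kappa> * p * (p - \<sigma> + d) \<le> (p - \<sigma>) * q"
    and \<kappa>_lower: "(q - \<kappa> * p) * (p - \<sigma> + d - 1) < d * q"
begin

lemma d_pos: "0 < d"
  using \<sigma>_large by linarith

lemma \<kappa>_p_less_q: "\<kappa> * p < q"
proof -
  have "(p - \<sigma>) * q < (p - \<sigma> + d) * q" using d_pos pq_pos by simp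
  hence "\<kappa> * p * (p - \<sigma> + d) < q * (p - \<sigma> + d)" using \<kappa>_upper by (simp only: mult.commute)
  thus ?thesis using d_pos \<sigma>_bounds by simp
qed

lemma mod_shift:
  assumes "0 \<le> \<beta>" "\<beta> < p"
  shows "(\<beta> + d) mod p = (if \<beta> + d < p then \<beta> + d else \<beta> + d - p)"
  using assms d_pos d_le \<sigma>_bounds mod_pos_pos_trivial[of "\<beta> + d - p" p] by auto

lemma mult_less_d_q:
  assumes "j \<le> p - \<sigma> + d - 1"
  shows "(q - \<kappa> * p) * j < d * q"
proof -
  have "(q - \<kappa> * p) * j \<le> (q - \<kappa> * p) * (p - \<sigma> + d - 1)"
    using assms \<kappa>_p_less_q by (intro mult_left_mono) auto
  thus ?thesis using \<kappa>_lower by linarith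
qed

lemma d_q_le_mult:
  assumes "p - \<sigma> + d \<le> j"
  shows "d * q \<le> (q - \<kappa> * p) * j"
proof -
  have "d * q \<le> (q - \<kappa> * p) * (p - \<sigma> + d)" using \<kappa>_upper by (simp add: algebra_simps)
  also have "\<dots> \<le> (q - \<kappa> * p) * j" using assms \<kappa>_p_less_q by (intro mult_left_mono) auto
  finally show ?thesis .
qed

lemma p_mult_\<mu>: "p * \<mu> = (p - \<sigma>) * q + 1"
  using bezout by (simp add: algebra_simps)

lemma max_line_range:
  assumes "0 \<le> \<beta>" "\<beta> < p"
  shows "\<mu> - q \<le> \<kappa> * (\<sigma> - 1) - \<kappa> * \<beta>" "\<kappa> * (\<sigma> - 1) - \<kappa> * \<beta> < \<mu>"
proof -
  have "p * (\<kappa> * (\<sigma> - 1)) \<le> \<kappa> * p * (p - \<sigma> + d)"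
    using \<sigma>_large(2) \<kappa>_pos pq_pos by (simp add: mult_ac)
  hence "p * (\<kappa> * (\<sigma> - 1)) < p * \<mu>" using \<kappa>_upper p_mult_\<mu> by linarith
  hence "\<kappa> * (\<sigma> - 1) < \<mu>" using pq_pos by simp
  moreover have "0 \<le> \<kappa> * \<beta>" using \<kappa>_pos assms(1) by simp
  ultimately show "\<kappa> * (\<sigma> - 1) - \<kappa> * \<beta> < \<mu>" by linarith
  have "p * (\<kappa> * (p - \<sigma>)) \<le> \<kappa> * p * (p - \<sigma> + d)"
    using d_pos \<kappa>_pos pq_pos by (simp add: algebra_simps)
  moreover have "(p - \<sigma>) * q \<le> (\<sigma> - 1) * q"
    using \<sigma>_large(1) pq_pos by (intro mult_right_mono) auto
  ultimately have "p * (\<kappa> * (p - \<sigma>)) \<le> p * (q - \<mu>)"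
    using \<kappa>_upper p_mult_\<mu> pq_pos by (simp add: algebra_simps)
  hence "\<kappa> * (p - \<sigma>) \<le> q - \<mu>" using pq_pos by simp
  moreover have "\<kappa> * (\<beta> - (\<sigma> - 1)) \<le> \<kappa> * (p - \<sigma>)" using assms(2) \<kappa>_pos by (intro mult_left_mono) auto
  ultimately show "\<mu> - q \<le> \<kappa> * (\<sigma> - 1) - \<kappa> * \<beta>" by (simp add: algebra_simps)
qed

lemma shift_diff_max_line:
  assumes "0 \<le> \<beta>" "\<beta> < p"
  shows "shift_diff d ((\<sigma> - 1) * q) (\<kappa> * (\<sigma> - 1) - \<kappa> * \<beta>) \<beta> = of_bool (\<beta> < \<sigma>)"
proof -
  define E where "E = q - \<kappa> * p"
  define N where "N = (\<sigma> - 1) * q"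
  define \<alpha> where "\<alpha> = \<kappa> * (\<sigma> - 1) - \<kappa> * \<beta>"
  have combined: "\<alpha> * p + \<beta> * q = N - E * (\<sigma> - 1 - \<beta>)"
    and shifted: "\<alpha> * p + (\<beta> + d) * q = N - E * (\<sigma> - 1 - \<beta>) + d * q"
    by (simp_all add: \<alpha>_def N_def E_def algebra_simps)
  have \<alpha>_nonneg: "0 \<le> \<alpha> \<longleftrightarrow> \<beta> < \<sigma>"
    using \<kappa>_pos by (simp add: \<alpha>_def zero_le_mult_iff flip: right_diff_distrib)
  have "shift_diff d N \<alpha> \<beta> = of_bool (\<beta> < \<sigma>)"
  proof (cases "\<beta> < \<sigma>")
    case True
    have "0 \<le> E * (\<sigma> - 1 - \<beta>)" using True \<kappa>_p_less_q by (simp add: E_def)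
    moreover have "E * (\<sigma> - 1 - \<beta>) < d * q"
      unfolding E_def using assms \<sigma>_large(2) by (intro mult_less_d_q) auto
    ultimately show ?thesis
      using True \<alpha>_nonneg combined shifted d_le mod_shift[OF assms]
      by (simp add: shift_diff_def truncated_sign_def coord_sign_def)
  next
    case False
    have "E * (\<sigma> - 1 - \<beta>) < 0" using False \<kappa>_p_less_q by (simp add: E_def mult_pos_neg)
    moreover have "0 < d * q" using d_pos pq_pos by simp
    moreover have "\<beta> + d - p < \<sigma>" using assms d_le \<sigma>_large(1) by linarith
    ultimately show ?thesis
      using False \<alpha>_nonneg combined shifted mod_shift[OF assms]
      by (simp add: shift_diff_def truncated_sign_def coord_sign_def)
  qed
  thus ?thesis by (simp only: N_def \<alpha>_def)
qed

lemma min_line_range: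
  assumes "0 \<le> \<beta>" "\<beta> < p"
  shows "\<mu> - q \<le> \<mu> - q + \<kappa> * (p - 1) - \<kappa> * \<beta>" "\<mu> - q + \<kappa> * (p - 1) - \<kappa> * \<beta> < \<mu>"
proof -
  have "0 \<le> \<kappa> * (p - 1 - \<beta>)" "\<kappa> * (p - 1 - \<beta>) \<le> \<kappa> * p"
    using assms \<kappa>_pos by (auto intro: mult_left_mono)
  thus "\<mu> - q \<le> \<mu> - q + \<kappa> * (p - 1) - \<kappa> * \<beta>" "\<mu> - q + \<kappa> * (p - 1) - \<kappa> * \<beta> < \<mu>"
    using \<kappa>_p_less_q by (auto simp: right_diff_distrib)
qed

lemma min_line_nonnegD:
  assumes "0 \<le> \<mu> - q + \<kappa> * j"
  shows "p - \<sigma> + d \<le> j"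
proof -
  have "p * (q - \<mu>) \<le> p * (\<kappa> * j)" using assms pq_pos by (intro mult_left_mono) auto
  moreover have "(p - \<sigma>) * q \<le> (\<sigma> - 1) * q"
    using \<sigma>_large(1) pq_pos by (intro mult_right_mono) auto
  ultimately have "(p - \<sigma>) * q \<le> \<kappa> * p * j"
    using p_mult_\<mu> pq_pos by (simp add: algebra_simps)
  hence "\<kappa> * p * (p - \<sigma> + d) \<le> \<kappa> * p * j" using \<kappa>_upper by linarith
  thus ?thesis using \<kappa>_pos pq_pos by simp
qed

lemma shift_diff_min_line:
  assumes "0 \<le> \<beta>" "\<beta> < p"
  shows "shift_diff d ((p - \<sigma> - 1) * q + 1) (\<mu> - q + \<kappa> * (p - 1) - \<kappa> * \<beta>) \<beta> = - of_bool (\<sigma> \<le> \<beta>)"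
proof -
  define E where "E = q - \<kappa> * p"
  define N where "N = (p - \<sigma> - 1) * q + 1"
  define j where "j = p - 1 - \<beta>"
  define \<alpha> where "\<alpha> = \<mu> - q + \<kappa> * (p - 1) - \<kappa> * \<beta>"
  have \<alpha>_eq: "\<alpha> = \<mu> - q + \<kappa> * j" by (simp add: \<alpha>_def j_def right_diff_distrib)
  have "\<alpha> * p + \<beta> * q = N - E * j"
    using p_mult_\<mu> by (simp add: \<alpha>_eq N_def E_def j_def algebra_simps)
  moreover have "0 \<le> E * j" using assms \<kappa>_p_less_q by (simp add: E_def j_def)
  ultimately have below: "\<alpha> * p + \<beta> * q \<le> N"
    and shifted_below: "\<alpha> * p + (\<beta> + d) * q \<le> N \<longleftrightarrow> d * q \<le> E * j"
    by (auto simp: distrib_right)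
  have "shift_diff d N \<alpha> \<beta> = - of_bool (\<sigma> \<le> \<beta>)"
  proof (cases "\<sigma> \<le> \<beta> + d")
    case True
    hence j_le: "j \<le> p - \<sigma> + d - 1" by (simp add: j_def)
    hence "\<not> d * q \<le> E * j" using mult_less_d_q[of j] by (simp add: E_def)
    moreover have "\<alpha> < 0" using j_le min_line_nonnegD[of j] by (force simp: \<alpha>_eq)
    moreover have "\<beta> + d - p < \<sigma>" using assms d_le \<sigma>_large(1) by linarith
    ultimately show ?thesis
      using below shifted_below
      by (simp add: shift_diff_def truncated_sign_def coord_sign_def mod_shift[OF assms])
  next
    case False
    hence "(\<beta> + d) mod p = \<beta> + d" "\<beta> < \<sigma>" using mod_shift[OF assms] d_pos \<sigma>_bounds by auto
    moreover have "d * q \<le> E * j" if "0 \<le> \<alpha>"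
      using that d_q_le_mult[of j] min_line_nonnegD[of j] by (simp add: E_def \<alpha>_eq)
    ultimately show ?thesis
      using below shifted_below False by (simp add: shift_diff_def truncated_sign_def coord_sign_def)
  qed
  thus ?thesis by (simp only: N_def \<alpha>_def)
qed

lemma truncated_sum_extrema:
  fixes r s :: int
  assumes "p < q" "[r * s = 1] (mod p * q)" "[s = - d] (mod p)"
    and "[d * \<sigma> = \<epsilon>] (mod p)" "[s = \<epsilon> * (\<kappa> * p)] (mod q)" "\<epsilon> = 1 \<or> \<epsilon> = - 1"
  shows "\<exists>N t. truncated_sum r N t = \<sigma>" "\<exists>N t. truncated_sum r N t = \<sigma> - p"
proof -
  note line = truncated_sum_on_line[OF assms]
  obtain t where "\<And>N. truncated_sum r N t = (\<Sum>\<beta>\<in>{0..<p}. shift_diff d N (\<kappa> * (\<sigma> - 1) - \<kappa> * \<beta>) \<beta>)"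
    using line[of "\<kappa> * (\<sigma> - 1)"] max_line_range by blast
  hence "truncated_sum r ((\<sigma> - 1) * q) t = (\<Sum>\<beta>\<in>{0..<p}. of_bool (\<beta> < \<sigma>))"
    by (simp only:) (intro sum.cong refl shift_diff_max_line, auto)
  thus "\<exists>N t. truncated_sum r N t = \<sigma>" unfolding sum_of_bool_less_\<sigma> by blast
  obtain t' where "\<And>N. truncated_sum r N t' =
      (\<Sum>\<beta>\<in>{0..<p}. shift_diff d N (\<mu> - q + \<kappa> * (p - 1) - \<kappa> * \<beta>) \<beta>)"
    using line[of "\<mu> - q + \<kappa> * (p - 1)"] min_line_range by blast
  hence "truncated_sum r ((p - \<sigma> - 1) * q + 1) t' = (\<Sum>\<beta>\<in>{0..<p}. - of_bool (\<sigma> \<le> \<beta>))"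
    by (simp only:) (intro sum.cong refl shift_diff_min_line, auto)
  thus "\<exists>N t. truncated_sum r N t = \<sigma> - p" unfolding sum_of_bool_ge_\<sigma> by blast
qed

end

section \<open>Ternary cyclotomic polynomials\<close>

locale ternary_cyclotomic = bezout_pair "int p" "int q" \<mu> \<sigma>
  for p q r :: nat and \<mu> \<sigma> :: int +
  assumes primes: "prime p" "prime q" "prime r" and p_less_q: "p < q" and pq_less_r: "p * q < r"
begin

lemma pq_ge_add: "q + p \<le> p * q"
proof -
  have "2 * q \<le> p * q" using primes(1) by (intro mult_right_mono prime_ge_2_nat) auto
  thus ?thesis using p_less_q by linarith
qed

lemma cyclotomic_poly_binary:
  "cyclotomic_poly (p * q) = (\<Sum>i<p * q. monom (of_int (binary_coeff (int i))) i)"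
proof -
  let ?B = "\<Sum>i<p * q. monom (of_int (binary_coeff (int i))) i :: complex poly"
  have "?B = (\<Sum>i\<in>{0..<int p * int q}. of_int (binary_coeff i) * monom 1 1 ^ nat i)"
    by (rule sum.reindex_bij_witness[where i = nat and j = int])
       (auto simp: monom_power of_int_poly smult_monom nat_less_iff simp flip: of_nat_mult)
  hence "?B * (monom 1 p - 1) * (monom 1 q - 1) = (monom 1 (p * q) - 1) * (monom 1 1 - 1)"
    using binary_coeff_polynomial_identity[of "monom 1 1 :: complex poly"]
    by (simp add: monom_power flip: of_nat_mult)
  also have "\<dots> = cyclotomic_poly (p * q) * (monom 1 p - 1) * (monom 1 q - 1)"
    using primes p_less_q by (intro cyclotomic_poly_two_primes [symmetric]) auto
  finally show ?thesis
    using primes monom_minus_1_nonzero[where ?'a = complex] by (simp add: prime_gt_0_nat)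
qed

lemma coeff_geometric_mult_eq_window:
  "coeff ((\<Sum>i<p. monom 1 i) * (1 - monom 1 q)) j = (of_int (window (int j)) :: complex)"
proof -
  let ?G = "\<Sum>i<p. monom 1 i :: complex poly"
  have G: "coeff ?G k = of_bool (k < p)" for k by (auto simp: coeff_sum)
  have "coeff (?G * (1 - monom 1 q)) j = coeff ?G j - (if q \<le> j then coeff ?G (j - q) else 0)"
    by (simp add: right_diff_distrib mult.commute[of ?G "monom 1 q"] coeff_monom_mult)
  also have "\<dots> = of_int (window (int j))"
    unfolding G window_def using p_less_q by auto
  finally show ?thesis .
qed

lemma cyclotomic_coeff_eq_truncated_sum:
  "cyclotomic_coeff (p * q * r) n = of_int (truncated_sum (int r) (int (n div r)) (int n))"
proof -
  let ?W = "(\<Sum>i<p. monom 1 i) * (1 - monom 1 q) :: complex poly"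
  have pos: "p * q > 0" "r > 0" using primes by (auto simp: prime_gt_0_nat)
  have "p * 1 \<le> p * q" "1 * q \<le> p * q" using pos by (intro mult_mono; auto)+
  hence neq: "p \<noteq> q" "p \<noteq> r" "q \<noteq> r" using p_less_q pq_less_r by auto
  have "cyclotomic_poly (p * q * r) * (1 - monom 1 (p * q)) =
      (\<Sum>i<p * q. monom (of_int (binary_coeff (int i))) (r * i)) * ?W"
    unfolding cyclotomic_poly_three_primes[OF primes neq] cyclotomic_poly_binary
    by (simp add: pcompose_sum pcompose_monom_monom)
  moreover have "coeff ?W j = 0" if "p * q \<le> j" for j
    unfolding coeff_geometric_mult_eq_window window_def using that pq_ge_add
    by (auto simp flip: of_nat_add)
  ultimately have "cyclotomic_coeff (p * q * r) n =
      (\<Sum>i<p * q. if r * i \<le> n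
        then of_int (binary_coeff (int i)) * coeff ?W ((n - r * i) mod (p * q)) else 0)"
    unfolding cyclotomic_coeff_def using pos(1) by (intro coeff_quotient_one_minus_monom)
  also have "\<dots> = (\<Sum>i\<in>{0..<int p * int q}. of_int
      (if i \<le> int (n div r)
        then binary_coeff i * window ((int n - int r * i) mod (int p * int q)) else 0))"
  proof (rule sum.reindex_bij_witness[where i = nat and j = int])
    fix i assume "i \<in> {..<p * q}"
    thus "int i \<in> {0..<int p * int q}" by (simp flip: of_nat_mult)
    have "r * i \<le> n \<longleftrightarrow> i \<le> n div r" using pos by (simp add: less_eq_div_iff_mult_less_eq mult.commute)
    moreover have "(int n - int r * int i) mod (int p * int q) = int ((n - r * i) mod (p * q))"
      if "r * i \<le> n"
      using that by (simp add: of_nat_diff zmod_int)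
    ultimately show "of_int (if int i \<le> int (n div r) then binary_coeff (int i) *
          window ((int n - int r * int i) mod (int p * int q)) else 0) =
        (if r * i \<le> n then of_int (binary_coeff (int i)) * coeff ?W ((n - r * i) mod (p * q)) else 0)"
      by (simp add: coeff_geometric_mult_eq_window)
  qed (auto simp: nat_less_iff simp flip: of_nat_mult)
  finally show ?thesis by (simp add: truncated_sum_def)
qed

lemma range_cyclotomic_coeff:
  "range (cyclotomic_coeff (p * q * r)) = {of_int (truncated_sum (int r) N t) | N t. True}"
proof (intro equalityI subsetI)
  fix c :: complex assume "c \<in> {of_int (truncated_sum (int r) N t) | N t. True}"
  then obtain N t where c: "c = of_int (truncated_sum (int r) N t)" by blast
  show "c \<in> range (cyclotomic_coeff (p * q * r))"
  proof (cases "N < 0")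
    case True
    hence "cyclotomic_coeff (p * q * r) (Suc (degree (cyclotomic_poly (p * q * r)))) = c"
      by (simp add: c truncated_sum_neg cyclotomic_coeff_def coeff_eq_0)
    thus ?thesis by blast
  next
    case False
    define m where "m = nat ((t - int r * N) mod (int p * int q))"
    define n where "n = r * nat N + m"
    have m: "int m = (t - int r * N) mod (int p * int q)" using pq_mult_pos by (simp add: m_def)
    hence "int m < int (p * q)" using pq_mult_pos by simp
    hence "m < p * q" by (simp only: of_nat_less_iff)
    hence "n div r = nat N" using pq_less_r by (simp add: n_def)
    moreover have "[int n = t] (mod int p * int q)"
      using False m by (simp add: n_def cong_def mod_add_right_eq)
    ultimately have "cyclotomic_coeff (p * q * r) n = c"
      using False truncated_sum_cong by (simp add: cyclotomic_coeff_eq_truncated_sum c)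
    thus ?thesis by blast
  qed
qed (use cyclotomic_coeff_eq_truncated_sum in blast)

lemma range_cyclotomic_coeff_eq_interval:
  assumes bounds: "\<And>N t. truncated_sum (int r) N t \<in> {lo..hi}"
    and lo: "truncated_sum (int r) N t = lo" and hi: "truncated_sum (int r) N' t' = hi"
  shows "range (cyclotomic_coeff (p * q * r)) = of_int ` {lo..hi}"
proof -
  have "\<exists>N t. truncated_sum (int r) N t = v" if v: "v \<in> {lo..hi}" for v
  proof (cases "v \<ge> 0")
    case True
    hence "min 0 (truncated_sum (int r) N' t') \<le> v" "v \<le> max 0 (truncated_sum (int r) N' t')"
      using v hi by auto
    thus ?thesis using truncated_sum_intermediate by blast
  next
    case False
    hence "min 0 (truncated_sum (int r) N t) \<le> v" "v \<le> max 0 (truncated_sum (int r) N t)"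
      using v lo by auto
    thus ?thesis using truncated_sum_intermediate by blast
  qed
  thus ?thesis unfolding range_cyclotomic_coeff using bounds by blast
qed

end

section \<open>Choice of the primes\<close>

lemma exists_bezout_pair:
  fixes p q \<sigma> :: int
  assumes \<sigma>_bounds: "0 < \<sigma>" "\<sigma> < p" and q: "1 < q" "[q * \<sigma> = 1] (mod p)"
  obtains \<mu> where "bezout_pair p q \<mu> \<sigma>"
proof -
  obtain k where k: "q * \<sigma> - 1 = p * k" using q(2) by (auto simp: cong_iff_dvd_diff)
  have bezout: "p * (q - k) + q * \<sigma> = p * q + 1" using k by (simp add: right_diff_distrib)
  have "q * 1 \<le> q * \<sigma>" using \<sigma>_bounds q by (intro mult_left_mono) auto
  hence "0 < p * k" using q k by linarith
  hence "0 < k" using \<sigma>_bounds by (simp add: zero_less_mult_iff)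
  have "q * \<sigma> < p * q" using \<sigma>_bounds q by (simp add: mult.commute)
  hence "0 < p * (q - k)" using bezout by linarith
  hence "0 < q - k" using \<sigma>_bounds by (simp add: zero_less_mult_iff)
  thus ?thesis using that[of "q - k"] bezout \<sigma>_bounds \<open>0 < k\<close> by (simp add: bezout_pair_def)
qed

lemma exists_slope:
  fixes p q v d :: int
  assumes v: "0 < v" and d: "0 < d" and p: "0 < p" and q: "p * (v + d) ^ 2 \<le> q"
  obtains \<kappa> where "0 < \<kappa>" "\<kappa> * p * (v + d) \<le> v * q" "(q - \<kappa> * p) * (v + d - 1) < d * q"
proof -
  define T where "T = v + d"
  define \<kappa> where "\<kappa> = (v * q) div (p * T)"
  have T: "1 \<le> T" using v d by (simp add: T_def)
  have pT: "0 < p * T" using p T by simp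
  have "p * T * 1 \<le> p * T * T" using pT T by (intro mult_left_mono) auto
  hence pT_le: "p * T \<le> q" using q by (simp add: T_def power2_eq_square mult.assoc)
  have "v * q mod (p * T) = v * q - \<kappa> * (p * T)" unfolding \<kappa>_def by (metis minus_div_mult_eq_mod)
  hence floor: "\<kappa> * p * T \<le> v * q" "v * q < \<kappa> * p * T + p * T"
    using pos_mod_sign[OF pT, of "v * q"] pos_mod_bound[OF pT, of "v * q"] by (auto simp: mult.assoc)
  have "1 * q \<le> v * q" "1 * q \<le> d * q" using v d pT_le pT by (auto intro!: mult_right_mono)
  hence q_le: "q \<le> v * q" "q \<le> d * q" by (simp_all only: mult_1)
  have "0 < \<kappa>"
    unfolding \<kappa>_def using pT order.trans[OF pT_le q_le(1)] by (simp only: pos_imp_zdiv_pos_iff)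
  have split: "(q - \<kappa> * p) * T = d * q + (v * q - \<kappa> * p * T)" by (simp add: T_def algebra_simps)
  have "(p * T) * T \<le> (q - \<kappa> * p) * T"
    using split floor(1) q_le q by (simp add: T_def power2_eq_square mult.assoc)
  hence "p * T \<le> q - \<kappa> * p" using T by simp
  hence "(q - \<kappa> * p) * (T - 1) < d * q" using split floor(2) by (simp add: right_diff_distrib)
  thus ?thesis using that[of \<kappa>] \<open>0 < \<kappa>\<close> floor(1) by (simp add: T_def)
qed

lemma exists_prime_with_inverse_residues:
  fixes p q a b :: int
  assumes "0 < p" "0 < q" "coprime p q" "coprime a p" "coprime b q"
  obtains r :: nat and s :: int where "prime r" "r > M" "[int r * s = 1] (mod p * q)"
    "[s = a] (mod p)" "[s = b] (mod q)"
proof -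
  obtain s where s: "[s = a] (mod p)" "[s = b] (mod q)"
    using binary_chinese_remainder_int[OF assms(3)] by blast
  have "coprime s p" "coprime s q" using s assms(4,5) cong_imp_coprime cong_sym by blast+
  hence "coprime s (p * q)" by simp
  moreover have "0 < p * q" using assms by simp
  ultimately obtain r :: nat where "prime r" "r > M" "[int r * s = 1] (mod p * q)"
    using exists_prime_inverse_mod by blast
  thus ?thesis using that s by blast
qed

lemma exists_extremal_line:
  fixes p :: nat and \<sigma> d :: int
  assumes p: "prime p" "coprime \<sigma> (int p)"
    and \<sigma>_bounds: "\<sigma> < int p" "int p - \<sigma> < \<sigma>" "\<sigma> \<le> int p - \<sigma> + d" and d: "d \<le> int p - \<sigma>"
  obtains q :: nat and \<mu> \<kappa> :: int where "prime q" "M < q" "extremal_line (int p) (int q) \<mu> \<sigma> d \<kappa>"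
proof -
  have pos: "0 < d" "0 < \<sigma>" "0 < int p" "0 < int p - \<sigma>" using \<sigma>_bounds by linarith+
  obtain q where q: "prime q" "q > M + nat (int p * (int p - \<sigma> + d) ^ 2)"
    "[int q * \<sigma> = 1] (mod int p)"
    using exists_prime_inverse_mod[OF pos(3) p(2)] .
  have q_large: "M < q" "int p * (int p - \<sigma> + d) ^ 2 \<le> int q" using q(2) by linarith+
  have "1 < int q" using prime_gt_1_nat[OF q(1)] by simp
  then obtain \<mu> where \<mu>: "bezout_pair (int p) (int q) \<mu> \<sigma>"
    using exists_bezout_pair[OF pos(2) \<sigma>_bounds(1) _ q(3)] by blast
  obtain \<kappa> where "0 < \<kappa>" "\<kappa> * int p * (int p - \<sigma> + d) \<le> (int p - \<sigma>) * int q"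
    "(int q - \<kappa> * int p) * (int p - \<sigma> + d - 1) < d * int q"
    using exists_slope[OF pos(4,1,3) q_large(2)] .
  hence "extremal_line (int p) (int q) \<mu> \<sigma> d \<kappa>"
    using \<mu> \<sigma>_bounds d by (simp add: extremal_line_def extremal_line_axioms_def)
  thus ?thesis using that q(1) q_large(1) by blast
qed

lemma exists_third_prime:
  fixes p q :: nat and \<mu> \<sigma> d \<kappa> \<epsilon> :: int
  assumes pq: "prime p" "prime q" "p < q" and line: "extremal_line (int p) (int q) \<mu> \<sigma> d \<kappa>"
    and \<epsilon>: "\<epsilon> = 1 \<or> \<epsilon> = - 1" and d\<sigma>: "[d * \<sigma> = \<epsilon>] (mod int p)"
  obtains r where "prime r" "p * q < r"
    "range (cyclotomic_coeff (p * q * r)) = of_int ` {\<sigma> - int p..\<sigma>}"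
proof -
  interpret extremal_line "int p" "int q" \<mu> \<sigma> d \<kappa> by (rule line)
  have "\<kappa> * 1 \<le> \<kappa> * int p" using \<kappa>_pos pq_pos(1) by (intro mult_left_mono) auto
  hence "\<kappa> < int q" using \<kappa>_p_less_q by linarith
  hence "\<not> int q dvd \<kappa>" using \<kappa>_pos by (auto dest: zdvd_imp_le)
  hence "coprime (int q) \<kappa>" using pq(2) by (intro prime_imp_coprime) auto
  hence "coprime (\<epsilon> * (\<kappa> * int p)) (int q)" using \<epsilon> coprime_p_q by (auto simp: coprime_commute)
  moreover have "\<not> int p dvd d" using d_pos d_le \<sigma>_bounds by (auto dest: zdvd_imp_le)
  hence "coprime (- d) (int p)"
    using pq(1) prime_imp_coprime[of "int p" d] by (simp add: coprime_commute)
  ultimately obtain r s where r: "prime r" "r > p * q" "[int r * s = 1] (mod int p * int q)"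
    and s: "[s = - d] (mod int p)" "[s = \<epsilon> * (\<kappa> * int p)] (mod int q)"
    using exists_prime_with_inverse_residues[OF pq_pos coprime_p_q] by metis
  interpret ternary_cyclotomic p q r \<mu> \<sigma>
    using pq r(1,2) by unfold_locales
  have "int p < int q" using pq(3) by simp
  note residues = this r(3) s(1)
  have "truncated_sum (int r) N t \<in> {\<sigma> - int p..\<sigma>}" for N t
    using truncated_sum_bounds[OF residues] d_le d_pos \<sigma>_large by simp
  hence "range (cyclotomic_coeff (p * q * r)) = of_int ` {\<sigma> - int p..\<sigma>}"
    using truncated_sum_extrema[OF residues d\<sigma> s(2) \<epsilon>] range_cyclotomic_coeff_eq_interval by metis
  thus ?thesis using that r(1,2) by blast
qed

lemma exists_ternary_coeff_interval:
  fixes p :: nat and \<sigma> d \<epsilon> :: int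
  assumes p: "prime p" and \<epsilon>: "\<epsilon> = 1 \<or> \<epsilon> = - 1" and d\<sigma>: "[d * \<sigma> = \<epsilon>] (mod int p)"
    and \<sigma>_bounds: "\<sigma> < int p" "int p - \<sigma> < \<sigma>" "\<sigma> \<le> int p - \<sigma> + d" and d: "d \<le> int p - \<sigma>"
  shows "\<exists>q r. M < q \<and> prime q \<and> prime r \<and> p < q \<and> p * q < r \<and>
    range (cyclotomic_coeff (p * q * r)) = of_int ` {\<sigma> - int p..\<sigma>}"
proof -
  have "[\<sigma> * (\<epsilon> * d) = 1] (mod int p)"
    using cong_scalar_left[OF d\<sigma>, of \<epsilon>] \<epsilon> by (auto simp: mult_ac)
  hence "coprime \<sigma> (int p)" by (metis coprime_iff_invertible_int)
  then obtain q :: nat and \<mu> \<kappa> :: int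
    where q: "prime q" "max M p < q" "extremal_line (int p) (int q) \<mu> \<sigma> d \<kappa>"
    using exists_extremal_line[OF p _ \<sigma>_bounds d] by metis
  moreover have "p < q" using q(2) by simp
  from exists_third_prime[OF p q(1) this q(3) \<epsilon> d\<sigma>]
  obtain r where "prime r" "p * q < r"
    "range (cyclotomic_coeff (p * q * r)) = of_int ` {\<sigma> - int p..\<sigma>}" .
  ultimately show ?thesis by auto
qed

lemma exists_signed_half_quotient:
  fixes p u c :: int
  assumes "0 < p" "odd p" "coprime u p"
  obtains d \<epsilon> where "\<epsilon> = 1 \<or> \<epsilon> = - 1" "0 \<le> d" "2 * d < p" "[d * u = c * \<epsilon>] (mod p)"
proof -
  obtain x where "[u * x = 1] (mod p)" using cong_solve_coprime_int[OF assms(3)] by blast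
  define y where "y = (c * x) mod p"
  have y: "0 \<le> y" "y < p" using assms(1) by (auto simp: y_def)
  have "[y * u = c * x * u] (mod p)" unfolding y_def by (intro cong_scalar_right) (simp add: cong_def)
  also have "c * x * u = c * (u * x)" by simp
  also have "[c * (u * x) = c * 1] (mod p)" using \<open>[u * x = 1] (mod p)\<close> by (rule cong_scalar_left)
  finally have yu: "[y * u = c] (mod p)" by simp
  show ?thesis
  proof (cases "2 * y < p")
    case True
    thus ?thesis using that[of 1 y] y yu by simp
  next
    case False
    hence "2 * (p - y) < p" using assms(2) by presburger
    moreover have "[p * u - y * u = 0 - c] (mod p)"
      using yu by (intro cong_diff) (auto simp: cong_def)
    hence "[(p - y) * u = c * - 1] (mod p)" by (simp add: left_diff_distrib)
    ultimately show ?thesis using that[of "- 1" "p - y"] y by simp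
  qed
qed

lemma half_residue_ge:
  fixes p u d \<epsilon> :: int
  assumes u: "3 \<le> u" "u ^ 2 - u + 3 \<le> p" and \<epsilon>: "\<epsilon> = 1 \<or> \<epsilon> = - 1"
    and d: "0 \<le> d" "[d * u = 2 * \<epsilon>] (mod p)"
  shows "u \<le> d"
proof (rule ccontr)
  assume "\<not> u \<le> d"
  have dvd: "p dvd d * u - 2 * \<epsilon>" using d(2) by (simp add: cong_iff_dvd_diff)
  have "3 * u \<le> u ^ 2" using u(1) by (simp add: power2_eq_square)
  hence "2 < p" using u by linarith
  have "d \<noteq> 0"
  proof
    assume "d = 0"
    hence "p dvd 2" using dvd \<epsilon> by auto
    thus False using \<open>2 < p\<close> zdvd_imp_le by fastforce
  qed
  hence "1 * u \<le> d * u" using d(1) u(1) by (intro mult_right_mono) auto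
  hence "u \<le> d * u" by (simp only: mult_1)
  moreover have "d * u \<le> (u - 1) * u" using \<open>\<not> u \<le> d\<close> u(1) by (intro mult_right_mono) auto
  hence "d * u \<le> u ^ 2 - u" by (simp add: power2_eq_square left_diff_distrib)
  moreover have "- 1 \<le> \<epsilon>" "\<epsilon> \<le> 1" using \<epsilon> by auto
  ultimately have "0 < d * u - 2 * \<epsilon>" "d * u - 2 * \<epsilon> < p" using u by linarith+
  thus False using zdvd_imp_le[OF dvd] by linarith
qed

lemma half_residue_le:
  fixes p u d \<epsilon> :: int
  assumes u: "3 \<le> u" "odd u" "u ^ 2 - u + 3 \<le> p" and p: "odd p" and \<epsilon>: "\<epsilon> = 1 \<or> \<epsilon> = - 1"
    and d: "2 * d < p" "[d * u = 2 * \<epsilon>] (mod p)"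
  shows "2 * d \<le> p - u"
proof (rule ccontr)
  define j where "j = p - 2 * d"
  assume "\<not> 2 * d \<le> p - u"
  hence "j < u" by (simp add: j_def)
  moreover have "odd j" using p by (simp add: j_def)
  ultimately have j: "1 \<le> j" "j \<le> u - 2" using d(1) u(2) unfolding j_def by presburger+
  have "p dvd d * u - 2 * \<epsilon>" using d(2) by (simp add: cong_iff_dvd_diff)
  hence "p dvd p * u - 2 * (d * u - 2 * \<epsilon>)" by (rule dvd_diff[OF dvd_triv_left dvd_mult])
  also have "p * u - 2 * (d * u - 2 * \<epsilon>) = j * u + 4 * \<epsilon>" by (simp add: j_def algebra_simps)
  finally have dvd: "p dvd j * u + 4 * \<epsilon>" .
  have "odd (j * u + 4 * \<epsilon>)" using \<open>odd j\<close> u(2) by simp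
  hence "j * u + 4 * \<epsilon> \<noteq> 0" by (metis even_zero)
  moreover have "1 * u \<le> j * u" "j * u \<le> (u - 2) * u" using j u(1) by (auto intro: mult_right_mono)
  hence "u \<le> j * u" "j * u \<le> u ^ 2 - 2 * u"
    by (simp_all only: mult_1 left_diff_distrib power2_eq_square)
  moreover have "- 1 \<le> \<epsilon>" "\<epsilon> \<le> 1" using \<epsilon> by auto
  ultimately have "\<bar>j * u + 4 * \<epsilon>\<bar> < p" "j * u + 4 * \<epsilon> \<noteq> 0" using u by linarith+
  thus False using dvd_imp_le_int[OF _ dvd] by linarith
qed

lemma exists_inverse_parameters:
  fixes l p :: nat
  assumes l: "1 \<le> l" "odd l" and p: "prime p" "l ^ 2 + 3 * l + 5 \<le> p"
  obtains \<sigma> d \<epsilon> :: int where "2 * \<sigma> = int p + int l + 2"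
    "\<epsilon> = 1 \<or> \<epsilon> = - 1" "[d * \<sigma> = \<epsilon>] (mod int p)" "\<sigma> < int p"
    "int p - \<sigma> < \<sigma>" "\<sigma> \<le> int p - \<sigma> + d" "d \<le> int p - \<sigma>"
proof -
  define u where "u = int l + 2"
  have "2 < p" using p(2) by linarith
  hence "odd p" using p(1) prime_odd_nat by blast
  have "int (l ^ 2 + 3 * l + 5) \<le> int p" using p(2) by (simp only: of_nat_le_iff)
  hence u: "3 \<le> u" "odd u" "u ^ 2 - u + 3 \<le> int p"
    using l by (auto simp: u_def power2_eq_square algebra_simps)
  have "3 * u \<le> u ^ 2" using u(1) by (simp add: power2_eq_square)
  hence "u < int p" using u by linarith
  have "even (int p + u)" using \<open>odd p\<close> u(2) by simp
  define \<sigma> where "\<sigma> = (int p + u) div 2"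
  have \<sigma>: "2 * \<sigma> = int p + u" using \<open>even (int p + u)\<close> by (simp add: \<sigma>_def)
  have "\<not> int p dvd u" using u(1) \<open>u < int p\<close> by (auto dest: zdvd_imp_le)
  hence "coprime u (int p)" using p(1) prime_imp_coprime[of "int p" u] by (simp add: coprime_commute)
  moreover have "0 < int p" "odd (int p)" using \<open>odd p\<close> \<open>2 < p\<close> by simp_all
  ultimately obtain d \<epsilon> where \<epsilon>: "\<epsilon> = 1 \<or> \<epsilon> = - 1"
    and d: "0 \<le> d" "2 * d < int p" and du: "[d * u = 2 * \<epsilon>] (mod int p)"
    using exists_signed_half_quotient[of "int p" u 2] by metis
  have d_bounds: "u \<le> d" "2 * d \<le> int p - u"
    using half_residue_ge[OF u(1,3) \<epsilon> d(1) du] half_residue_le[OF u _ \<epsilon> d(2) du] \<open>odd p\<close> by auto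
  have "[2 * (d * \<sigma>) = 2 * \<epsilon>] (mod int p)"
  proof -
    have "2 * (d * \<sigma>) = d * u + int p * d"
      using arg_cong[OF \<sigma>, of "\<lambda>z. d * z"] by (simp add: algebra_simps)
    thus ?thesis using du by (simp add: cong_def)
  qed
  moreover have "coprime 2 (int p)" using \<open>odd p\<close> by simp
  ultimately have d\<sigma>: "[d * \<sigma> = \<epsilon>] (mod int p)" by (simp only: cong_mult_lcancel)
  show ?thesis
  proof (rule that[OF _ \<epsilon> d\<sigma>])
    show "2 * \<sigma> = int p + int l + 2" using \<sigma> by (simp add: u_def)
    show "\<sigma> < int p" "int p - \<sigma> < \<sigma>" "\<sigma> \<le> int p - \<sigma> + d" "d \<le> int p - \<sigma>"
      using \<sigma> d_bounds u(1) \<open>u < int p\<close> by linarith+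
  qed
qed

lemma exists_increasing_sequence:
  fixes P :: "nat \<Rightarrow> 'a \<Rightarrow> bool"
  assumes "\<And>M. \<exists>q r. M < q \<and> P q r"
  obtains q r where "\<And>j. P (q j) (r j)" "\<And>j. q j < q (Suc j)"
proof -
  have "\<exists>x. P (fst x) (snd x) \<and> M < fst x" for M using assms[of M] by auto
  then obtain f where "\<And>j. P (fst (f j)) (snd (f j)) \<and> fst (f j) < fst (f (Suc j))"
    using dependent_nat_choice[of "\<lambda>_ x. P (fst x) (snd x)" "\<lambda>_ x y. fst x < fst y"] by blast
  thus ?thesis using that[of "fst \<circ> f" "snd \<circ> f"] by simp
qed

theorem theorem1:
  fixes l p :: nat
  assumes "l \<ge> 1" and "odd l"
    and "prime p" and "p \<ge> l^2 + 3 * l + 5"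
  shows "\<exists>q r :: nat \<Rightarrow> nat.
    (\<forall>j. prime (q j) \<and> prime (r j) \<and> p < q j \<and> p * q j < r j \<and> q j < q (Suc j) \<and>
       {cyclotomic_coeff (p * q j * r j) k | k. k \<ge> 0} =
         of_int ` {m :: int. - ((real p - real l - 2) / 2) \<le> real_of_int m \<and>
                             real_of_int m \<le> (real p + real l + 2) / 2})"
proof -
  obtain \<sigma> d \<epsilon> :: int where \<sigma>: "2 * \<sigma> = int p + int l + 2"
    and parameters: "\<epsilon> = 1 \<or> \<epsilon> = - 1" "[d * \<sigma> = \<epsilon>] (mod int p)" "\<sigma> < int p"
      "int p - \<sigma> < \<sigma>" "\<sigma> \<le> int p - \<sigma> + d" "d \<le> int p - \<sigma>"
    by (rule exists_inverse_parameters[OF assms])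
  have "real_of_int (2 * \<sigma>) = real_of_int (int p + int l + 2)" by (simp only: \<sigma>)
  hence ends: "real_of_int (\<sigma> - int p) = - ((real p - real l - 2) / 2)"
    "real_of_int \<sigma> = (real p + real l + 2) / 2"
    by (simp_all add: field_simps)
  have interval: "{\<sigma> - int p..\<sigma>} = {m. - ((real p - real l - 2) / 2) \<le> real_of_int m \<and>
      real_of_int m \<le> (real p + real l + 2) / 2}"
    unfolding ends [symmetric] of_int_le_iff by auto
  obtain q r where qr: "\<And>j. prime (q j) \<and> prime (r j) \<and> p < q j \<and> p * q j < r j \<and>
      range (cyclotomic_coeff (p * q j * r j)) = of_int ` {\<sigma> - int p..\<sigma>}"
    and increasing: "\<And>j. q j < q (Suc j)"
    by (rule exists_increasing_sequence[OF exists_ternary_coeff_interval[OF assms(3) parameters]])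
      (rule that)
  have "{cyclotomic_coeff n k | k. k \<ge> 0} = range (cyclotomic_coeff n)" for n by auto
  thus ?thesis using qr increasing unfolding interval by (intro exI[of _ q] exI[of _ r]) simp
qed

end
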